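(* Let $M\ge1$ and let $\gamma_{m,i}$ ($1\le m\le M$, $0\le i\le m-1$) be real numbers with $\sum_{i=0}^{m-1}\gamma_{m,i}=1$ for each $m$. Define $\beta_{j,m}$, $1\le j\le5$, $0\le m\le M$, by $\beta_{1,0}=\beta_{2,0}=\beta_{3,0}=\beta_{4,0}=\beta_{5,0}=0$ and, for $1\le m\le M$, $$\beta_{1,m}=1+\sum_{i=0}^{m-1}\gamma_{m,i}\beta_{1,i},$$ $$\beta_{2,m}=\frac12+\sum_{i=0}^{m-1}\gamma_{m,i}\beta_{2,i}+\sum_{i=0}^{m-1}\gamma_{m,i}\beta_{4,i},$$ $$\beta_{3,m}=\frac23+\frac16\Big(\sum_{i=0}^{m-1}\gamma_{m,i}\beta_{1,i}\Big)^3-\frac14\Big(\sum_{i=0}^{m-1}\gamma_{m,i}\beta_{1,i}\Big)\Big(\sum_{i=0}^{m-1}\gamma_{m,i}\beta_{1,i}^2\Big)+\frac1{12}\sum_{i=0}^{m-1}\gamma_{m,i}\beta_{1,i}^3+\sum_{i=0}^{m-1}\gamma_{m,i}\beta_{3,i}+\sum_{i=0}^{m-1}\gamma_{m,i}\beta_{5,i},$$ $$\beta_{4,m}=1+\sum_{i=0}^{m-1}\gamma_{m,i}\beta_{4,i},\qquad \beta_{5,m}=2+\sum_{i=0}^{m-1}\gamma_{m,i}\beta_{5,i}.$$ Assume $\beta_{1,M}>0$. Let $f(x,t):\mathbb{R}\times[0,\infty)\to\mathbb{R}$ be smooth with $f(0,0)=0$, $f_x(0,0)=0$, and let $\bar\Sigma_0=\{(x,y)\in\mathbb{R}^2: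 y\le f(x,0)\}$. For $\tau>0$ and $m=1,\dots,M$ let $$\bar\Sigma_m=\Big\{p\in\mathbb{R}^2:\ \Big(G_\tau*\sum_{i=0}^{m-1}\gamma_{m,i}\mathbf{1}_{\bar\Sigma_i}\Big)(p)\ge\tfrac12\Big\},$$ and let $h_i$ be defined by $\bar\Sigma_i=\{(x,y): y\le h_i(x)\}$ (near the origin, for small $\tau$), so $h_0(x)=f(x,0)$. Then for every $0\le i\le M$, as $\tau\to0^+$, $$h_i(0)=\tau\beta_{1,i}f_{xx}+\tau^2\big(\beta_{2,i}f_{xxxx}-\beta_{3,i}f_{xx}^3\big)+O(\tau^3),$$ $$\frac{d^2}{dx^2}h_i(0)=f_{xx}+\tau\big(\beta_{4,i}f_{xxxx}-\beta_{5,i}f_{xx}^3\big)+O(\tau^2),$$ where the derivatives of $f$ are evaluated at $(0,0)$. Furthermore, the conditions $$\frac{\beta_{2,M}}{\beta_{1,M}^2}=\frac12,\qquad \frac{\beta_{3,M}}{\beta_{1,M}^2}=1$$ are necessary and sufficient for second order accuracy (in two dimensions, for motion by mean curvature) of the $M$-stage threshold dynamics algorithm with coefficients $\gamma_{m,i}$.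
   Context: $G_t(p)=\frac{1}{4\pi t}e^{-|p|^2/(4t)}$ is the Gaussian kernel on $\mathbb{R}^2$, $*$ is convolution, $\mathbf{1}_\Sigma$ is the characteristic function of $\Sigma$. $M$-stage threshold dynamics algorithm with coefficients $\gamma_{m,i}$: for a time step size $\delta t>0$ put $\tau=\delta t/\beta_{1,M}$; given $\Sigma^k$, put $\bar\Sigma_0=\Sigma^k$, form $\bar\Sigma_1,\dots,\bar\Sigma_M$ by the thresholding formula in the claim, and set $\Sigma^{k+1}=\bar\Sigma_M$. Second order accuracy in two dimensions: for every smooth $f(x,t)$ with $f(0,0)=0$, $f_x(0,0)=0$ whose graph moves by mean curvature, i.e. $f_t=f_{xx}/(1+f_x^2)$, one step of the algorithm started from $\Sigma^k=\{(x,y): y\le f(x,0)\}$ with time step $\delta t$ produces an interface $y=h_M(x)$ near the origin with $h_M(0)=f(0,\delta t)+O(\delta t^3)$ as $\delta t\to0^+$; here $f(0,t)=tf_{xx}+t^2\big[\tfrac12f_{xxxx}-f_{xx}^3\big]+O(t^3)$ with derivatives at $(0,0)$. *)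

theory Defs
  imports "HOL-Analysis.Analysis" "HOL-Library.Landau_Symbols"
begin

definition gauss :: "real \<Rightarrow> real \<times> real \<Rightarrow> real" where
  "gauss t p = 1 / (4 * pi * t) * exp (- (norm p)\<^sup>2 / (4 * t))"

definition conv :: "(real \<times> real \<Rightarrow> real) \<Rightarrow> (real \<times> real \<Rightarrow> real) \<Rightarrow> real \<times> real \<Rightarrow> real" where
  "conv F G p = (LINT q|lborel. F (p - q) * G q)"

text \<open>The argument \<open>\<gamma>\<close> is used as \<open>\<gamma> m i\<close> with \<open>i < m\<close>, that is with row index \<open>Suc m\<close> and
  \<open>i \<le> m\<close> below; \<open>stage \<gamma> \<tau> S m\<close> is the \<open>m\<close>-th intermediate set started from \<open>S\<close>.\<close>

fun stage :: "(nat \<Rightarrow> nat \<Rightarrow> real) \<Rightarrow> real \<Rightarrow> (real \<times> real) set \<Rightarrow> nat \<Rightarrow> (real \<times> real) set" where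
  "stage \<gamma> \<tau> S 0 = S"
| "stage \<gamma> \<tau> S (Suc m) =
     {p. conv (gauss \<tau>) (\<lambda>q. \<Sum>i\<le>m. \<gamma> (Suc m) i * indicator (stage \<gamma> \<tau> S i) q) p \<ge> 1 / 2}"

fun beta1 :: "(nat \<Rightarrow> nat \<Rightarrow> real) \<Rightarrow> nat \<Rightarrow> real" where
  "beta1 \<gamma> 0 = 0"
| "beta1 \<gamma> (Suc m) = 1 + (\<Sum>i\<le>m. \<gamma> (Suc m) i * beta1 \<gamma> i)"

fun beta4 :: "(nat \<Rightarrow> nat \<Rightarrow> real) \<Rightarrow> nat \<Rightarrow> real" where
  "beta4 \<gamma> 0 = 0"
| "beta4 \<gamma> (Suc m) = 1 + (\<Sum>i\<le>m. \<gamma> (Suc m) i * beta4 \<gamma> i)"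

fun beta5 :: "(nat \<Rightarrow> nat \<Rightarrow> real) \<Rightarrow> nat \<Rightarrow> real" where
  "beta5 \<gamma> 0 = 0"
| "beta5 \<gamma> (Suc m) = 2 + (\<Sum>i\<le>m. \<gamma> (Suc m) i * beta5 \<gamma> i)"

fun beta2 :: "(nat \<Rightarrow> nat \<Rightarrow> real) \<Rightarrow> nat \<Rightarrow> real" where
  "beta2 \<gamma> 0 = 0"
| "beta2 \<gamma> (Suc m) = 1 / 2 + (\<Sum>i\<le>m. \<gamma> (Suc m) i * beta2 \<gamma> i)
     + (\<Sum>i\<le>m. \<gamma> (Suc m) i * beta4 \<gamma> i)"

fun beta3 :: "(nat \<Rightarrow> nat \<Rightarrow> real) \<Rightarrow> nat \<Rightarrow> real" where
  "beta3 \<gamma> 0 = 0"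
| "beta3 \<gamma> (Suc m) = 2 / 3
     + 1 / 6 * (\<Sum>i\<le>m. \<gamma> (Suc m) i * beta1 \<gamma> i) ^ 3
     - 1 / 4 * (\<Sum>i\<le>m. \<gamma> (Suc m) i * beta1 \<gamma> i) * (\<Sum>i\<le>m. \<gamma> (Suc m) i * (beta1 \<gamma> i)\<^sup>2)
     + 1 / 12 * (\<Sum>i\<le>m. \<gamma> (Suc m) i * beta1 \<gamma> i ^ 3)
     + (\<Sum>i\<le>m. \<gamma> (Suc m) i * beta3 \<gamma> i)
     + (\<Sum>i\<le>m. \<gamma> (Suc m) i * beta5 \<gamma> i)"

text \<open>Functions \<open>f x t\<close> on \<open>\<real> \<times> [0, \<infinity>)\<close> whose partial derivatives up to order \<open>k\<close> exist and are
  continuous up to the boundary; the \<open>t\<close>-derivative at \<open>t = 0\<close> is one-sided. Values at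
  \<open>t < 0\<close> are irrelevant.\<close>

fun Ck_halfplane :: "nat \<Rightarrow> (real \<Rightarrow> real \<Rightarrow> real) \<Rightarrow> bool" where
  "Ck_halfplane 0 f \<longleftrightarrow> continuous_on (UNIV \<times> {0..}) (\<lambda>(x, t). f x t)"
| "Ck_halfplane (Suc k) f \<longleftrightarrow>
     continuous_on (UNIV \<times> {0..}) (\<lambda>(x, t). f x t) \<and>
     (\<exists>fx ft.
        (\<forall>x. \<forall>t\<ge>0. ((\<lambda>\<xi>. f \<xi> t) has_real_derivative fx x t) (at x)) \<and>
        (\<forall>x. \<forall>t\<ge>0. ((\<lambda>s. f x s) has_real_derivative ft x t) (at t within {0..})) \<and>
        Ck_halfplane k fx \<and> Ck_halfplane k ft)"

definition smooth_halfplane :: "(real \<Rightarrow> real \<Rightarrow> real) \<Rightarrow> bool" where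
  "smooth_halfplane f \<longleftrightarrow> (\<forall>k. Ck_halfplane k f)"

definition subgraph :: "(real \<Rightarrow> real) \<Rightarrow> (real \<times> real) set" where
  "subgraph g = {(x, y). y \<le> g x}"

text \<open>In the box \<open>(-r, r)\<^sup>2\<close> the set \<open>S\<close> is the region below the graph of \<open>h\<close>, and the graph does
  not leave the box through its top or bottom. The latter makes \<open>h\<close> unique near the origin.\<close>

definition interface_near :: "real \<Rightarrow> (real \<times> real) set \<Rightarrow> (real \<Rightarrow> real) \<Rightarrow> bool" where
  "interface_near r S h \<longleftrightarrow>
     (\<forall>x. \<bar>x\<bar> < r \<longrightarrow> \<bar>h x\<bar> < r \<and> (\<forall>y. \<bar>y\<bar> < r \<longrightarrow> ((x, y) \<in> S \<longleftrightarrow> y \<le> h x)))"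

lemma interface_near_unique:
  assumes "interface_near r S h" "interface_near r' S h'" "\<bar>x\<bar> < r" "\<bar>x\<bar> < r'"
  shows "h x = h' x"
proof -
  have *: "k x = k' x" if k: "interface_near s S k" "interface_near s' S k'"
    and x: "\<bar>x\<bar> < s" "s \<le> s'" for s s' k k'
  proof -
    have a: "\<bar>k x\<bar> < s" and b: "\<And>y. \<bar>y\<bar> < s \<Longrightarrow> y \<le> k x \<longleftrightarrow> y \<le> k' x"
      using k x unfolding interface_near_def by force+
    have "k x \<le> k' x" using a b by blast
    moreover have "\<not> k x < k' x"
    proof
      assume "k x < k' x"
      then have "k x < min s (k' x)" using a by auto
      then obtain y where "k x < y" "y < min s (k' x)" using dense by blast
      moreover from this have "\<bar>y\<bar> < s" using a by (simp add: abs_less_iff)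
      ultimately show False using b[of y] by auto
    qed
    ultimately show ?thesis by simp
  qed
  show ?thesis
    using *[of r h r' h'] *[of r' h' r h] assms by (cases "r \<le> r'") auto
qed

definition moves_by_mean_curvature :: "(real \<Rightarrow> real \<Rightarrow> real) \<Rightarrow> bool" where
  "moves_by_mean_curvature f \<longleftrightarrow>
     (\<forall>x. \<forall>t\<ge>0. ((\<lambda>s. f x s) has_real_derivative
        (deriv ^^ 2) (\<lambda>\<xi>. f \<xi> t) x / (1 + (deriv (\<lambda>\<xi>. f \<xi> t) x)\<^sup>2)) (at t within {0..}))"

definition threshold_step ::
    "(nat \<Rightarrow> nat \<Rightarrow> real) \<Rightarrow> nat \<Rightarrow> real \<Rightarrow> (real \<times> real) set \<Rightarrow> (real \<times> real) set" where
  "threshold_step \<gamma> M \<delta>t S = stage \<gamma> (\<delta>t / beta1 \<gamma> M) S M"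

definition second_order_accurate :: "(nat \<Rightarrow> nat \<Rightarrow> real) \<Rightarrow> nat \<Rightarrow> bool" where
  "second_order_accurate \<gamma> M \<longleftrightarrow>
     (\<forall>f. smooth_halfplane f \<and> f 0 0 = 0 \<and> deriv (\<lambda>x. f x 0) 0 = 0 \<and> moves_by_mean_curvature f \<longrightarrow>
        (\<exists>r>0. \<exists>h :: real \<Rightarrow> real \<Rightarrow> real.
           (\<forall>\<^sub>F \<delta>t in at_right 0.
              interface_near r (threshold_step \<gamma> M \<delta>t (subgraph (\<lambda>x. f x 0))) (h \<delta>t)) \<and>
           (\<lambda>\<delta>t. h \<delta>t 0 - f 0 \<delta>t) \<in> O[at_right 0](\<lambda>\<delta>t. \<delta>t ^ 3)))"

end

theory Submission
  imports Defs "HOL-Probability.Probability"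
begin

text \<open>Put \<open>\<sigma> = sqrt \<tau>\<close> and blow up space by \<open>1 / \<sigma>\<close>, so that every stage uses the heat kernel at time 1.
  Where the earlier sets are subgraphs of \<open>k i\<close>, integrating out the vertical variable turns the equation
  of the new interface \<open>y = \<kappa> x\<close> into \<open>\<Sum>i. w i * \<integral>u. gs u * E (k i (x + u) - y) = 0\<close>, up to
  a far-field error smaller than any power of \<open>\<sigma>\<close>; here \<open>E\<close> is the odd antiderivative of the one-dimensional
  kernel \<open>gs\<close>. To leading order the left-hand side is strictly decreasing in \<open>y\<close>, which gives \<open>\<kappa>\<close>. The blown-up
  initial graph is \<open>\<sigma> f2 x\<^sup>2 / 2 + \<sigma>\<^sup>2 f3 x\<^sup>3 / 6 + \<dots>\<close>, so the argument of \<open>E\<close> is of order \<open>\<sigma> (1 + \<bar>x\<bar>)\<close> and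
  \<open>E w = gs 0 * (w - w\<^sup>3 / 12) + O(w\<^sup>5)\<close> reduces everything to Gaussian moments of polynomials.
  An expansion of all interfaces to relative order \<open>\<sigma>\<^sup>4\<close>, with error \<open>\<sigma>\<^sup>5 (1 + \<bar>x\<bar>)\<^sup>6\<close> uniformly near the origin, is
  therefore inherited from stage to stage. The second derivative at 0 needs no expansion of derivatives of the
  \<open>k i\<close>: implicit differentiation puts all derivatives on the kernel.

  Necessity of the two conditions is tested on the hairclip solutions \<open>sinh y = a e\<^sup>-\<^sup>t cos x\<close> of motion by mean
  curvature, for which \<open>f2 = - T\<close> and \<open>f4 = T - 3 T\<^sup>3\<close> at the origin with \<open>T = a / sqrt (a\<^sup>2 + 1)\<close>; two values of \<open>a\<close>
  separate the conditions.\<close>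

section \<open>The heat kernel at time 1 and its derivatives\<close>

text \<open>An error O(\<tau>^3) in the height is of size \<sigma>^6, hence \<sigma>^5 after the
  blow-up. This is why a \<sigma>^4 coefficient is carried along; it is odd in x, so at the origin
  neither its value nor its second derivative survives. The weights may be negative, so the
  thresholded function need not be monotone in y and no comparison principle applies. Existence and
  uniqueness of the new height therefore rest on quantitative sign and slope bounds for the tangent
  half plane, which are stable under the O(\<sigma>) error made by replacing each earlier set by
  that half plane. Each earlier set is a known subgraph only in a box of fixed size before the
  blow-up. A column in the inner half of the box sees everything outside the box at a distance of
  order 1/\<sigma>, where the Gaussian is negligible; the box is halved at every stage to keep this
  margin. The cubic term of E contains the unknown \<kappa>, so each stage is expanded twice, the
  first time with E replaced by its linear part.\<close>

definition gs :: "real \<Rightarrow> real" where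
  "gs x = exp (- x\<^sup>2 / 4) / sqrt (4 * pi)"

text \<open>The recursion is the product rule (p gs)' = (p' - (x/2) p) gs, so \<open>gd j\<close>
  below is the j-th derivative of \<open>gs\<close>; up to sign and scaling these are the Hermite
  polynomials. Having all derivatives in the form polynomial times \<open>gs\<close> yields
  integrability against polynomial growth for every order at once.\<close>

primrec herm :: "nat \<Rightarrow> real poly" where
  "herm 0 = 1"
| "herm (Suc j) = pderiv (herm j) - [:0, 1/2:] * herm j"

definition gd :: "nat \<Rightarrow> real \<Rightarrow> real" where
  "gd j x = poly (herm j) x * gs x"

lemma gs_eq_normal_density: "gs = normal_density 0 (sqrt 2)"
  by (simp add: fun_eq_iff gs_def normal_density_def)

lemma gs_pos: "gs x > 0"
  by (simp add: gs_def)

lemma gs_even [simp]: "gs (- x) = gs x"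
  by (simp add: gs_def)

lemma gd_0: "gd 0 = gs"
  by (simp add: gd_def fun_eq_iff)

lemma gd_1: "gd 1 x = - x / 2 * gs x" and gd_2: "gd 2 x = (x\<^sup>2 / 4 - 1 / 2) * gs x"
  by (simp_all add: gd_def numeral_2_eq_2 pderiv_pCons power2_eq_square field_simps)

lemma gs_deriv: "(gs has_real_derivative - x / 2 * gs x) (at x)"
  unfolding gs_def
  by (auto intro!: derivative_eq_intros simp: field_simps)

lemma gd_deriv [derivative_intros]:
  assumes "(f has_real_derivative D) (at x within S)"
  shows "((\<lambda>x. gd j (f x)) has_real_derivative gd (Suc j) (f x) * D) (at x within S)"
proof -
  have "(gd j has_real_derivative gd (Suc j) y) (at y)" for y
    unfolding gd_def
    by (auto intro!: derivative_eq_intros poly_DERIV gs_deriv simp: algebra_simps)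
  from DERIV_chain2[OF this assms] show ?thesis .
qed

lemma continuous_on_gd: "continuous_on S (gd j)"
  by (rule DERIV_continuous_on[where D = "gd (Suc j)"]) (auto intro!: derivative_eq_intros)

lemma borel_measurable_gd [measurable]: "gd j \<in> borel_measurable borel"
  by (rule borel_measurable_continuous_onI[OF continuous_on_gd])

lemma borel_measurable_gs [measurable]: "gs \<in> borel_measurable borel"
  unfolding gs_eq_normal_density by simp

lemma integrable_abs_power_normal:
  fixes a :: real
  assumes "\<sigma> > 0"
  shows "integrable lborel (\<lambda>x. (a + \<bar>x\<bar>) ^ n * normal_density 0 \<sigma> x)"
proof -
  have "integrable lborel (\<lambda>x. \<Sum>k\<le>n. of_nat (n choose k) * a ^ k * (normal_density 0 \<sigma> x * \<bar>x - 0\<bar> ^ (n - k)))"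
    by (intro Bochner_Integration.integrable_sum integrable_mult_right integrable_normal_moment_abs[OF assms])
  also have "(\<lambda>x. \<Sum>k\<le>n. of_nat (n choose k) * a ^ k * (normal_density 0 \<sigma> x * \<bar>x - 0\<bar> ^ (n - k)))
      = (\<lambda>x. (a + \<bar>x\<bar>) ^ n * normal_density 0 \<sigma> x)"
    by (simp add: fun_eq_iff binomial_ring sum_distrib_left sum_distrib_right mult_ac)
  finally show ?thesis .
qed

lemma poly_abs_bound:
  fixes p :: "real poly"
  obtains C n where "C \<ge> 0" "\<And>x. \<bar>poly p x\<bar> \<le> C * (1 + \<bar>x\<bar>) ^ n"
proof -
  have "\<exists>C n. C \<ge> 0 \<and> (\<forall>x. \<bar>poly p x\<bar> \<le> C * (1 + \<bar>x\<bar>) ^ n)"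
  proof (induction p)
    case 0
    show ?case by (auto intro!: exI[of _ 0])
  next
    case (pCons a p)
    then obtain C n where C: "C \<ge> 0" "\<And>x. \<bar>poly p x\<bar> \<le> C * (1 + \<bar>x\<bar>) ^ n" by blast
    have "\<bar>poly (pCons a p) x\<bar> \<le> (\<bar>a\<bar> + C) * (1 + \<bar>x\<bar>) ^ Suc n" for x
    proof -
      have "\<bar>poly (pCons a p) x\<bar> \<le> \<bar>a\<bar> + \<bar>x\<bar> * \<bar>poly p x\<bar>"
        by (simp add: abs_mult[symmetric])
      also have "\<dots> \<le> \<bar>a\<bar> * (1 + \<bar>x\<bar>) ^ Suc n + (1 + \<bar>x\<bar>) * (C * (1 + \<bar>x\<bar>) ^ n)"
      proof (intro add_mono mult_mono C(2))
        show "\<bar>a\<bar> \<le> \<bar>a\<bar> * (1 + \<bar>x\<bar>) ^ Suc n"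
          using mult_left_mono[OF one_le_power[of "1 + \<bar>x\<bar>" "Suc n"], of "\<bar>a\<bar>"] by simp
      qed auto
      finally show ?thesis by (simp add: algebra_simps)
    qed
    then show ?case using C(1) by (intro exI[of _ "\<bar>a\<bar> + C"] exI[of _ "Suc n"]) auto
  qed
  then show ?thesis using that by blast
qed

lemma integrable_power_gd: "integrable lborel (\<lambda>x. (1 + \<bar>x\<bar>) ^ n * \<bar>gd j x\<bar>)"
proof -
  obtain C m where C: "C \<ge> 0" "\<And>x. \<bar>poly (herm j) x\<bar> \<le> C * (1 + \<bar>x\<bar>) ^ m"
    using poly_abs_bound by blast
  have "integrable lborel (\<lambda>x. C * ((1 + \<bar>x\<bar>) ^ (m + n) * gs x))"
    unfolding gs_eq_normal_density by (intro integrable_mult_right integrable_abs_power_normal) auto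
  then show ?thesis
  proof (rule Bochner_Integration.integrable_bound)
    show "AE x in lborel. norm ((1 + \<bar>x\<bar>) ^ n * \<bar>gd j x\<bar>) \<le> norm (C * ((1 + \<bar>x\<bar>) ^ (m + n) * gs x))"
    proof (rule AE_I2)
      fix x :: real
      have "(1 + \<bar>x\<bar>) ^ n * \<bar>gd j x\<bar> = (1 + \<bar>x\<bar>) ^ n * \<bar>poly (herm j) x\<bar> * gs x"
        using gs_pos[of x] by (simp add: gd_def abs_mult)
      also have "\<dots> \<le> (1 + \<bar>x\<bar>) ^ n * (C * (1 + \<bar>x\<bar>) ^ m) * gs x"
        using gs_pos[of x] by (intro mult_right_mono mult_left_mono C) auto
      finally show "norm ((1 + \<bar>x\<bar>) ^ n * \<bar>gd j x\<bar>) \<le> norm (C * ((1 + \<bar>x\<bar>) ^ (m + n) * gs x))"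
        using C(1) gs_pos[of x] by (simp add: power_add abs_mult mult_ac)
    qed
  qed simp
qed

lemma integrable_gd_mult:
  assumes [measurable]: "\<psi> \<in> borel_measurable borel" and "\<And>x. \<bar>\<psi> x\<bar> \<le> C * (1 + \<bar>x\<bar>) ^ n"
  shows "integrable lborel (\<lambda>x. gd j x * \<psi> x)"
proof (rule Bochner_Integration.integrable_bound)
  show "integrable lborel (\<lambda>x. C * ((1 + \<bar>x\<bar>) ^ n * \<bar>gd j x\<bar>))"
    by (intro integrable_mult_right integrable_power_gd)
  show "AE x in lborel. norm (gd j x * \<psi> x) \<le> norm (C * ((1 + \<bar>x\<bar>) ^ n * \<bar>gd j x\<bar>))"
  proof (rule AE_I2)
    fix x :: real
    have "norm (gd j x * \<psi> x) \<le> \<bar>gd j x\<bar> * (C * (1 + \<bar>x\<bar>) ^ n)"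
      by (simp add: abs_mult mult_left_mono assms)
    also have "\<dots> \<le> norm (C * ((1 + \<bar>x\<bar>) ^ n * \<bar>gd j x\<bar>))" by (simp add: abs_mult mult_ac mult_right_mono)
    finally show "norm (gd j x * \<psi> x) \<le> norm (C * ((1 + \<bar>x\<bar>) ^ n * \<bar>gd j x\<bar>))" .
  qed
qed simp

lemma integrable_gd_bounded:
  assumes [measurable]: "\<psi> \<in> borel_measurable borel" and "\<And>x. \<bar>\<psi> x\<bar> \<le> B"
  shows "integrable lborel (\<lambda>x. gd j x * \<psi> x)"
  using integrable_gd_mult[of \<psi> B 0 j] assms by simp

text \<open>The integrals of \<open>x ^ n\<close> against the heat kernel at time 1 are 1, 0, 2, 0, 12, 0, 120, 0, 1680.\<close>

lemma gs_integral_poly: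
  "has_bochner_integral lborel
     (\<lambda>u. gs u * (c0 + c1*u + c2*u^2 + c3*u^3 + c4*u^4 + c5*u^5 + c6*u^6 + c7*u^7 + c8*u^8 + c9*u^9 + c10*u^10))
     (c0 + 2*c2 + 12*c4 + 120*c6 + 1680*c8 + 30240*c10)"
proof -
  have ev: "has_bochner_integral lborel (\<lambda>x. gs x * x ^ (2*k)) (fact (2*k) / fact k)" for k
    using normal_moment_even[of "sqrt 2" 0 k] by (simp add: gs_eq_normal_density)
  have od: "has_bochner_integral lborel (\<lambda>x. gs x * x ^ (2*k+1)) 0" for k
    using normal_moment_odd[of "sqrt 2" 0 k] by (simp add: gs_eq_normal_density)
  note e = ev[of 0] ev[of 1] ev[of 2] ev[of 3] ev[of 4] ev[of 5]
  note o = od[of 0] od[of 1] od[of 2] od[of 3] od[of 4]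
  have "has_bochner_integral lborel
     (\<lambda>u. c0 * (gs u * u^(2*0)) + c1 * (gs u * u^(2*0+1)) + c2 * (gs u * u^(2*1)) + c3 * (gs u * u^(2*1+1))
       + c4 * (gs u * u^(2*2)) + c5 * (gs u * u^(2*2+1)) + c6 * (gs u * u^(2*3)) + c7 * (gs u * u^(2*3+1))
       + c8 * (gs u * u^(2*4)) + c9 * (gs u * u^(2*4+1)) + c10 * (gs u * u^(2*5)))
     (c0 * (fact (2*0) / fact 0) + c1 * 0 + c2 * (fact (2*1) / fact 1) + c3 * 0 + c4 * (fact (2*2) / fact 2)
       + c5 * 0 + c6 * (fact (2*3) / fact 3) + c7 * 0 + c8 * (fact (2*4) / fact 4) + c9 * 0 + c10 * (fact (2*5) / fact 5))"
    by (intro has_bochner_integral_add has_bochner_integral_mult_right e o)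
  then show ?thesis
    by (simp add: fact_numeral algebra_simps power2_eq_square power3_eq_cube)
qed

lemma gs_integral_1: "has_bochner_integral lborel gs 1"
  using gs_integral_poly[of 1 0 0 0 0 0 0 0 0 0 0] by simp

section \<open>Differentiating convolutions with bounded measurable functions\<close>

lemma gd_dominated:
  obtains w where "integrable lborel w" "\<And>z. w z \<ge> 0" "\<And>z \<theta>. \<bar>\<theta>\<bar> \<le> 1 \<Longrightarrow> \<bar>gd j (z + \<theta>)\<bar> \<le> w z"
proof -
  obtain C m where C: "C \<ge> 0" "\<And>x. \<bar>poly (herm j) x\<bar> \<le> C * (1 + \<bar>x\<bar>) ^ m"
    using poly_abs_bound by blast
  define w where "w z = C * exp (1/4) * sqrt 2 * ((2 + \<bar>z\<bar>) ^ m * normal_density 0 2 z)" for z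
  have "integrable lborel w"
    unfolding w_def by (intro integrable_mult_right integrable_abs_power_normal) auto
  moreover have "\<bar>gd j (z + \<theta>)\<bar> \<le> w z" if "\<bar>\<theta>\<bar> \<le> 1" for z \<theta>
  proof -
    have "\<bar>poly (herm j) (z + \<theta>)\<bar> \<le> C * (1 + \<bar>z + \<theta>\<bar>) ^ m" by (rule C)
    also have "\<dots> \<le> C * (2 + \<bar>z\<bar>) ^ m" using that C(1) by (intro mult_left_mono power_mono) auto
    finally have 1: "\<bar>poly (herm j) (z + \<theta>)\<bar> \<le> C * (2 + \<bar>z\<bar>) ^ m" .
    have "\<theta>\<^sup>2 \<le> 1" using that abs_square_le_1 by blast
    \<comment> \<open>Completing the square: (z + \<theta>)^2 - (z^2/2 - \<theta>^2) = (z + 2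
      \<theta>)^2 / 2. Half of the Gaussian exponent survives a unit shift, whence the density of
      standard deviation 2 in \<open>w\<close>.\<close>
    moreover have "0 \<le> (z + 2 * \<theta>)\<^sup>2" by simp
    ultimately have "(z + \<theta>)\<^sup>2 \<ge> z\<^sup>2 / 2 - 1"
      unfolding power2_sum power_mult_distrib by (simp add: power2_eq_square)
    then have "- (z + \<theta>)\<^sup>2 / 4 \<le> 1/4 + - z\<^sup>2 / 8"
      by simp
    then have "exp (- (z + \<theta>)\<^sup>2 / 4) \<le> exp (1/4) * exp (- z\<^sup>2 / 8)"
      unfolding exp_add[symmetric] by simp
    moreover have "sqrt 8 = 2 * sqrt (2::real)" using real_sqrt_mult[of 4 2] by simp
    ultimately have 2: "gs (z + \<theta>) \<le> exp (1/4) * sqrt 2 * normal_density 0 2 z"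
      by (simp add: gs_def normal_density_def divide_right_mono real_sqrt_mult)
    have "\<bar>gd j (z + \<theta>)\<bar> = \<bar>poly (herm j) (z + \<theta>)\<bar> * gs (z + \<theta>)"
      using gs_pos[of "z + \<theta>"] by (simp add: gd_def abs_mult)
    also have "\<dots> \<le> (C * (2 + \<bar>z\<bar>) ^ m) * (exp (1/4) * sqrt 2 * normal_density 0 2 z)"
      using 1 2 C(1) gs_pos[of "z + \<theta>"] by (intro mult_mono) auto
    finally show ?thesis by (simp add: w_def mult_ac)
  qed
  moreover have "w z \<ge> 0" for z using C(1) by (simp add: w_def)
  ultimately show ?thesis using that by blast
qed

text \<open>A second-order Taylor bound can be integrated pointwise, so this criterion takes the
  place of a limit theorem when differentiating under the integral sign.\<close>

lemma DERIV_of_quadratic_error: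
  fixes F :: "real \<Rightarrow> real"
  assumes "\<And>h. \<bar>h\<bar> \<le> 1 \<Longrightarrow> \<bar>F (x + h) - F x - h * D\<bar> \<le> C * h\<^sup>2"
  shows "(F has_real_derivative D) (at x)"
  unfolding has_field_derivative_def
proof (rule has_derivativeI)
  show "bounded_linear ((*) D)" by (rule bounded_linear_mult_right)
  have "((\<lambda>y. C * \<bar>y - x\<bar>) \<longlongrightarrow> C * \<bar>x - x\<bar>) (at x)" by (intro tendsto_intros)
  then have lim: "((\<lambda>y. C * \<bar>y - x\<bar>) \<longlongrightarrow> 0) (at x)" by simp
  show "((\<lambda>y. ((F y - F x) - D * (y - x)) /\<^sub>R norm (y - x)) \<longlongrightarrow> 0) (at x)"
  proof (rule Lim_null_comparison[OF _ lim])
    have "\<forall>\<^sub>F y in at x. dist y x < 1 \<and> y \<noteq> x" by (auto simp: eventually_at intro!: exI[of _ 1])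
    then show "\<forall>\<^sub>F y in at x. norm (((F y - F x) - D * (y - x)) /\<^sub>R norm (y - x)) \<le> C * \<bar>y - x\<bar>"
    proof eventually_elim
      case (elim y)
      then have "\<bar>F (x + (y - x)) - F x - (y - x) * D\<bar> \<le> C * (y - x)\<^sup>2"
        by (intro assms) (auto simp: dist_real_def)
      then show ?case using elim
        by (simp add: divide_simps mult.commute power2_eq_square abs_mult) (simp add: mult_ac abs_mult_self_eq)
    qed
  qed
qed

lemma gd_taylor:
  assumes "\<And>\<theta>. \<bar>\<theta>\<bar> \<le> 1 \<Longrightarrow> \<bar>gd (Suc (Suc j)) (z + \<theta>)\<bar> \<le> K" and "\<bar>h\<bar> \<le> 1"
  shows "\<bar>gd j (z + h) - gd j z - h * gd (Suc j) z\<bar> \<le> K * h\<^sup>2"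
proof (cases "h = 0")
  case False
  have "\<exists>t. \<bar>t\<bar> \<le> \<bar>h\<bar> \<and> gd j (z + h) = (\<Sum>m<2. gd (j + m) (z + 0) / fact m * h ^ m) + gd (j + 2) (z + t) / fact 2 * h ^ 2"
    by (rule Maclaurin_all_le[of "\<lambda>m h. gd (j + m) (z + h)"]) (auto intro!: derivative_eq_intros)
  then obtain t where t: "\<bar>t\<bar> \<le> \<bar>h\<bar>"
    "gd j (z + h) = gd j z + gd (Suc j) z * h + gd (Suc (Suc j)) (z + t) / 2 * h ^ 2"
    by (auto simp: numeral_2_eq_2)
  have "\<bar>gd (Suc (Suc j)) (z + t)\<bar> \<le> K" using t assms by auto
  then have "\<bar>gd (Suc (Suc j)) (z + t)\<bar> / 2 * h\<^sup>2 \<le> K * h\<^sup>2" by (intro mult_right_mono) auto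
  then show ?thesis using t by (simp add: abs_mult)
qed simp

lemma integrable_gd_shift_bounded:
  assumes [measurable]: "\<psi> \<in> borel_measurable borel" and "\<And>x. \<bar>\<psi> x\<bar> \<le> B"
  shows "integrable lborel (\<lambda>s. gd j (x - s) * \<psi> s)"
proof -
  have "integrable lborel (\<lambda>u. gd j u * \<psi> (x - u))"
    by (rule integrable_gd_bounded[where B = B]) (use assms in auto)
  from lborel_integrable_real_affine[OF this, of "-1" x] show ?thesis by simp
qed

text \<open>All derivatives fall on the kernel, so \<psi> may be as rough as a section of a
  measurable set. The Taylor remainder of \<open>gd j\<close> is integrated against \<psi>;
  \<open>w\<close> is an integrable majorant of the second derivative over unit
  neighbourhoods.\<close>

lemma gd_convolution_deriv:
  assumes [measurable]: "\<psi> \<in> borel_measurable borel" and B: "\<And>x. \<bar>\<psi> x\<bar> \<le> B"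
  shows "((\<lambda>x. LINT s|lborel. gd j (x - s) * \<psi> s) has_real_derivative
           (LINT s|lborel. gd (Suc j) (x - s) * \<psi> s)) (at x)"
proof -
  obtain w where w: "integrable lborel w" "\<And>z. w z \<ge> 0"
    "\<And>z \<theta>. \<bar>\<theta>\<bar> \<le> 1 \<Longrightarrow> \<bar>gd (Suc (Suc j)) (z + \<theta>)\<bar> \<le> w z"
    using gd_dominated by blast
  have iw: "integrable lborel (\<lambda>s. w (x - s))"
    using lborel_integrable_real_affine[OF w(1), of "-1" x] by simp
  note int = integrable_gd_shift_bounded[OF assms]
  have B0: "B \<ge> 0" using B[of 0] by simp
  show ?thesis
  proof (rule DERIV_of_quadratic_error[where C = "B * (LINT s|lborel. w (x - s))"])
    fix h :: real assume h: "\<bar>h\<bar> \<le> 1"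
    have "(LINT s|lborel. gd j (x + h - s) * \<psi> s) - (LINT s|lborel. gd j (x - s) * \<psi> s)
            - h * (LINT s|lborel. gd (Suc j) (x - s) * \<psi> s)
        = (LINT s|lborel. gd j (x + h - s) * \<psi> s - gd j (x - s) * \<psi> s - h * (gd (Suc j) (x - s) * \<psi> s))"
      using int[of j x] int[of j "x + h"] int[of "Suc j" x] by simp
    also have "\<bar>\<dots>\<bar> \<le> (LINT s|lborel. h\<^sup>2 * B * w (x - s))"
    proof (rule integral_abs_bound_integral)
      fix s :: real
      have "\<bar>gd j (x - s + h) - gd j (x - s) - h * gd (Suc j) (x - s)\<bar> \<le> w (x - s) * h\<^sup>2"
        by (rule gd_taylor) (use w h in auto)
      then have "\<bar>gd j (x - s + h) - gd j (x - s) - h * gd (Suc j) (x - s)\<bar> * \<bar>\<psi> s\<bar> \<le> (w (x - s) * h\<^sup>2) * B"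
        by (intro mult_mono B) (use w in auto)
      then show "\<bar>gd j (x + h - s) * \<psi> s - gd j (x - s) * \<psi> s - h * (gd (Suc j) (x - s) * \<psi> s)\<bar>
                 \<le> h\<^sup>2 * B * w (x - s)"
        unfolding abs_mult[symmetric] by (simp add: algebra_simps)
    qed (use int iw in \<open>auto intro!: Bochner_Integration.integrable_diff integrable_mult_right\<close>)
    finally show "\<bar>(LINT s|lborel. gd j (x + h - s) * \<psi> s) - (LINT s|lborel. gd j (x - s) * \<psi> s)
            - h * (LINT s|lborel. gd (Suc j) (x - s) * \<psi> s)\<bar> \<le> B * (LINT s|lborel. w (x - s)) * h\<^sup>2"
      by (simp add: mult_ac)
  qed
qed

section \<open>Partial derivatives of the planar convolution\<close>

definition W :: "nat \<Rightarrow> (real \<times> real \<Rightarrow> real) \<Rightarrow> real \<Rightarrow> real \<Rightarrow> real" where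
  "W k \<phi> s y = (LINT t|lborel. gd k (y - t) * \<phi> (s, t))"

text \<open>For bounded measurable \<phi> this is the partial derivative of order j in x and k in y
  of the convolution with the planar kernel at time 1; see \<open>V_deriv_x\<close>,
  \<open>V_deriv_y\<close> and \<open>conv_gauss_eq_V\<close>. The vertical integral
  \<open>W\<close> is innermost because it has a closed form when the section is a half
  line.\<close>

definition V :: "nat \<Rightarrow> nat \<Rightarrow> (real \<times> real \<Rightarrow> real) \<Rightarrow> real \<Rightarrow> real \<Rightarrow> real" where
  "V j k \<phi> x y = (LINT s|lborel. gd j (x - s) * W k \<phi> s y)"

definition gd_norm :: "nat \<Rightarrow> real" where
  "gd_norm j = (LINT s|lborel. \<bar>gd j s\<bar>)"

lemma gd_norm_nonneg: "gd_norm j \<ge> 0"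
  by (simp add: gd_norm_def)

lemma integrable_gd: "integrable lborel (gd j)"
  using integrable_gd_bounded[of "\<lambda>_. 1" 1 j] by simp

lemma integrable_abs_gd_shift: "integrable lborel (\<lambda>s. \<bar>gd j (x - s)\<bar>)"
  using lborel_integrable_real_affine[OF integrable_abs[OF integrable_gd], of "-1" j x] by simp

lemma integral_abs_gd_shift: "(LINT s|lborel. \<bar>gd j (x - s)\<bar>) = gd_norm j"
  unfolding gd_norm_def using lborel_integral_real_affine[of "-1" "\<lambda>s. \<bar>gd j s\<bar>" x] by simp

lemma gd_convolution_bound:
  assumes [measurable]: "\<psi> \<in> borel_measurable borel" and B: "\<And>x. \<bar>\<psi> x\<bar> \<le> B"
  shows "\<bar>LINT s|lborel. gd j (x - s) * \<psi> s\<bar> \<le> B * gd_norm j"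
proof -
  have "\<bar>LINT s|lborel. gd j (x - s) * \<psi> s\<bar> \<le> (LINT s|lborel. B * \<bar>gd j (x - s)\<bar>)"
    by (rule integral_abs_bound_integral)
       (use B in \<open>auto intro!: integrable_gd_shift_bounded[where B = B] integrable_mult_right
          integrable_abs_gd_shift simp: abs_mult mult.commute[of B] mult_left_mono\<close>)
  then show ?thesis by (simp add: integral_abs_gd_shift)
qed

section \<open>Blow-up of the convolution and measurability of the stages\<close>

lemma gauss_1_eq: "gauss 1 (x, y) = gd 0 x * gd 0 y"
  by (simp add: gauss_def gd_0 gs_def norm_Pair exp_add[symmetric] diff_divide_distrib add_divide_distrib)

lemma conv_gauss_rescale:
  assumes "\<sigma> > 0"
  shows "conv (gauss (\<sigma>\<^sup>2)) \<phi> (\<sigma> *\<^sub>R p) = conv (gauss 1) (\<lambda>q. \<phi> (\<sigma> *\<^sub>R q)) p"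
proof -
  have K: "\<sigma>\<^sup>2 * (gauss (\<sigma>\<^sup>2) (\<sigma> *\<^sub>R p - \<sigma> *\<^sub>R q)) = gauss 1 (p - q)" for q
    using assms by (simp add: gauss_def scaleR_diff_right[symmetric] power_mult_distrib)
  let ?f = "\<lambda>q. gauss (\<sigma>\<^sup>2) (\<sigma> *\<^sub>R p - q) * \<phi> q"
  let ?T = "\<lambda>q::real\<times>real. \<sigma> *\<^sub>R q"
  have d: "lborel = density (distr lborel borel ?T) (\<lambda>_. ennreal (\<sigma>\<^sup>2))"
    using lborel_affine[of \<sigma> "0::real\<times>real"] assms by (simp add: power2_eq_square)
  have inj: "?T \<in> lborel \<rightarrow>\<^sub>M borel" "(\<lambda>q. (1 / \<sigma>) *\<^sub>R q) \<in> borel \<rightarrow>\<^sub>M (borel :: (real\<times>real) measure)" by simp_all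
  show ?thesis
  proof (cases "\<phi> \<in> borel_measurable borel")
    case True
    note [measurable] = True
    have [measurable]: "(\<lambda>q. gauss (\<sigma>\<^sup>2) (\<sigma> *\<^sub>R p - q)) \<in> borel_measurable borel"
      unfolding gauss_def by measurable
    have "conv (gauss (\<sigma>\<^sup>2)) \<phi> (\<sigma> *\<^sub>R p) = integral\<^sup>L lborel ?f"
      by (simp add: conv_def)
    also have "\<dots> = integral\<^sup>L (density (distr lborel borel ?T) (\<lambda>_. ennreal (\<sigma>\<^sup>2))) ?f"
      by (subst d) (rule refl)
    also have "\<dots> = (LINT q|lborel. \<sigma>\<^sup>2 * ?f (\<sigma> *\<^sub>R q))"
      by (simp add: integral_density integral_distr)
    also have "\<dots> = (LINT q|lborel. gauss 1 (p - q) * \<phi> (\<sigma> *\<^sub>R q))"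
      by (simp add: K[symmetric] mult.assoc)
    finally show ?thesis by (simp add: conv_def)
  next
    \<comment> \<open>The kernel vanishes nowhere, so an integrable product would make \<phi>
      measurable after division. Hence neither integrand is integrable and both integrals take the
      default value 0.\<close>
    case False
    have gpos: "gauss t q \<noteq> 0" if "t > 0" for t q using that by (simp add: gauss_def)
    have [measurable]: "gauss t \<in> borel_measurable borel" for t unfolding gauss_def by measurable
    have "\<not> integrable lborel ?f"
    proof
      assume "integrable lborel ?f"
      then have [measurable]: "?f \<in> borel_measurable borel" by (simp add: integrable_iff_bounded)
      have "(\<lambda>q. ?f q / gauss (\<sigma>\<^sup>2) (\<sigma> *\<^sub>R p - q)) \<in> borel_measurable borel" by measurable
      then show False using False gpos[of "\<sigma>\<^sup>2"] assms by simp
    qed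
    moreover have "\<not> integrable lborel (\<lambda>q. gauss 1 (p - q) * \<phi> (\<sigma> *\<^sub>R q))"
    proof
      assume "integrable lborel (\<lambda>q. gauss 1 (p - q) * \<phi> (\<sigma> *\<^sub>R q))"
      then have [measurable]: "(\<lambda>q. gauss 1 (p - q) * \<phi> (\<sigma> *\<^sub>R q)) \<in> borel_measurable borel"
        by (simp add: integrable_iff_bounded)
      have "(\<lambda>q. (gauss 1 (p - q) * \<phi> (\<sigma> *\<^sub>R q)) / gauss 1 (p - q)) \<in> borel_measurable borel" by measurable
      then have m: "(\<lambda>q. \<phi> (\<sigma> *\<^sub>R q)) \<in> borel_measurable borel" using gpos[of 1] by simp
      have "(\<lambda>q. \<phi> (\<sigma> *\<^sub>R ((1 / \<sigma>) *\<^sub>R q))) \<in> borel_measurable borel"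
        by (rule measurable_compose[OF inj(2) m])
      then show False using False assms by simp
    qed
    ultimately show ?thesis by (simp add: conv_def not_integrable_integral_eq)
  qed
qed

lemma borel_measurable_conv_gauss:
  assumes [measurable]: "\<phi> \<in> borel_measurable borel"
  shows "conv (gauss t) \<phi> \<in> borel_measurable borel"
proof -
  have [measurable]: "gauss t \<in> borel_measurable borel" unfolding gauss_def by measurable
  have "(\<lambda>(p, q). gauss t (p - q) * \<phi> q) \<in> borel_measurable (borel \<Otimes>\<^sub>M lborel)" by measurable
  then show ?thesis unfolding conv_def[abs_def]
    using sigma_finite_measure.borel_measurable_lebesgue_integral[OF sigma_finite_lborel,
        of "\<lambda>p q. gauss t (p - q) * \<phi> q" borel] by simp
qed

lemma sets_stage:
  assumes "S \<in> sets borel"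
  shows "stage \<gamma> \<tau> S m \<in> sets borel"
proof (induction m rule: less_induct)
  case (less m)
  show ?case
  proof (cases m)
    case 0
    then show ?thesis using assms by simp
  next
    case (Suc n)
    have [measurable]: "stage \<gamma> \<tau> S i \<in> sets borel" if "i \<in> {..n}" for i using less.IH[of i] Suc that by simp
    have [measurable]: "conv (gauss \<tau>) (\<lambda>q. \<Sum>i\<le>n. \<gamma> (Suc n) i * indicator (stage \<gamma> \<tau> S i) q) \<in> borel_measurable borel"
      by (rule borel_measurable_conv_gauss) measurable
    show ?thesis unfolding Suc stage.simps by measurable
  qed
qed

lemma borel_measurable_W:
  assumes [measurable]: "\<phi> \<in> borel_measurable borel"
  shows "(\<lambda>s. W k \<phi> s y) \<in> borel_measurable borel"
proof -
  have "(\<lambda>(s, t). gd k (y - t) * \<phi> (s, t)) \<in> borel_measurable (borel \<Otimes>\<^sub>M lborel)"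
    by (measurable; simp add: borel_prod)
  then show ?thesis unfolding W_def
    using sigma_finite_measure.borel_measurable_lebesgue_integral[OF sigma_finite_lborel,
        of "\<lambda>s t. gd k (y - t) * \<phi> (s, t)" borel] by simp
qed

lemma borel_measurable_section:
  fixes \<phi> :: "real \<times> real \<Rightarrow> real"
  assumes "\<phi> \<in> borel_measurable borel"
  shows "(\<lambda>t. \<phi> (s, t)) \<in> borel_measurable borel" "(\<lambda>t. \<phi> (t, s)) \<in> borel_measurable borel"
  by (rule measurable_compose[OF _ assms],
      intro borel_measurable_continuous_onI continuous_intros)+

lemma W_bound:
  assumes "\<phi> \<in> borel_measurable borel" "\<And>q. \<bar>\<phi> q\<bar> \<le> B"
  shows "\<bar>W k \<phi> s y\<bar> \<le> B * gd_norm k"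
  unfolding W_def by (rule gd_convolution_bound[OF borel_measurable_section(1)[OF assms(1)] assms(2)])

lemma V_bound:
  assumes "\<phi> \<in> borel_measurable borel" "\<And>q. \<bar>\<phi> q\<bar> \<le> B"
  shows "\<bar>V j k \<phi> x y\<bar> \<le> B * gd_norm k * gd_norm j"
  unfolding V_def by (rule gd_convolution_bound[OF borel_measurable_W[OF assms(1)] W_bound[OF assms]])

lemma integrable_gd_gd:
  assumes [measurable]: "\<phi> \<in> borel_measurable borel" and B: "\<And>q. \<bar>\<phi> q\<bar> \<le> B"
  shows "integrable (lborel \<Otimes>\<^sub>M lborel) (\<lambda>(s, t). gd j (x - s) * (gd k (y - t) * \<phi> (s, t)))"
proof -
  have "integrable (lborel \<Otimes>\<^sub>M lborel) (\<lambda>q. B * (\<bar>gd j (x - fst q)\<bar> * \<bar>gd k (y - snd q)\<bar>))"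
    by (intro integrable_mult_right lborel_pair.Fubini_integrable)
       (use integrable_abs_gd_shift in \<open>auto simp: abs_mult integral_abs_gd_shift\<close>)
  then show ?thesis
  proof (rule Bochner_Integration.integrable_bound)
    show "AE q in lborel \<Otimes>\<^sub>M lborel. norm ((\<lambda>(s, t). gd j (x - s) * (gd k (y - t) * \<phi> (s, t))) q)
        \<le> norm (B * (\<bar>gd j (x - fst q)\<bar> * \<bar>gd k (y - snd q)\<bar>))"
    proof (rule AE_I2)
      fix q :: "real \<times> real"
      have "\<bar>gd j (x - fst q) * gd k (y - snd q)\<bar> * \<bar>\<phi> q\<bar> \<le> \<bar>gd j (x - fst q) * gd k (y - snd q)\<bar> * \<bar>B\<bar>"
        using B[of q] by (intro mult_left_mono) auto
      then show "norm ((\<lambda>(s, t). gd j (x - s) * (gd k (y - t) * \<phi> (s, t))) q)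
        \<le> norm (B * (\<bar>gd j (x - fst q)\<bar> * \<bar>gd k (y - snd q)\<bar>))"
        by (simp add: case_prod_beta' abs_mult mult_ac)
    qed
  qed (measurable; simp add: borel_prod)
qed

text \<open>Fubini exchanges the roles of the coordinates, so differentiation in y becomes
  differentiation in x for the transposed function.\<close>

lemma V_swap:
  assumes [measurable]: "\<phi> \<in> borel_measurable borel" and B: "\<And>q. \<bar>\<phi> q\<bar> \<le> B"
  shows "V j k \<phi> x y = (LINT t|lborel. gd k (y - t) * W j (\<lambda>(a, b). \<phi> (b, a)) t x)"
proof -
  have "V j k \<phi> x y = (LINT s|lborel. LINT t|lborel. gd j (x - s) * (gd k (y - t) * \<phi> (s, t)))"
    by (simp add: V_def W_def)
  also have "\<dots> = (LINT t|lborel. LINT s|lborel. gd j (x - s) * (gd k (y - t) * \<phi> (s, t)))"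
    using lborel_pair.Fubini_integral[of "\<lambda>s t. gd j (x - s) * (gd k (y - t) * \<phi> (s, t))"]
      integrable_gd_gd[OF assms] by simp
  finally show ?thesis
    by (simp add: W_def mult.left_commute[of _ "gd k _"])
qed

lemma measurable_swap_borel:
  assumes "\<phi> \<in> borel_measurable borel"
  shows "(\<lambda>(a, b). \<phi> (b, a)) \<in> borel_measurable (borel :: (real \<times> real) measure)"
proof -
  have "(\<lambda>(a, b). (b, a)) \<in> borel \<rightarrow>\<^sub>M (borel :: (real \<times> real) measure)"
    unfolding borel_prod[symmetric] by measurable
  from measurable_compose[OF this assms] show ?thesis by (simp add: case_prod_beta')
qed

lemma V_deriv_x:
  assumes "\<phi> \<in> borel_measurable borel" "\<And>q. \<bar>\<phi> q\<bar> \<le> B"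
  shows "((\<lambda>x. V j k \<phi> x y) has_real_derivative V (Suc j) k \<phi> x y) (at x)"
  unfolding V_def
  by (rule gd_convolution_deriv[OF borel_measurable_W[OF assms(1)] W_bound[OF assms]])

lemma V_deriv_y:
  assumes "\<phi> \<in> borel_measurable borel" "\<And>q. \<bar>\<phi> q\<bar> \<le> B"
  shows "((\<lambda>y. V j k \<phi> x y) has_real_derivative V j (Suc k) \<phi> x y) (at y)"
  unfolding V_swap[OF assms]
  by (rule gd_convolution_deriv[OF borel_measurable_W[OF measurable_swap_borel[OF assms(1)]]
        W_bound[OF measurable_swap_borel[OF assms(1)]]]) (use assms(2) in auto)

lemma conv_gauss_eq_V:
  assumes [measurable]: "\<phi> \<in> borel_measurable borel" and B: "\<And>q. \<bar>\<phi> q\<bar> \<le> B"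
  shows "conv (gauss 1) \<phi> (x, y) = V 0 0 \<phi> x y"
proof -
  have "conv (gauss 1) \<phi> (x, y) = integral\<^sup>L (lborel \<Otimes>\<^sub>M lborel) (\<lambda>(s, t). gd 0 (x - s) * (gd 0 (y - t) * \<phi> (s, t)))"
    unfolding conv_def lborel_prod
    by (intro Bochner_Integration.integral_cong refl) (auto simp: gauss_1_eq)
  also have "\<dots> = V 0 0 \<phi> x y"
    using lborel_pair.integral_fst'[OF integrable_gd_gd[OF assms, of 0 x 0 y]]
    by (simp add: V_def W_def case_prod_beta')
  finally show ?thesis .
qed

lemma W_sum:
  assumes "\<And>i. i \<in> I \<Longrightarrow> \<phi> i \<in> borel_measurable borel" and "\<And>i q. i \<in> I \<Longrightarrow> \<bar>\<phi> i q\<bar> \<le> B"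
  shows "W k (\<lambda>q. \<Sum>i\<in>I. c i * \<phi> i q) s y = (\<Sum>i\<in>I. c i * W k (\<phi> i) s y)"
proof -
  have int: "integrable lborel (\<lambda>t. gd k (y - t) * \<phi> i (s, t))" if "i \<in> I" for i
    by (rule integrable_gd_shift_bounded[OF borel_measurable_section(1)[OF assms(1)[OF that]] assms(2)[OF that]])
  have "W k (\<lambda>q. \<Sum>i\<in>I. c i * \<phi> i q) s y = (LINT t|lborel. (\<Sum>i\<in>I. c i * (gd k (y - t) * \<phi> i (s, t))))"
    by (simp add: W_def sum_distrib_left mult_ac)
  also have "\<dots> = (\<Sum>i\<in>I. LINT t|lborel. c i * (gd k (y - t) * \<phi> i (s, t)))"
    by (intro Bochner_Integration.integral_sum integrable_mult_right int)
  finally show ?thesis by (simp add: W_def)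
qed

lemma V_eq_shift: "V j k \<phi> x y = (LINT u|lborel. gd j (- u) * W k \<phi> (x + u) y)"
  unfolding V_def using lborel_integral_real_affine[of 1 "\<lambda>s. gd j (x - s) * W k \<phi> s y" x] by simp

section \<open>The antiderivative of the one-dimensional kernel\<close>

definition E :: "real \<Rightarrow> real" where
  "E w = (LINT t|lborel. gs t * indicator {..w} t) - 1 / 2"

lemma integrable_gs_indicator: "A \<in> sets borel \<Longrightarrow> integrable lborel (\<lambda>t. gs t * indicator A t)"
  using integrable_gd_bounded[of "indicator A" 1 0] by (simp add: gd_0 indicator_def)

lemma gs_le: "gs x \<le> gs 0"
  by (simp add: gs_def divide_right_mono)

lemma gs_0_less_1: "gs 0 < 1" 
proof -
  have "1 < sqrt (4 * pi)" using pi_gt3 by (subst real_less_rsqrt) auto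
  then show ?thesis by (simp add: gs_def)
qed

text \<open>The first bound makes \<open>gs\<close> 1-Lipschitz; it comes from |x| \<le> 1 + x^2/4
  \<le> exp (x^2/4). The second, linear at 0, makes the second y-derivative small along a nearly
  flat interface.\<close>

lemma gd_1_bound: "\<bar>gd 1 x\<bar> \<le> 1" and gd_1_le: "\<bar>gd 1 x\<bar> \<le> \<bar>x\<bar>"
proof -
  have "0 \<le> (\<bar>x\<bar> / 2 - 1)\<^sup>2" by simp
  then have "\<bar>x\<bar> \<le> 1 + x\<^sup>2 / 4" by (simp add: power2_eq_square algebra_simps)
  also have "\<dots> \<le> exp (x\<^sup>2 / 4)" by (rule exp_ge_add_one_self)
  finally have "\<bar>x\<bar> * exp (- x\<^sup>2 / 4) \<le> 1" by (simp add: exp_minus field_simps)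
  then have "\<bar>x\<bar> * gs x \<le> gs 0" by (simp add: gs_def divide_right_mono)
  moreover have "\<bar>x\<bar> * gs x \<le> \<bar>x\<bar> * gs 0" by (intro mult_left_mono gs_le) auto
  moreover have "\<bar>x\<bar> * gs 0 \<le> \<bar>x\<bar>" using gs_0_less_1 by (intro mult_left_le) auto
  ultimately have "\<bar>x\<bar> * gs x \<le> 1" "\<bar>x\<bar> * gs x \<le> \<bar>x\<bar>" using gs_0_less_1 by linarith+
  moreover have "\<bar>gd 1 x\<bar> = \<bar>x\<bar> * gs x / 2" using gs_pos[of x] unfolding gd_1 by (simp add: abs_mult)
  ultimately show "\<bar>gd 1 x\<bar> \<le> 1" "\<bar>gd 1 x\<bar> \<le> \<bar>x\<bar>" by auto
qed

lemma gs_lipschitz: "\<bar>gs x - gs y\<bar> \<le> \<bar>x - y\<bar>"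
proof -
  have "norm (gs x - gs y) \<le> 1 * norm (x - y)"
    by (rule field_differentiable_bound[where S = UNIV and f' = "gd 1"])
       (use gd_deriv[of "\<lambda>x. x" 1 _ UNIV 0] gd_1_bound in \<open>auto simp: gd_0\<close>)
  then show ?thesis by simp
qed

text \<open>The reference point c is free in [a, b] so that one estimate serves both one-sided
  difference quotients: c is the left end for positive increments and the right end for negative
  ones. The square comes from \<open>gs\<close> being 1-Lipschitz.\<close>

lemma E_diff_bound:
  assumes "a \<le> b" "c \<in> {a..b}"
  shows "\<bar>E b - E a - (b - a) * gs c\<bar> \<le> 1 * (b - a)\<^sup>2"
proof -
  have i: "integrable lborel (\<lambda>t. r * indicator {a<..b} t)" for r :: real
    by (intro integrable_mult_right integrable_real_indicator) (use assms in auto)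
  have "E b - E a = (LINT t|lborel. gs t * indicator {a<..b} t)"
    unfolding E_def using assms
    by (simp add: integrable_gs_indicator flip: Bochner_Integration.integral_diff)
       (auto intro!: Bochner_Integration.integral_cong simp: indicator_def)
  moreover have "(b - a) * gs c = (LINT t|lborel. gs c * indicator {a<..b} t)"
    using assms by simp
  ultimately have "E b - E a - (b - a) * gs c = (LINT t|lborel. (gs t - gs c) * indicator {a<..b} t)"
    using i[of "gs c"] by (simp add: integrable_gs_indicator left_diff_distrib)
  also have "\<bar>\<dots>\<bar> \<le> (LINT t|lborel. (b - a) * indicator {a<..b} t)"
  proof (rule integral_abs_bound_integral)
    show "\<bar>(gs t - gs c) * indicator {a<..b} t\<bar> \<le> (b - a) * indicator {a<..b} t" for t
      using gs_lipschitz[of t c] assms by (auto simp: indicator_def)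
    show "integrable lborel (\<lambda>t. (gs t - gs c) * indicator {a<..b} t)"
      unfolding left_diff_distrib by (intro Bochner_Integration.integrable_diff i integrable_gs_indicator) auto
  qed (use i in auto)
  also have "\<dots> = 1 * (b - a)\<^sup>2" using assms by (simp add: power2_eq_square)
  finally show ?thesis .
qed

lemma E_deriv [derivative_intros]:
  assumes "(f has_real_derivative D) (at x within S)"
  shows "((\<lambda>x. E (f x)) has_real_derivative gs (f x) * D) (at x within S)"
proof -
  have "(E has_real_derivative gs w) (at w)" for w
  proof (rule DERIV_of_quadratic_error[where C = 1])
    fix h :: real
    show "\<bar>E (w + h) - E w - h * gs w\<bar> \<le> 1 * h\<^sup>2"
    proof (cases "h \<ge> 0")
      case True
      then show ?thesis using E_diff_bound[of w "w + h" w] by simp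
    next
      case False
      then show ?thesis using E_diff_bound[of "w + h" w w] by (simp add: abs_minus_commute algebra_simps)
    qed
  qed
  from DERIV_chain2[OF this assms] show ?thesis .
qed

lemma continuous_E: "continuous_on S E"
  by (rule DERIV_continuous_on[where D = gs]) (auto intro!: derivative_eq_intros)

lemma borel_measurable_E [measurable]: "E \<in> borel_measurable borel"
  by (rule borel_measurable_continuous_onI[OF continuous_E])

text \<open>Reflection turns the lower tail at -w into the upper tail at w, and the two tails at w
  add up to the total mass 1, up to the null set {w}.\<close>

lemma E_minus: "E (- w) = - E w"
proof -
  have "(LINT t|lborel. gs t * indicator {..- w} t) = (LINT t|lborel. gs t * indicator {w..} t)"
    by (subst lborel_integral_real_affine[where c = "-1" and t = 0])
       (auto intro!: Bochner_Integration.integral_cong simp: indicator_def)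
  also have "\<dots> = (LINT t|lborel. gs t * indicator {w<..} t)"
    by (intro integral_cong_AE) (use AE_lborel_singleton[of w] in \<open>auto elim!: eventually_mono simp: indicator_def\<close>)
  finally have "E (- w) + E w + 1 = (LINT t|lborel. gs t * indicator {w<..} t + gs t * indicator {..w} t)"
    by (simp add: E_def integrable_gs_indicator)
  also have "\<dots> = (LINT t|lborel. gs t)"
    by (intro Bochner_Integration.integral_cong) (auto simp: indicator_def)
  also have "\<dots> = 1" using gs_integral_1 has_bochner_integral_integral_eq by blast
  finally show ?thesis by simp
qed

lemma E_0: "E 0 = 0"
  using E_minus[of 0] by simp

lemma E_bounded: "\<bar>E w\<bar> \<le> 1"
proof -
  have "(LINT t|lborel. gs t * indicator {..w} t) \<le> (LINT t|lborel. gs t)"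
    using integrable_gs_indicator[of UNIV] integrable_gs_indicator[of "{..w}"] gs_pos
    by (intro integral_mono) (auto simp: indicator_def less_imp_le)
  also have "\<dots> = 1" using gs_integral_1 has_bochner_integral_integral_eq by blast
  finally have 1: "(LINT t|lborel. gs t * indicator {..w} t) \<le> 1" .
  have "0 \<le> (LINT t|lborel. gs t * indicator {..w} t)"
    by (rule integral_nonneg_AE) (use gs_pos in \<open>auto simp: indicator_def less_imp_le\<close>)
  with 1 show ?thesis by (simp add: E_def abs_le_iff)
qed

lemma E_lipschitz: "\<bar>E x - E y\<bar> \<le> \<bar>x - y\<bar>"
proof -
  have "norm (E x - E y) \<le> 1 * norm (x - y)"
  proof (rule field_differentiable_bound[where S = UNIV and f' = gs])
    show "norm (gs z) \<le> 1" for z using gs_pos[of z] gs_le[of z] gs_0_less_1 by simp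
  qed (auto intro!: derivative_eq_intros)
  then show ?thesis by simp
qed

lemma gs_taylor2: "\<bar>gs w - gs 0\<bar> \<le> w\<^sup>2" and gs_taylor4: "\<bar>gs w - gs 0 * (1 - w\<^sup>2 / 4)\<bar> \<le> w ^ 4"
proof -
  define y where "y = w\<^sup>2 / 4"
  have y: "y \<ge> 0" by (simp add: y_def)
  have 1: "1 - y \<le> exp (- y)" using exp_ge_add_one_self[of "- y"] by simp
  \<comment> \<open>(1 - y + y^2) (1 + y) = 1 + y^3 is at least 1, and exp y \<ge> 1 + y.\<close>
  have 3: "exp (- y) \<le> 1 - y + y\<^sup>2"
  proof -
    have "1 \<le> (1 - y + y\<^sup>2) * (1 + y)" using y by (simp add: algebra_simps power2_eq_square)
    also have "\<dots> \<le> (1 - y + y\<^sup>2) * exp y"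
    proof (rule mult_left_mono)
      have "1 - y + y\<^sup>2 = (1 - y / 2)\<^sup>2 + 3 / 4 * y\<^sup>2" by (simp add: power2_eq_square algebra_simps)
      then show "0 \<le> 1 - y + y\<^sup>2" by simp
    qed (use exp_ge_add_one_self[of y] in simp)
    finally show ?thesis by (simp add: exp_minus field_simps)
  qed
  have g: "gs w = gs 0 * exp (- y)" by (simp add: gs_def y_def)
  have "gs w - gs 0 = - (gs 0 * (1 - exp (- y)))" by (simp add: g algebra_simps)
  then have "\<bar>gs w - gs 0\<bar> = gs 0 * (1 - exp (- y))" using gs_pos[of 0] y by (simp add: abs_mult)
  also have "\<dots> \<le> 1 * y" using gs_0_less_1 gs_pos[of 0] 1 y by (intro mult_mono) auto
  also have "\<dots> \<le> w\<^sup>2" by (simp add: y_def)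
  finally show "\<bar>gs w - gs 0\<bar> \<le> w\<^sup>2" .
  have "gs w - gs 0 * (1 - w\<^sup>2 / 4) = gs 0 * (exp (- y) - (1 - y))"
    by (simp add: g y_def algebra_simps)
  then have "\<bar>gs w - gs 0 * (1 - w\<^sup>2 / 4)\<bar> = gs 0 * (exp (- y) - (1 - y))"
    using gs_pos[of 0] 1 by (simp add: abs_mult)
  also have "\<dots> \<le> 1 * y\<^sup>2" using gs_0_less_1 gs_pos[of 0] 1 3 by (intro mult_mono) auto
  also have "\<dots> \<le> w ^ 4" by (simp add: y_def power_divide power_mult[symmetric])
  finally show "\<bar>gs w - gs 0 * (1 - w\<^sup>2 / 4)\<bar> \<le> w ^ 4" .
qed

lemma abs_le_of_deriv_power_bound:
  fixes F :: "real \<Rightarrow> real"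
  assumes "\<And>z. (F has_real_derivative F' z) (at z)" "\<And>z. \<bar>F' z\<bar> \<le> \<bar>z\<bar> ^ n" "F 0 = 0"
  shows "\<bar>F w\<bar> \<le> \<bar>w\<bar> ^ Suc n"
proof -
  have "norm (F w - F 0) \<le> \<bar>w\<bar> ^ n * norm (w - 0)"
  proof (rule field_differentiable_bound[where S = "{- \<bar>w\<bar> .. \<bar>w\<bar>}" and f' = F'])
    fix z assume z: "z \<in> {- \<bar>w\<bar> .. \<bar>w\<bar>}"
    have "\<bar>F' z\<bar> \<le> \<bar>z\<bar> ^ n" by (rule assms)
    also have "\<dots> \<le> \<bar>w\<bar> ^ n" using z by (intro power_mono) auto
    finally show "norm (F' z) \<le> \<bar>w\<bar> ^ n" by simp
  qed (use assms in \<open>auto intro: has_field_derivative_at_within\<close>)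
  then show ?thesis using assms(3) by (simp add: mult.commute)
qed

lemma E_taylor3: "\<bar>E w - gs 0 * w\<bar> \<le> \<bar>w\<bar> ^ 3"
proof -
  have "\<bar>E w - gs 0 * w\<bar> \<le> \<bar>w\<bar> ^ Suc 2"
  proof (rule abs_le_of_deriv_power_bound[where F' = "\<lambda>w. gs w - gs 0"])
    show "((\<lambda>w. E w - gs 0 * w) has_real_derivative gs z - gs 0) (at z)" for z
      by (auto intro!: derivative_eq_intros)
    show "\<bar>gs z - gs 0\<bar> \<le> \<bar>z\<bar> ^ 2" for z
      using gs_taylor2[of z] by simp
  qed (simp add: E_0)
  then show ?thesis by simp
qed

lemma E_taylor5: "\<bar>E w - gs 0 * (w - w ^ 3 / 12)\<bar> \<le> \<bar>w\<bar> ^ 5"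
proof -
  have "\<bar>E w - gs 0 * (w - w ^ 3 / 12)\<bar> \<le> \<bar>w\<bar> ^ Suc 4"
  proof (rule abs_le_of_deriv_power_bound[where F' = "\<lambda>w. gs w - gs 0 * (1 - w\<^sup>2 / 4)"])
    show "((\<lambda>w. E w - gs 0 * (w - w ^ 3 / 12)) has_real_derivative gs z - gs 0 * (1 - z\<^sup>2 / 4)) (at z)" for z
      by (auto intro!: derivative_eq_intros simp: power2_eq_square)
    show "\<bar>gs z - gs 0 * (1 - z\<^sup>2 / 4)\<bar> \<le> \<bar>z\<bar> ^ 4" for z
      using gs_taylor4[of z] by simp
  qed (simp add: E_0)
  then show ?thesis by simp
qed

lemma half_line_0: "(LINT t|lborel. gd 0 (y - t) * indicator {..a} t) = 1 / 2 + E (a - y)"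
proof -
  have "(LINT t|lborel. gd 0 (y - t) * indicator {..a} t) = (LINT t|lborel. gs t * indicator {..a - y} t)"
    by (subst lborel_integral_real_affine[where c = 1 and t = y])
       (auto intro!: Bochner_Integration.integral_cong simp: indicator_def gd_0)
  then show ?thesis by (simp add: E_def)
qed

text \<open>Obtained by differentiating \<open>half_line_0\<close> in y in two ways, on the kernel
  and on the closed form, instead of evaluating the integral; \<open>half_line_2\<close> repeats the
  argument.\<close>

lemma half_line_1: "(LINT t|lborel. gd 1 (y - t) * indicator {..a} t) = - gs (a - y)"
proof (rule DERIV_unique)
  have "((\<lambda>y. LINT t|lborel. gd 0 (y - t) * indicator {..a} t) has_real_derivative
          (LINT t|lborel. gd (Suc 0) (y - t) * indicator {..a} t)) (at y)"
    by (rule gd_convolution_deriv[where B = 1]) (auto simp: indicator_def)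
  then show "((\<lambda>y. 1 / 2 + E (a - y)) has_real_derivative
          (LINT t|lborel. gd 1 (y - t) * indicator {..a} t)) (at y)"
    unfolding half_line_0 One_nat_def .
  show "((\<lambda>y. 1 / 2 + E (a - y)) has_real_derivative - gs (a - y)) (at y)"
    by (auto intro!: derivative_eq_intros)
qed

lemma half_line_2: "(LINT t|lborel. gd 2 (y - t) * indicator {..a} t) = gd 1 (a - y)"
proof (rule DERIV_unique)
  have "((\<lambda>y. LINT t|lborel. gd 1 (y - t) * indicator {..a} t) has_real_derivative
          (LINT t|lborel. gd (Suc 1) (y - t) * indicator {..a} t)) (at y)"
    by (rule gd_convolution_deriv[where B = 1]) (auto simp: indicator_def)
  then show "((\<lambda>y. - gs (a - y)) has_real_derivative
          (LINT t|lborel. gd 2 (y - t) * indicator {..a} t)) (at y)"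
    unfolding half_line_1 Suc_1 .
  show "((\<lambda>y. - gs (a - y)) has_real_derivative gd 1 (a - y)) (at y)"
    unfolding gd_0[symmetric] by (auto intro!: derivative_eq_intros)
qed

section \<open>Weighted remainder estimates\<close>

text \<open>\<open>bnd Q a b f\<close> reads \<open>f = O(\<sigma> ^ a * (1 + \<bar>x\<bar>) ^ b)\<close> up to polynomial growth in the integration variable
  \<open>u\<close>, uniformly on \<open>Q\<close>. Since \<open>\<sigma> * (1 + \<bar>x\<bar>) \<le> 2\<close>, a factor \<open>\<sigma>\<close> may be traded for \<open>1 / (1 + \<bar>x\<bar>)\<close>.\<close>

definition bnd :: "(real \<Rightarrow> real \<Rightarrow> real \<Rightarrow> bool) \<Rightarrow> nat \<Rightarrow> nat \<Rightarrow> (real \<Rightarrow> real \<Rightarrow> real \<Rightarrow> real) \<Rightarrow> bool" where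
  "bnd Q a b f \<longleftrightarrow> (\<exists>C n. C \<ge> 0 \<and> (\<forall>\<sigma> x u. 0 < \<sigma> \<and> \<sigma> \<le> 1 \<and> \<sigma> * (1 + \<bar>x\<bar>) \<le> 2 \<and> Q \<sigma> x u \<longrightarrow>
     \<bar>f \<sigma> x u\<bar> \<le> C * \<sigma> ^ a * (1 + \<bar>x\<bar>) ^ b * (1 + \<bar>u\<bar>) ^ n))"

lemma bndI:
  assumes "C \<ge> 0" "\<And>\<sigma> x u. 0 < \<sigma> \<Longrightarrow> \<sigma> \<le> 1 \<Longrightarrow> \<sigma> * (1 + \<bar>x\<bar>) \<le> 2 \<Longrightarrow> Q \<sigma> x u \<Longrightarrow>
     \<bar>f \<sigma> x u\<bar> \<le> C * \<sigma> ^ a * (1 + \<bar>x\<bar>) ^ b * (1 + \<bar>u\<bar>) ^ n"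
  shows "bnd Q a b f"
  unfolding bnd_def using assms by blast

lemma bnd_le:
  assumes "bnd Q a b g" "\<And>\<sigma> x u. 0 < \<sigma> \<Longrightarrow> \<sigma> \<le> 1 \<Longrightarrow> \<sigma> * (1 + \<bar>x\<bar>) \<le> 2 \<Longrightarrow> Q \<sigma> x u \<Longrightarrow> \<bar>f \<sigma> x u\<bar> \<le> \<bar>g \<sigma> x u\<bar>"
  shows "bnd Q a b f"
  using assms unfolding bnd_def by (meson order_trans)

lemma bnd_cong:
  assumes "bnd Q a b g" "\<And>\<sigma> x u. 0 < \<sigma> \<Longrightarrow> \<sigma> \<le> 1 \<Longrightarrow> \<sigma> * (1 + \<bar>x\<bar>) \<le> 2 \<Longrightarrow> Q \<sigma> x u \<Longrightarrow> f \<sigma> x u = g \<sigma> x u"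
  shows "bnd Q a b f"
  by (rule bnd_le[OF assms(1)]) (simp add: assms(2))

lemma bnd_subset:
  assumes "bnd Q a b f" "\<And>\<sigma> x u. P \<sigma> x u \<Longrightarrow> Q \<sigma> x u"
  shows "bnd P a b f"
  using assms unfolding bnd_def by meson

lemma bnd_add:
  assumes "bnd Q a b f" "bnd Q a b g"
  shows "bnd Q a b (\<lambda>\<sigma> x u. f \<sigma> x u + g \<sigma> x u)"
proof -
  obtain C n where C: "C \<ge> 0" "\<And>\<sigma> x u. 0 < \<sigma> \<Longrightarrow> \<sigma> \<le> 1 \<Longrightarrow> \<sigma> * (1 + \<bar>x\<bar>) \<le> 2 \<Longrightarrow> Q \<sigma> x u \<Longrightarrow>
     \<bar>f \<sigma> x u\<bar> \<le> C * \<sigma> ^ a * (1 + \<bar>x\<bar>) ^ b * (1 + \<bar>u\<bar>) ^ n"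
    using assms(1) unfolding bnd_def by blast
  obtain D m where D: "D \<ge> 0" "\<And>\<sigma> x u. 0 < \<sigma> \<Longrightarrow> \<sigma> \<le> 1 \<Longrightarrow> \<sigma> * (1 + \<bar>x\<bar>) \<le> 2 \<Longrightarrow> Q \<sigma> x u \<Longrightarrow>
     \<bar>g \<sigma> x u\<bar> \<le> D * \<sigma> ^ a * (1 + \<bar>x\<bar>) ^ b * (1 + \<bar>u\<bar>) ^ m"
    using assms(2) unfolding bnd_def by blast
  show ?thesis
  proof (rule bndI[of "C + D" _ _ _ _ "max n m"])
    fix \<sigma> x u :: real assume H: "0 < \<sigma>" "\<sigma> \<le> 1" "\<sigma> * (1 + \<bar>x\<bar>) \<le> 2" "Q \<sigma> x u"
    have "C * \<sigma> ^ a * (1 + \<bar>x\<bar>) ^ b * (1 + \<bar>u\<bar>) ^ n \<le> C * \<sigma> ^ a * (1 + \<bar>x\<bar>) ^ b * (1 + \<bar>u\<bar>) ^ max n m"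
      "D * \<sigma> ^ a * (1 + \<bar>x\<bar>) ^ b * (1 + \<bar>u\<bar>) ^ m \<le> D * \<sigma> ^ a * (1 + \<bar>x\<bar>) ^ b * (1 + \<bar>u\<bar>) ^ max n m"
      using C(1) D(1) H by (auto intro!: mult_left_mono power_increasing)
    then show "\<bar>f \<sigma> x u + g \<sigma> x u\<bar> \<le> (C + D) * \<sigma> ^ a * (1 + \<bar>x\<bar>) ^ b * (1 + \<bar>u\<bar>) ^ max n m"
      using C(2)[OF H] D(2)[OF H] unfolding distrib_right by linarith
  qed (use C D in auto)
qed

lemma bnd_mult:
  assumes "bnd Q a b f" "bnd Q a' b' g" "c = a + a'" "d = b + b'"
  shows "bnd Q c d (\<lambda>\<sigma> x u. f \<sigma> x u * g \<sigma> x u)"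
proof -
  obtain C n where C: "C \<ge> 0" "\<And>\<sigma> x u. 0 < \<sigma> \<Longrightarrow> \<sigma> \<le> 1 \<Longrightarrow> \<sigma> * (1 + \<bar>x\<bar>) \<le> 2 \<Longrightarrow> Q \<sigma> x u \<Longrightarrow>
     \<bar>f \<sigma> x u\<bar> \<le> C * \<sigma> ^ a * (1 + \<bar>x\<bar>) ^ b * (1 + \<bar>u\<bar>) ^ n"
    using assms(1) unfolding bnd_def by blast
  obtain D m where D: "D \<ge> 0" "\<And>\<sigma> x u. 0 < \<sigma> \<Longrightarrow> \<sigma> \<le> 1 \<Longrightarrow> \<sigma> * (1 + \<bar>x\<bar>) \<le> 2 \<Longrightarrow> Q \<sigma> x u \<Longrightarrow>
     \<bar>g \<sigma> x u\<bar> \<le> D * \<sigma> ^ a' * (1 + \<bar>x\<bar>) ^ b' * (1 + \<bar>u\<bar>) ^ m"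
    using assms(2) unfolding bnd_def by blast
  show ?thesis
  proof (rule bndI[of "C * D" _ _ _ _ "n + m"])
    fix \<sigma> x u :: real assume H: "0 < \<sigma>" "\<sigma> \<le> 1" "\<sigma> * (1 + \<bar>x\<bar>) \<le> 2" "Q \<sigma> x u"
    have "\<bar>f \<sigma> x u * g \<sigma> x u\<bar> \<le> (C * \<sigma> ^ a * (1 + \<bar>x\<bar>) ^ b * (1 + \<bar>u\<bar>) ^ n) * (D * \<sigma> ^ a' * (1 + \<bar>x\<bar>) ^ b' * (1 + \<bar>u\<bar>) ^ m)"
      unfolding abs_mult using C(1) D(1) H by (intro mult_mono C(2) D(2)) auto
    then show "\<bar>f \<sigma> x u * g \<sigma> x u\<bar> \<le> C * D * \<sigma> ^ c * (1 + \<bar>x\<bar>) ^ d * (1 + \<bar>u\<bar>) ^ (n + m)"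
      by (simp add: assms power_add mult_ac)
  qed (use C D in auto)
qed

text \<open>With e = a - a', the surplus factor \<sigma>^e pays for e factors 1 + |x| at the price
  2^e, so b may exceed b' by up to e.\<close>

lemma bnd_weaken:
  assumes "bnd Q a b f" "a' \<le> a" "b + a' \<le> b' + a"
  shows "bnd Q a' b' f"
proof -
  obtain C n where C: "C \<ge> 0" "\<And>\<sigma> x u. 0 < \<sigma> \<Longrightarrow> \<sigma> \<le> 1 \<Longrightarrow> \<sigma> * (1 + \<bar>x\<bar>) \<le> 2 \<Longrightarrow> Q \<sigma> x u \<Longrightarrow>
     \<bar>f \<sigma> x u\<bar> \<le> C * \<sigma> ^ a * (1 + \<bar>x\<bar>) ^ b * (1 + \<bar>u\<bar>) ^ n"
    using assms(1) unfolding bnd_def by blast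
  define e where "e = a - a'"
  have a: "a = a' + e" using assms e_def by auto
  show ?thesis
  proof (rule bndI[of "C * 2 ^ e" _ _ _ _ n])
    fix \<sigma> x u :: real assume H: "0 < \<sigma>" "\<sigma> \<le> 1" "\<sigma> * (1 + \<bar>x\<bar>) \<le> 2" "Q \<sigma> x u"
    have "\<sigma> ^ a * (1 + \<bar>x\<bar>) ^ b \<le> \<sigma> ^ a * (1 + \<bar>x\<bar>) ^ (b' + e)"
      using H assms a by (intro mult_left_mono power_increasing) auto
    also have "\<dots> = \<sigma> ^ a' * (1 + \<bar>x\<bar>) ^ b' * (\<sigma> * (1 + \<bar>x\<bar>)) ^ e"
      by (simp add: a power_add power_mult_distrib mult_ac)
    also have "\<dots> \<le> \<sigma> ^ a' * (1 + \<bar>x\<bar>) ^ b' * 2 ^ e"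
      using H by (intro mult_left_mono power_mono) auto
    finally have "C * (1 + \<bar>u\<bar>) ^ n * (\<sigma> ^ a * (1 + \<bar>x\<bar>) ^ b) \<le> C * (1 + \<bar>u\<bar>) ^ n * (\<sigma> ^ a' * (1 + \<bar>x\<bar>) ^ b' * 2 ^ e)"
      using C(1) by (intro mult_left_mono) auto
    with C(2)[OF H] show "\<bar>f \<sigma> x u\<bar> \<le> C * 2 ^ e * \<sigma> ^ a' * (1 + \<bar>x\<bar>) ^ b' * (1 + \<bar>u\<bar>) ^ n"
      by (simp add: mult_ac)
  qed (use C in auto)
qed

lemma bnd_minus: "bnd Q a b f \<Longrightarrow> bnd Q a b (\<lambda>\<sigma> x u. - f \<sigma> x u)"
  by (erule bnd_le) simp

lemma bnd_diff:
  assumes "bnd Q a b f" "bnd Q a b g"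
  shows "bnd Q a b (\<lambda>\<sigma> x u. f \<sigma> x u - g \<sigma> x u)"
  using bnd_add[OF assms(1) bnd_minus[OF assms(2)]] by simp

lemma bnd_const: "bnd Q 0 b (\<lambda>\<sigma> x u. c)"
proof (rule bnd_weaken)
  show "bnd Q 0 0 (\<lambda>\<sigma> x u. c)" by (rule bndI[of "\<bar>c\<bar>" _ _ _ _ 0]) auto
qed auto

lemma bnd_cmult: "bnd Q a b f \<Longrightarrow> bnd Q a b (\<lambda>\<sigma> x u. c * f \<sigma> x u)"
  using bnd_mult[OF bnd_const[of Q 0 c]] by simp

lemma bnd_divc: "bnd Q a b f \<Longrightarrow> bnd Q a b (\<lambda>\<sigma> x u. f \<sigma> x u / c)"
  using bnd_cmult[of Q a b f "1 / c"] by simp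

lemma bnd_sigma: "bnd Q a 0 (\<lambda>\<sigma> x u. \<sigma> ^ a)" 
  by (rule bndI[of 1 _ _ _ _ 0]) auto

lemma bnd_sigma_mult: "bnd Q a b f \<Longrightarrow> c = n + a \<Longrightarrow> bnd Q c b (\<lambda>\<sigma> x u. \<sigma> ^ n * f \<sigma> x u)"
  by (rule bnd_mult[OF bnd_sigma]) auto

lemma bnd_power:
  assumes "bnd Q a b f"
  shows "bnd Q (n * a) (n * b) (\<lambda>\<sigma> x u. f \<sigma> x u ^ n)"
proof (induction n)
  case 0 show ?case using bnd_const[of Q 0 1] by simp
next
  case (Suc n) show ?case using bnd_mult[OF assms Suc refl refl] by simp
qed

lemma bnd_powerI: "bnd Q a b f \<Longrightarrow> c = n * a \<Longrightarrow> d = n * b \<Longrightarrow> bnd Q c d (\<lambda>\<sigma> x u. f \<sigma> x u ^ n)"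
  using bnd_power by blast

lemma bnd_x: "bnd Q 0 1 (\<lambda>\<sigma> x u. x)"
  by (rule bndI[of 1 _ _ _ _ 0]) auto

lemma bnd_u: "bnd Q 0 0 (\<lambda>\<sigma> x u. u)"
  by (rule bndI[of 1 _ _ _ _ 1]) auto

lemma bnd_x_power: "n \<le> b \<Longrightarrow> bnd Q 0 b (\<lambda>\<sigma> x u. x ^ n)"
  by (rule bnd_weaken[OF bnd_power[OF bnd_x]]) auto

lemma bnd_u_power: "bnd Q 0 b (\<lambda>\<sigma> x u. u ^ n)"
  by (rule bnd_weaken[OF bnd_power[OF bnd_u]]) auto

lemma bnd_xu_power: "n \<le> b \<Longrightarrow> bnd Q 0 b (\<lambda>\<sigma> x u. (x + u) ^ n)"
  by (rule bnd_weaken[OF bnd_power[OF bnd_add[OF bnd_x bnd_weaken[OF bnd_u]]]]) auto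

lemma bnd_union:
  assumes "bnd (\<lambda>\<sigma> x u. Q \<sigma> x u \<and> P \<sigma> x u) a b f" "bnd (\<lambda>\<sigma> x u. Q \<sigma> x u \<and> \<not> P \<sigma> x u) a b f"
  shows "bnd Q a b f"
proof -
  let ?P = "\<lambda>\<sigma> x u. Q \<sigma> x u \<and> P \<sigma> x u" and ?N = "\<lambda>\<sigma> x u. Q \<sigma> x u \<and> \<not> P \<sigma> x u"
  have "bnd Q a b (\<lambda>\<sigma> x u. if P \<sigma> x u then f \<sigma> x u else 0)"
    "bnd Q a b (\<lambda>\<sigma> x u. if \<not> P \<sigma> x u then f \<sigma> x u else 0)"
  proof -
    have *: "bnd Q a b (\<lambda>\<sigma> x u. if R \<sigma> x u then f \<sigma> x u else 0)"
      if R: "bnd (\<lambda>\<sigma> x u. Q \<sigma> x u \<and> R \<sigma> x u) a b f" for R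
    proof -
      obtain C n where C: "C \<ge> 0" "\<And>\<sigma> x u. 0 < \<sigma> \<Longrightarrow> \<sigma> \<le> 1 \<Longrightarrow> \<sigma> * (1 + \<bar>x\<bar>) \<le> 2 \<Longrightarrow> Q \<sigma> x u \<Longrightarrow> R \<sigma> x u \<Longrightarrow>
        \<bar>f \<sigma> x u\<bar> \<le> C * \<sigma> ^ a * (1 + \<bar>x\<bar>) ^ b * (1 + \<bar>u\<bar>) ^ n"
        using R unfolding bnd_def by blast
      show ?thesis by (rule bndI[of C _ _ _ _ n]) (use C in auto)
    qed
    show "bnd Q a b (\<lambda>\<sigma> x u. if P \<sigma> x u then f \<sigma> x u else 0)"
      "bnd Q a b (\<lambda>\<sigma> x u. if \<not> P \<sigma> x u then f \<sigma> x u else 0)"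
      using *[OF assms(1)] *[OF assms(2)] by simp_all
  qed
  from bnd_add[OF this] show ?thesis by (rule bnd_cong) auto
qed

text \<open>Where \<open>\<sigma> u\<close> is bounded away from 0, powers of \<open>\<sigma>\<close> can be bought with powers of \<open>u\<close>.\<close>

lemma bnd_far:
  assumes "bnd Q a b f" "\<rho> > 0" "\<And>\<sigma> x u. Q \<sigma> x u \<Longrightarrow> \<sigma> > 0 \<Longrightarrow> \<rho> \<le> \<sigma> * \<bar>u\<bar>" "c = a + n"
  shows "bnd Q c b f"
proof (rule bnd_le)
  have "bnd Q n 0 (\<lambda>\<sigma> x u. (1 / \<rho>) ^ n * (\<sigma> ^ n * u ^ n))"
    by (intro bnd_cmult bnd_mult[OF bnd_sigma bnd_u_power]) auto
  from bnd_mult[OF assms(1) this refl refl] assms(4)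
  show "bnd Q c b (\<lambda>\<sigma> x u. f \<sigma> x u * ((1 / \<rho>) ^ n * (\<sigma> ^ n * u ^ n)))" by simp
  fix \<sigma> x u :: real assume "0 < \<sigma>" "Q \<sigma> x u"
  then have "1 \<le> (\<sigma> * \<bar>u\<bar> / \<rho>) ^ n" using assms(2,3) by (intro one_le_power) auto
  then have "\<bar>f \<sigma> x u\<bar> * 1 \<le> \<bar>f \<sigma> x u\<bar> * (\<sigma> * \<bar>u\<bar> / \<rho>) ^ n" by (intro mult_left_mono) auto
  then show "\<bar>f \<sigma> x u\<bar> \<le> \<bar>f \<sigma> x u * ((1 / \<rho>) ^ n * (\<sigma> ^ n * u ^ n))\<bar>"
    using \<open>0 < \<sigma>\<close> assms(2) by (simp add: abs_mult power_mult_distrib power_divide power_abs)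
qed

text \<open>A non-integrable h has integral 0 by convention, which the nonnegative integral of g
  dominates; otherwise this is the usual bound.\<close>

lemma integral_abs_le_of_abs_le:
  fixes h g :: "real \<Rightarrow> real"
  assumes "integrable lborel g" "\<And>u. \<bar>h u\<bar> \<le> g u"
  shows "\<bar>integral\<^sup>L lborel h\<bar> \<le> integral\<^sup>L lborel g"
proof (cases "integrable lborel h")
  case True
  then show ?thesis by (rule integral_abs_bound_integral) (use assms in auto)
next
  case False
  have "0 \<le> g u" for u using assms(2)[of u] by linarith
  then have "0 \<le> integral\<^sup>L lborel g" by (intro Bochner_Integration.integral_nonneg)
  then show ?thesis using False by (simp add: not_integrable_integral_eq)
qed

text \<open>The polynomial growth in u is absorbed by a finite Gaussian moment, so a pointwise
  expansion of e becomes an expansion of its integral with the same powers of \<sigma> and 1 + |x|.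
  The result is phrased with \<open>bnd\<close> again, now constant in u.\<close>

lemma integral_gd_of_bnd:
  assumes "bnd Q a b (\<lambda>\<sigma> x u. e \<sigma> x u - p \<sigma> x u)"
    and Q: "\<And>\<sigma> x u. R \<sigma> x \<Longrightarrow> Q \<sigma> x u"
    and e: "\<And>\<sigma> x. R \<sigma> x \<Longrightarrow> integrable lborel (\<lambda>u. gd j (- u) * e \<sigma> x u)"
    and p: "\<And>\<sigma> x. R \<sigma> x \<Longrightarrow> has_bochner_integral lborel (\<lambda>u. gd j (- u) * p \<sigma> x u) (T \<sigma> x)"
  shows "bnd (\<lambda>\<sigma> x u. R \<sigma> x) a b (\<lambda>\<sigma> x u. (LINT u|lborel. gd j (- u) * e \<sigma> x u) - T \<sigma> x)"
proof -
  obtain C n where C: "C \<ge> 0" "\<And>\<sigma> x u. 0 < \<sigma> \<Longrightarrow> \<sigma> \<le> 1 \<Longrightarrow> \<sigma> * (1 + \<bar>x\<bar>) \<le> 2 \<Longrightarrow> Q \<sigma> x u \<Longrightarrow>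
     \<bar>e \<sigma> x u - p \<sigma> x u\<bar> \<le> C * \<sigma> ^ a * (1 + \<bar>x\<bar>) ^ b * (1 + \<bar>u\<bar>) ^ n"
    using assms(1) unfolding bnd_def by blast
  define K where "K = (LINT u|lborel. (1 + \<bar>u\<bar>) ^ n * \<bar>gd j (- u)\<bar>)"
  have ig: "integrable lborel (\<lambda>u. (1 + \<bar>u\<bar>) ^ n * \<bar>gd j (- u)\<bar>)"
    using lborel_integrable_real_affine[OF integrable_power_gd[of n j], of "-1" 0] by simp
  show ?thesis
  proof (rule bndI[of "C * K" _ _ _ _ 0])
    show "0 \<le> C * K" unfolding K_def using C(1) by (intro mult_nonneg_nonneg Bochner_Integration.integral_nonneg) auto
    fix \<sigma> x u :: real assume H: "0 < \<sigma>" "\<sigma> \<le> 1" "\<sigma> * (1 + \<bar>x\<bar>) \<le> 2" "R \<sigma> x"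
    have eq: "(LINT u|lborel. gd j (- u) * e \<sigma> x u) - T \<sigma> x = (LINT u|lborel. gd j (- u) * e \<sigma> x u - gd j (- u) * p \<sigma> x u)"
      using e[OF H(4)] p[OF H(4)] by (simp add: has_bochner_integral_iff)
    have "\<bar>LINT u|lborel. gd j (- u) * e \<sigma> x u - gd j (- u) * p \<sigma> x u\<bar>
        \<le> (LINT u|lborel. C * \<sigma> ^ a * (1 + \<bar>x\<bar>) ^ b * ((1 + \<bar>u\<bar>) ^ n * \<bar>gd j (- u)\<bar>))"
    proof (rule integral_abs_le_of_abs_le)
      fix u :: real
      have "\<bar>e \<sigma> x u - p \<sigma> x u\<bar> * \<bar>gd j (- u)\<bar> \<le> C * \<sigma> ^ a * (1 + \<bar>x\<bar>) ^ b * (1 + \<bar>u\<bar>) ^ n * \<bar>gd j (- u)\<bar>"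
        using C(2)[OF H(1-3) Q[OF H(4)]] by (intro mult_right_mono) auto
      then show "\<bar>gd j (- u) * e \<sigma> x u - gd j (- u) * p \<sigma> x u\<bar> \<le> C * \<sigma> ^ a * (1 + \<bar>x\<bar>) ^ b * ((1 + \<bar>u\<bar>) ^ n * \<bar>gd j (- u)\<bar>)"
        unfolding right_diff_distrib[symmetric] abs_mult by (simp add: mult_ac)
    qed (intro integrable_mult_right ig)
    also have "\<dots> = C * K * \<sigma> ^ a * (1 + \<bar>x\<bar>) ^ b"
      unfolding integral_mult_right_zero K_def[symmetric] by (simp only: mult_ac)
    finally show "\<bar>(LINT u|lborel. gd j (- u) * e \<sigma> x u) - T \<sigma> x\<bar> \<le> C * K * \<sigma> ^ a * (1 + \<bar>x\<bar>) ^ b * (1 + \<bar>u\<bar>) ^ 0"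
      unfolding eq by (simp only: power_0 mult_1_right)
  qed
qed

text \<open>The integrands differ only where \<sigma> |t| \<ge> r. There |y - t| is at least r / (2
  \<sigma>), hence (2 \<sigma> / r) (1 + |y - t|) \<ge> 1, and any power n of this quantity may be
  inserted: the far field is smaller than every power of \<sigma>.\<close>

lemma W_half_line_error:
  assumes "A \<in> sets borel" "r > 0" "\<sigma> > 0" "\<sigma> * \<bar>y\<bar> < r / 2"
    and "\<And>t. \<sigma> * \<bar>t\<bar> < r \<Longrightarrow> (s, t) \<in> A \<longleftrightarrow> t \<le> a"
  shows "\<bar>W k (indicator A) s y - (LINT t|lborel. gd k (y - t) * indicator {..a} t)\<bar>
     \<le> (2 * \<sigma> / r) ^ n * (LINT t|lborel. (1 + \<bar>t\<bar>) ^ n * \<bar>gd k t\<bar>)"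
proof -
  have i1: "integrable lborel (\<lambda>t. gd k (y - t) * indicator A (s, t))"
    by (rule integrable_gd_shift_bounded[OF borel_measurable_section(1), where B = 1])
       (use assms in \<open>auto simp: indicator_def\<close>)
  have i2: "integrable lborel (\<lambda>t. gd k (y - t) * indicator {..a} t)"
    by (rule integrable_gd_shift_bounded[where B = 1]) (auto simp: indicator_def)
  have "W k (indicator A) s y - (LINT t|lborel. gd k (y - t) * indicator {..a} t)
     = (LINT t|lborel. gd k (y - t) * indicator A (s, t) - gd k (y - t) * indicator {..a} t)"
    unfolding W_def using i1 i2 by simp
  also have "\<bar>\<dots>\<bar> \<le> (LINT t|lborel. (2 * \<sigma> / r) ^ n * ((1 + \<bar>y - t\<bar>) ^ n * \<bar>gd k (y - t)\<bar>))"
  proof (rule integral_abs_le_of_abs_le)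
    fix t :: real
    show "\<bar>gd k (y - t) * indicator A (s, t) - gd k (y - t) * indicator {..a} t\<bar>
        \<le> (2 * \<sigma> / r) ^ n * ((1 + \<bar>y - t\<bar>) ^ n * \<bar>gd k (y - t)\<bar>)"
    proof (cases "\<sigma> * \<bar>t\<bar> < r")
      case True
      then have "indicator A (s, t) = (indicator {..a} t :: real)" using assms(5) by (simp add: indicator_def)
      then show ?thesis using assms by simp
    next
      case False
      have "\<bar>t\<bar> \<le> \<bar>y\<bar> + \<bar>y - t\<bar>" by linarith
      then have "\<sigma> * \<bar>t\<bar> \<le> \<sigma> * \<bar>y\<bar> + \<sigma> * \<bar>y - t\<bar>"
        using assms(3) by (simp add: distrib_left[symmetric])
      then have "r / 2 \<le> \<sigma> * (1 + \<bar>y - t\<bar>)" using False assms(3,4) by (simp add: distrib_left)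
      then have "1 \<le> (2 * \<sigma> / r) * (1 + \<bar>y - t\<bar>)" using assms(2) by (simp add: field_simps)
      then have "1 \<le> ((2 * \<sigma> / r) * (1 + \<bar>y - t\<bar>)) ^ n" by (rule one_le_power)
      then have "\<bar>gd k (y - t)\<bar> * 1 \<le> \<bar>gd k (y - t)\<bar> * ((2 * \<sigma> / r) * (1 + \<bar>y - t\<bar>)) ^ n"
        by (intro mult_left_mono) auto
      moreover have "\<bar>gd k (y - t) * indicator A (s, t) - gd k (y - t) * indicator {..a} t\<bar> \<le> \<bar>gd k (y - t)\<bar>"
        by (auto simp: indicator_def)
      moreover have "\<bar>gd k (y - t)\<bar> * ((2 * \<sigma> / r) * (1 + \<bar>y - t\<bar>)) ^ n
          = (2 * \<sigma> / r) ^ n * ((1 + \<bar>y - t\<bar>) ^ n * \<bar>gd k (y - t)\<bar>)"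
        by (simp only: power_mult_distrib mult_ac)
      ultimately show ?thesis by linarith
    qed
  qed (intro integrable_mult_right, use lborel_integrable_real_affine[OF integrable_power_gd[of n k], of "-1" y] in simp)
  also have "\<dots> = (2 * \<sigma> / r) ^ n * (LINT t|lborel. (1 + \<bar>t\<bar>) ^ n * \<bar>gd k t\<bar>)"
    using lborel_integral_real_affine[of "-1" "\<lambda>t. (1 + \<bar>t\<bar>) ^ n * \<bar>gd k t\<bar>" y] by simp
  finally show ?thesis .
qed

section \<open>Differentiating an implicitly defined graph\<close>

lemma continuous_V:
  assumes "\<phi> \<in> borel_measurable borel" "\<And>q. \<bar>\<phi> q\<bar> \<le> B"
  shows "isCont (\<lambda>(x, y). V j k \<phi> x y) p"
proof -
  obtain x y where p: "p = (x, y)" by fastforce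
  define K where "K = \<bar>B * gd_norm k * gd_norm (Suc j)\<bar> + \<bar>B * gd_norm (Suc k) * gd_norm j\<bar>"
  \<comment> \<open>Both partial derivatives are bounded on the whole plane, so moving in one
    coordinate at a time gives a joint Lipschitz bound.\<close>
  have lip: "\<bar>V j k \<phi> a b - V j k \<phi> x y\<bar> \<le> K * (\<bar>a - x\<bar> + \<bar>b - y\<bar>)" for a b
  proof -
    have "norm (V j k \<phi> a b - V j k \<phi> x b) \<le> K * norm (a - x)"
    proof (rule field_differentiable_bound[where S = UNIV and f' = "\<lambda>x. V (Suc j) k \<phi> x b"])
      show "norm (V (Suc j) k \<phi> z b) \<le> K" for z
        using V_bound[OF assms, of "Suc j" k z b] unfolding K_def real_norm_def by linarith
    qed (use V_deriv_x[OF assms] in auto)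
    moreover have "norm (V j k \<phi> x b - V j k \<phi> x y) \<le> K * norm (b - y)"
    proof (rule field_differentiable_bound[where S = UNIV and f' = "\<lambda>y. V j (Suc k) \<phi> x y"])
      show "norm (V j (Suc k) \<phi> x z) \<le> K" for z
        using V_bound[OF assms, of j "Suc k" x z] unfolding K_def real_norm_def by linarith
    qed (use V_deriv_y[OF assms] in auto)
    ultimately show ?thesis unfolding distrib_left by simp
  qed
  have "((\<lambda>q. K * (\<bar>fst q - x\<bar> + \<bar>snd q - y\<bar>)) \<longlongrightarrow> K * (\<bar>fst (x, y) - x\<bar> + \<bar>snd (x, y) - y\<bar>)) (at (x, y))"
    by (intro tendsto_intros)
  then have "((\<lambda>q. K * (\<bar>fst q - x\<bar> + \<bar>snd q - y\<bar>)) \<longlongrightarrow> 0) (at (x, y))" by simp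
  then have "((\<lambda>q. (case q of (x, y) \<Rightarrow> V j k \<phi> x y) - V j k \<phi> x y) \<longlongrightarrow> 0) (at (x, y))"
    by (rule Lim_null_comparison[rotated]) (auto intro!: always_eventually simp: lip)
  then show ?thesis unfolding p isCont_def by (simp add: LIM_zero_iff)
qed

lemma MVT_between:
  fixes f f' :: "real \<Rightarrow> real"
  assumes "\<And>z. (f has_real_derivative f' z) (at z)"
  shows "\<exists>z. min a b \<le> z \<and> z \<le> max a b \<and> f b - f a = (b - a) * f' z"
proof (cases a b rule: linorder_cases)
  case less
  from MVT2[of a b f f', OF less assms] obtain z where "a < z" "z < b" "f b - f a = (b - a) * f' z" by auto
  then show ?thesis by (intro exI[of _ z]) auto
next
  case equal then show ?thesis by auto
next
  case greater
  from MVT2[of b a f f', OF greater assms] obtain z where "b < z" "z < a" "f a - f b = (a - b) * f' z" by auto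
  then show ?thesis by (intro exI[of _ z]) (auto simp: algebra_simps)
qed

text \<open>The graph is given through the sign of F. The strict sign change of F x0 across \<kappa>
  x0 persists for nearby x and traps \<kappa> x, so \<kappa> is continuous at x0. Mean values along
  a horizontal segment at height \<kappa> x and a vertical one over x0 then yield the difference
  quotient.\<close>

lemma implicit_function_deriv:
  fixes F Fx Fy :: "real \<Rightarrow> real \<Rightarrow> real" and \<kappa> :: "real \<Rightarrow> real"
  assumes dx: "\<And>x y. ((\<lambda>x. F x y) has_real_derivative Fx x y) (at x)"
    and dy: "\<And>x y. ((\<lambda>y. F x y) has_real_derivative Fy x y) (at y)"
    and cx: "isCont (\<lambda>(x, y). Fx x y) (x0, \<kappa> x0)" and cy: "isCont (\<lambda>(x, y). Fy x y) (x0, \<kappa> x0)"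
    and neg: "Fy x0 (\<kappa> x0) < 0"
    and box: "\<delta> > 0" "\<And>x y. \<bar>x - x0\<bar> < \<delta> \<Longrightarrow> \<bar>y - \<kappa> x0\<bar> < \<delta> \<Longrightarrow> F x y \<ge> 0 \<longleftrightarrow> y \<le> \<kappa> x"
    and zero: "\<And>x. \<bar>x - x0\<bar> < \<delta> \<Longrightarrow> F x (\<kappa> x) = 0"
  shows "(\<kappa> has_real_derivative - Fx x0 (\<kappa> x0) / Fy x0 (\<kappa> x0)) (at x0)"
proof -
  have contx: "((\<lambda>x. F x y) \<longlongrightarrow> F x0 y) (at x0)" for y
    using DERIV_isCont[OF dx] by (simp add: isCont_def)
  have cont: "(\<kappa> \<longlongrightarrow> \<kappa> x0) (at x0)"
  proof (rule tendstoI)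
    fix e :: real assume e: "e > 0"
    obtain d where d: "d > 0" "\<And>h. h > 0 \<Longrightarrow> h < d \<Longrightarrow> F x0 (\<kappa> x0) < F x0 (\<kappa> x0 - h)"
      using DERIV_neg_dec_left[OF dy neg] by blast
    define h where "h = min (min e d) \<delta> / 2"
    have h: "h > 0" "h < e" "h < d" "h < \<delta>" using e d(1) box(1) by (auto simp: h_def)
    have "F x0 (\<kappa> x0 - h) > 0" using d(2)[of h] h zero[of x0] box(1) by simp
    moreover have "F x0 (\<kappa> x0 + h) < 0" using box(2)[of x0 "\<kappa> x0 + h"] h box(1) by auto
    ultimately have "\<forall>\<^sub>F x in at x0. F x (\<kappa> x0 - h) > 0" "\<forall>\<^sub>F x in at x0. F x (\<kappa> x0 + h) < 0"
      using order_tendstoD(1)[OF contx] order_tendstoD(2)[OF contx] by auto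
    moreover have "\<forall>\<^sub>F x in at x0. \<bar>x - x0\<bar> < \<delta>"
      using box(1) by (auto simp: eventually_at dist_real_def intro!: exI[of _ \<delta>])
    ultimately show "\<forall>\<^sub>F x in at x0. dist (\<kappa> x) (\<kappa> x0) < e"
    proof eventually_elim
      case (elim x)
      have "\<kappa> x0 - h \<le> \<kappa> x" using box(2)[of x "\<kappa> x0 - h"] elim h by auto
      moreover have "\<kappa> x < \<kappa> x0 + h" using box(2)[of x "\<kappa> x0 + h"] elim h by auto
      ultimately show ?case using h by (auto simp: dist_real_def)
    qed
  qed
  have "\<exists>z. min x0 x \<le> z \<and> z \<le> max x0 x \<and> F x (\<kappa> x) - F x0 (\<kappa> x) = (x - x0) * Fx z (\<kappa> x)" for x
    by (rule MVT_between[of "\<lambda>x'. F x' (\<kappa> x)" "\<lambda>x'. Fx x' (\<kappa> x)" x0 x]) (rule dx)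
  then have "\<forall>x. \<exists>z. min x0 x \<le> z \<and> z \<le> max x0 x \<and> F x (\<kappa> x) - F x0 (\<kappa> x) = (x - x0) * Fx z (\<kappa> x)"
    by (rule allI)
  from choice[OF this] obtain \<xi> where
    \<xi>: "\<And>x. min x0 x \<le> \<xi> x \<and> \<xi> x \<le> max x0 x \<and> F x (\<kappa> x) - F x0 (\<kappa> x) = (x - x0) * Fx (\<xi> x) (\<kappa> x)"
    by auto
  have "\<exists>z. min (\<kappa> x0) (\<kappa> x) \<le> z \<and> z \<le> max (\<kappa> x0) (\<kappa> x) \<and> F x0 (\<kappa> x) - F x0 (\<kappa> x0) = (\<kappa> x - \<kappa> x0) * Fy x0 z" for x
    by (rule MVT_between[of "F x0" "Fy x0" "\<kappa> x0" "\<kappa> x"]) (rule dy)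
  then have "\<forall>x. \<exists>z. min (\<kappa> x0) (\<kappa> x) \<le> z \<and> z \<le> max (\<kappa> x0) (\<kappa> x) \<and> F x0 (\<kappa> x) - F x0 (\<kappa> x0) = (\<kappa> x - \<kappa> x0) * Fy x0 z"
    by (rule allI)
  from choice[OF this] obtain \<omega> where
    \<omega>: "\<And>x. min (\<kappa> x0) (\<kappa> x) \<le> \<omega> x \<and> \<omega> x \<le> max (\<kappa> x0) (\<kappa> x) \<and>
      F x0 (\<kappa> x) - F x0 (\<kappa> x0) = (\<kappa> x - \<kappa> x0) * Fy x0 (\<omega> x)"
    by auto
  have l\<xi>: "(\<xi> \<longlongrightarrow> x0) (at x0)"
  proof (rule tendsto_sandwich)
    show "((\<lambda>x. min x0 x) \<longlongrightarrow> x0) (at x0)" "((\<lambda>x. max x0 x) \<longlongrightarrow> x0) (at x0)"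
      using tendsto_min[OF tendsto_const[of x0] tendsto_ident_at[of x0 UNIV]]
        tendsto_max[OF tendsto_const[of x0] tendsto_ident_at[of x0 UNIV]] by simp_all
  qed (use \<xi> in auto)
  have l\<omega>: "(\<omega> \<longlongrightarrow> \<kappa> x0) (at x0)"
  proof (rule tendsto_sandwich)
    show "((\<lambda>x. min (\<kappa> x0) (\<kappa> x)) \<longlongrightarrow> \<kappa> x0) (at x0)" "((\<lambda>x. max (\<kappa> x0) (\<kappa> x)) \<longlongrightarrow> \<kappa> x0) (at x0)"
      using tendsto_min[OF tendsto_const[of "\<kappa> x0"] cont] tendsto_max[OF tendsto_const[of "\<kappa> x0"] cont]
      by simp_all
  qed (use \<omega> in auto)
  have "((\<lambda>x. case (\<xi> x, \<kappa> x) of (x, y) \<Rightarrow> Fx x y) \<longlongrightarrow> (case (x0, \<kappa> x0) of (x, y) \<Rightarrow> Fx x y)) (at x0)"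
    by (rule isCont_tendsto_compose[OF cx tendsto_Pair[OF l\<xi> cont]])
  moreover have "((\<lambda>x. case (x0, \<omega> x) of (x, y) \<Rightarrow> Fy x y) \<longlongrightarrow> (case (x0, \<kappa> x0) of (x, y) \<Rightarrow> Fy x y)) (at x0)"
    by (rule isCont_tendsto_compose[OF cy tendsto_Pair[OF tendsto_const l\<omega>]])
  ultimately have L: "((\<lambda>x. Fx (\<xi> x) (\<kappa> x)) \<longlongrightarrow> Fx x0 (\<kappa> x0)) (at x0)"
    and L2: "((\<lambda>x. Fy x0 (\<omega> x)) \<longlongrightarrow> Fy x0 (\<kappa> x0)) (at x0)" by simp_all
  have lim: "((\<lambda>x. - Fx (\<xi> x) (\<kappa> x) / Fy x0 (\<omega> x)) \<longlongrightarrow> - Fx x0 (\<kappa> x0) / Fy x0 (\<kappa> x0)) (at x0)"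
    by (intro tendsto_divide tendsto_minus L L2) (use neg in auto)
  show ?thesis
    unfolding has_field_derivative_iff
  proof (rule Lim_transform_eventually[OF lim])
    have "\<forall>\<^sub>F x in at x0. Fy x0 (\<omega> x) < 0" using L2 neg by (rule order_tendstoD)
    moreover have "\<forall>\<^sub>F x in at x0. \<bar>x - x0\<bar> < \<delta> \<and> x \<noteq> x0"
      using box(1) by (auto simp: eventually_at dist_real_def intro!: exI[of _ \<delta>])
    ultimately show "\<forall>\<^sub>F x in at x0. - Fx (\<xi> x) (\<kappa> x) / Fy x0 (\<omega> x) = (\<kappa> x - \<kappa> x0) / (x - x0)"
    proof eventually_elim
      case (elim x)
      have "F x (\<kappa> x) = 0" "F x0 (\<kappa> x0) = 0" using zero[of x] zero[of x0] elim box(1) by auto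
      then have "(x - x0) * Fx (\<xi> x) (\<kappa> x) + (\<kappa> x - \<kappa> x0) * Fy x0 (\<omega> x) = 0"
        using \<xi>[of x] \<omega>[of x] by linarith
      then show ?case using elim by (simp add: field_simps)
    qed
  qed
qed

text \<open>A chain rule along the graph from separate partial derivatives: the x-increment is taken
  at the fixed height \<kappa> x0, and the y-increment is a mean value of Fy that converges by joint
  continuity.\<close>

lemma partials_chain_deriv:
  fixes F Fx Fy :: "real \<Rightarrow> real \<Rightarrow> real" and \<kappa> :: "real \<Rightarrow> real"
  assumes dx: "((\<lambda>x. F x (\<kappa> x0)) has_real_derivative Fx x0 (\<kappa> x0)) (at x0)"
    and dy: "\<And>x y. ((\<lambda>y. F x y) has_real_derivative Fy x y) (at y)"
    and cy: "isCont (\<lambda>(x, y). Fy x y) (x0, \<kappa> x0)"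
    and \<kappa>: "(\<kappa> has_real_derivative D) (at x0)"
  shows "((\<lambda>x. F x (\<kappa> x)) has_real_derivative Fx x0 (\<kappa> x0) + Fy x0 (\<kappa> x0) * D) (at x0)"
proof -
  have cont: "(\<kappa> \<longlongrightarrow> \<kappa> x0) (at x0)" using DERIV_isCont[OF \<kappa>] by (simp add: isCont_def)
  have "\<exists>z. min (\<kappa> x0) (\<kappa> x) \<le> z \<and> z \<le> max (\<kappa> x0) (\<kappa> x) \<and> F x (\<kappa> x) - F x (\<kappa> x0) = (\<kappa> x - \<kappa> x0) * Fy x z" for x
    by (rule MVT_between[of "F x" "Fy x" "\<kappa> x0" "\<kappa> x"]) (rule dy)
  then have "\<forall>x. \<exists>z. min (\<kappa> x0) (\<kappa> x) \<le> z \<and> z \<le> max (\<kappa> x0) (\<kappa> x) \<and> F x (\<kappa> x) - F x (\<kappa> x0) = (\<kappa> x - \<kappa> x0) * Fy x z"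
    by (rule allI)
  from choice[OF this] obtain \<omega> where
    \<omega>: "\<And>x. min (\<kappa> x0) (\<kappa> x) \<le> \<omega> x \<and> \<omega> x \<le> max (\<kappa> x0) (\<kappa> x) \<and>
      F x (\<kappa> x) - F x (\<kappa> x0) = (\<kappa> x - \<kappa> x0) * Fy x (\<omega> x)"
    by auto
  have l\<omega>: "(\<omega> \<longlongrightarrow> \<kappa> x0) (at x0)"
  proof (rule tendsto_sandwich)
    show "((\<lambda>x. min (\<kappa> x0) (\<kappa> x)) \<longlongrightarrow> \<kappa> x0) (at x0)" "((\<lambda>x. max (\<kappa> x0) (\<kappa> x)) \<longlongrightarrow> \<kappa> x0) (at x0)"
      using tendsto_min[OF tendsto_const[of "\<kappa> x0"] cont] tendsto_max[OF tendsto_const[of "\<kappa> x0"] cont]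
      by simp_all
  qed (use \<omega> in auto)
  have "((\<lambda>x. case (x, \<omega> x) of (x, y) \<Rightarrow> Fy x y) \<longlongrightarrow> (case (x0, \<kappa> x0) of (x, y) \<Rightarrow> Fy x y)) (at x0)"
    by (rule isCont_tendsto_compose[OF cy tendsto_Pair[OF tendsto_ident_at l\<omega>]])
  then have L: "((\<lambda>x. Fy x (\<omega> x)) \<longlongrightarrow> Fy x0 (\<kappa> x0)) (at x0)" by simp
  have q: "((\<lambda>x. (\<kappa> x - \<kappa> x0) / (x - x0)) \<longlongrightarrow> D) (at x0)" "((\<lambda>x. (F x (\<kappa> x0) - F x0 (\<kappa> x0)) / (x - x0)) \<longlongrightarrow> Fx x0 (\<kappa> x0)) (at x0)"
    using \<kappa> dx by (simp_all add: has_field_derivative_iff)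
  have "((\<lambda>x. (F x (\<kappa> x0) - F x0 (\<kappa> x0)) / (x - x0) + Fy x (\<omega> x) * ((\<kappa> x - \<kappa> x0) / (x - x0)))
       \<longlongrightarrow> Fx x0 (\<kappa> x0) + Fy x0 (\<kappa> x0) * D) (at x0)"
    by (intro tendsto_add tendsto_mult L q)
  moreover have "(F x (\<kappa> x0) - F x0 (\<kappa> x0)) / (x - x0) + Fy x (\<omega> x) * ((\<kappa> x - \<kappa> x0) / (x - x0))
      = (F x (\<kappa> x) - F x0 (\<kappa> x0)) / (x - x0)" for x
  proof -
    have "F x (\<kappa> x) - F x0 (\<kappa> x0) = (F x (\<kappa> x0) - F x0 (\<kappa> x0)) + Fy x (\<omega> x) * (\<kappa> x - \<kappa> x0)"
      using \<omega>[of x] by (simp add: mult.commute)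
    then show ?thesis by (simp only: add_divide_distrib times_divide_eq_right)
  qed
  ultimately show ?thesis by (simp add: has_field_derivative_iff)
qed

lemma bnd_sum:
  assumes "\<And>i. i \<in> I \<Longrightarrow> bnd Q a b (f i)"
  shows "bnd Q a b (\<lambda>\<sigma> x u. \<Sum>i\<in>I. f i \<sigma> x u)"
proof -
  have 0: "bnd Q a b (\<lambda>\<sigma> x u. 0)" by (rule bndI[of 0]) auto
  show ?thesis
    using assms by (induction I rule: infinite_finite_induct) (auto intro: 0 bnd_add)
qed

text \<open>Integration by parts: thanks to the reflected argument the three values are the Gaussian
  means of p, p' and p''. The polynomials met below have degree at most 7, and the factor x^2 in
  \<open>gd 2\<close> explains the range up to degree 10 in \<open>gs_integral_poly\<close>.\<close>

lemma gs_moments_poly: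
  assumes "\<And>u. p u = q0 + q1*u + q2*u^2 + q3*u^3 + q4*u^4 + q5*u^5 + q6*u^6 + q7*u^7 + q8*u^8"
  shows "has_bochner_integral lborel (\<lambda>u. gd 0 (- u) * p u) (q0 + 2*q2 + 12*q4 + 120*q6 + 1680*q8)"
    "has_bochner_integral lborel (\<lambda>u. gd 1 (- u) * p u) (q1 + 6*q3 + 60*q5 + 840*q7)"
    "has_bochner_integral lborel (\<lambda>u. gd 2 (- u) * p u) (2*q2 + 24*q4 + 360*q6 + 6720*q8)"
proof -
  show "has_bochner_integral lborel (\<lambda>u. gd 0 (- u) * p u) (q0 + 2*q2 + 12*q4 + 120*q6 + 1680*q8)"
    using gs_integral_poly[of q0 q1 q2 q3 q4 q5 q6 q7 q8 0 0] by (simp add: assms gd_0)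
  have "(\<lambda>u. gd 1 (- u) * p u) = (\<lambda>u. gs u * (0 + (q0/2)*u + (q1/2)*u^2 + (q2/2)*u^3 + (q3/2)*u^4 + (q4/2)*u^5
        + (q5/2)*u^6 + (q6/2)*u^7 + (q7/2)*u^8 + (q8/2)*u^9 + 0*u^10))"
    unfolding fun_eq_iff gd_1 gs_even assms by (simp add: field_simps eval_nat_numeral)
  with gs_integral_poly[of 0 "q0/2" "q1/2" "q2/2" "q3/2" "q4/2" "q5/2" "q6/2" "q7/2" "q8/2" 0]
  show "has_bochner_integral lborel (\<lambda>u. gd 1 (- u) * p u) (q1 + 6*q3 + 60*q5 + 840*q7)" by simp
  have "(\<lambda>u. gd 2 (- u) * p u) = (\<lambda>u. gs u * ((-q0/2) + (-q1/2)*u + (q0/4-q2/2)*u^2 + (q1/4-q3/2)*u^3 + (q2/4-q4/2)*u^4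
        + (q3/4-q5/2)*u^5 + (q4/4-q6/2)*u^6 + (q5/4-q7/2)*u^7 + (q6/4-q8/2)*u^8 + (q7/4)*u^9 + (q8/4)*u^10))"
    unfolding fun_eq_iff gd_2 gs_even assms by (simp add: field_simps eval_nat_numeral)
  with gs_integral_poly[of "-q0/2" "-q1/2" "q0/4-q2/2" "q1/4-q3/2" "q2/4-q4/2" "q3/4-q5/2" "q4/4-q6/2" "q5/4-q7/2" "q6/4-q8/2" "q7/4" "q8/4"]
  show "has_bochner_integral lborel (\<lambda>u. gd 2 (- u) * p u) (2*q2 + 24*q4 + 360*q6 + 6720*q8)"
    by (simp add: algebra_simps)
qed

section \<open>Existence of the new interface\<close>

text \<open>The vertical integral \<open>W k\<close> of an exact half line, as a function of the
  height of its end relative to y.\<close>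

definition hl :: "nat \<Rightarrow> real \<Rightarrow> real" where
  "hl k w = (LINT t|lborel. gd k (- t) * indicator {..w} t)"

lemma half_line_shift: "(LINT t|lborel. gd k (y - t) * indicator {..a} t) = hl k (a - y)"
proof -
  have "(LINT t|lborel. gd k (y - t) * indicator {..a} t) = (LINT t|lborel. gd k (- t) * indicator {..a} (y + t))"
    by (subst lborel_integral_real_affine[where c = 1 and t = y]) auto
  also have "(\<lambda>t. gd k (- t) * indicator {..a} (y + t)) = (\<lambda>t. gd k (- t) * indicator {..a - y} t)"
    by (auto simp: indicator_def fun_eq_iff)
  finally show ?thesis unfolding hl_def .
qed

lemma hl_0: "hl 0 w = 1 / 2 + E w" and hl_1: "hl 1 w = - gs w" and hl_2: "hl 2 w = gd 1 w"
  using half_line_shift[of 0 0 w] half_line_shift[of 1 0 w] half_line_shift[of 2 0 w]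
  unfolding half_line_0 half_line_1 half_line_2 by simp_all

lemma hl_lipschitz: "k \<le> 1 \<Longrightarrow> \<bar>hl k a - hl k b\<bar> \<le> \<bar>a - b\<bar>"
  using E_lipschitz[of a b] gs_lipschitz[of b a] hl_1 by (auto simp: le_Suc_eq hl_0 abs_minus_commute)

lemma hl_bounded: "k \<le> 1 \<Longrightarrow> \<bar>hl k a\<bar> \<le> 2"
  using E_bounded[of a] gs_pos[of a] gs_le[of a] gs_0_less_1 hl_1 by (auto simp: le_Suc_eq hl_0)

lemma borel_measurable_hl: "k \<le> 1 \<Longrightarrow> hl k \<in> borel_measurable borel"
proof -
  have "hl 0 = (\<lambda>w. 1 / 2 + E w)" "hl 1 = (\<lambda>w. - gs w)" by (simp_all add: fun_eq_iff hl_0 hl_1 del: One_nat_def)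
  then have "hl 0 \<in> borel_measurable borel" "hl 1 \<in> borel_measurable borel" by simp_all
  then show "k \<le> 1 \<Longrightarrow> hl k \<in> borel_measurable borel" by (auto simp: le_Suc_eq)
qed

text \<open>If |p|, |z| and |u| are at most 1 then p u - z lies in [-2, 2], where the density is at
  least \<open>gs 2\<close>. Restricting the outer integral to [-1, 1] gives this lower bound for
  the slope of the tilted integrals below.\<close>

definition c_tilt :: real where
  "c_tilt = gs 2 * (LINT u|lborel. gs u * indicator {-1..1} u)"

lemma gs_ge_2: "\<bar>x\<bar> \<le> 2 \<Longrightarrow> gs 2 \<le> gs x"
  using power_mono[of "\<bar>x\<bar>" 2 2] by (simp add: gs_def divide_right_mono)

lemma c_tilt_pos: "c_tilt > 0"
proof -
  have "0 < gs 2 * (LINT u|lborel. indicator {-1..1::real} u)" using gs_pos by simp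
  also have "\<dots> = (LINT u|lborel. gs 2 * indicator {-1..1::real} u)" by simp
  also have "\<dots> \<le> (LINT u|lborel. gs u * indicator {-1..1} u)"
  proof (rule integral_mono)
    show "integrable lborel (\<lambda>u. gs 2 * indicator {-1..1::real} u)"
      by (intro integrable_mult_right integrable_real_indicator) auto
    show "integrable lborel (\<lambda>u. gs u * indicator {-1..1::real} u)"
      by (rule integrable_gs_indicator) simp
  qed (use gs_ge_2 in \<open>auto simp: indicator_def\<close>)
  finally show ?thesis unfolding c_tilt_def using gs_pos by simp
qed

lemma integrable_gs_bounded:
  assumes "\<psi> \<in> borel_measurable borel" "\<And>x. \<bar>\<psi> x\<bar> \<le> B"
  shows "integrable lborel (\<lambda>u. gs u * \<psi> u)"
  using integrable_gd_bounded[OF assms, of 0] by (simp add: gd_0)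

lemma integrable_gs_E: "integrable lborel (\<lambda>u. gs u * E (p * u - z))"
  by (rule integrable_gs_bounded[where B = 1]) (use E_bounded in auto)

lemma tilted_integral_odd: "(LINT u|lborel. gs u * E (p * u - z)) = - (LINT u|lborel. gs u * E (p * u + z))"
proof -
  have "(LINT u|lborel. gs u * E (p * u - z)) = (LINT u|lborel. gs u * E (- (p * u + z)))"
    by (subst lborel_integral_real_affine[where c = "-1" and t = 0]) (auto intro!: Bochner_Integration.integral_cong)
  then show ?thesis unfolding E_minus by simp
qed

lemma E_mono: "a \<le> b \<Longrightarrow> E a \<le> E b"
  by (rule DERIV_nonneg_imp_nondecreasing) (use gs_pos E_deriv[of "\<lambda>x. x" 1] in \<open>auto intro!: derivative_eq_intros exI less_imp_le\<close>)

lemma E_gap: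
  assumes "\<bar>x\<bar> \<le> 1" "0 \<le> m" "m \<le> 1"
  shows "E (x - m) + m * gs 2 \<le> E x"
proof (cases "m = 0")
  case False
  have "\<exists>z. x - m < z \<and> z < x \<and> E x - E (x - m) = (x - (x - m)) * gs z"
    by (rule MVT2) (use False assms in \<open>auto intro!: derivative_eq_intros\<close>)
  then obtain z where z: "x - m < z" "z < x" "E x - E (x - m) = m * gs z" by auto
  then have "gs 2 \<le> gs z" using assms by (intro gs_ge_2) auto
  then have "m * gs 2 \<le> m * gs z" using assms by (intro mult_left_mono)
  then show ?thesis using z by linarith
qed simp

text \<open>The integral is the leading part of the convolution minus 1/2: a half plane with
  boundary slope p, seen at height z above the boundary. It vanishes at z = 0 by oddness. Lowering
  the argument by m = min z 1 costs at least m times \<open>gs 2\<close> for |u| \<le> 1 and never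
  raises E elsewhere; the cap at 1 keeps the arguments in [-2, 2].\<close>

lemma tilted_integral_neg:
  assumes "\<bar>p\<bar> \<le> 1" "z \<ge> 0"
  shows "(LINT u|lborel. gs u * E (p * u - z)) \<le> - c_tilt * min z 1"
proof -
  define m where "m = min z 1"
  have m: "0 \<le> m" "m \<le> 1" "m \<le> z" using assms by (auto simp: m_def)
  have "(LINT u|lborel. gs u * E (p * u - z)) \<le> (LINT u|lborel. gs u * E (p * u - 0) - m * gs 2 * (gs u * indicator {-1..1} u))"
  proof (rule integral_mono)
    fix u :: real
    have "E (p * u - z) \<le> E (p * u) - m * gs 2 * indicator {-1..1} u"
    proof (cases "u \<in> {-1..1}")
      case True
      then have "\<bar>p\<bar> * \<bar>u\<bar> \<le> 1 * 1" using assms by (intro mult_mono) auto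
      then have "E (p * u - m) + m * gs 2 \<le> E (p * u)" using m by (intro E_gap) (auto simp: abs_mult)
      moreover have "E (p * u - z) \<le> E (p * u - m)" using m by (intro E_mono) auto
      ultimately show ?thesis using True by simp
    next
      case False
      then show ?thesis using E_mono[of "p * u - z" "p * u"] assms by simp
    qed
    from mult_left_mono[OF this, of "gs u"] gs_pos[of u]
    show "gs u * E (p * u - z) \<le> gs u * E (p * u - 0) - m * gs 2 * (gs u * indicator {-1..1} u)"
      by (simp add: algebra_simps)
  next
    show "integrable lborel (\<lambda>u. gs u * E (p * u - 0) - m * gs 2 * (gs u * indicator {-1..1} u))"
      by (intro integrable_gs_E Bochner_Integration.integrable_diff integrable_mult_right integrable_gs_indicator) simp
  qed (rule integrable_gs_E)
  also have "\<dots> = (LINT u|lborel. gs u * E (p * u - 0)) - m * gs 2 * (LINT u|lborel. gs u * indicator {-1..1} u)"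
    using integrable_gs_E[of p 0] integrable_gs_indicator[of "{-1..1}"] by simp
  also have "(LINT u|lborel. gs u * E (p * u - 0)) = 0" using tilted_integral_odd[of p 0] by simp
  finally show ?thesis by (simp add: m_def c_tilt_def mult_ac)
qed

lemma tilted_integral_pos:
  assumes "\<bar>p\<bar> \<le> 1" "z \<le> 0"
  shows "c_tilt * min (- z) 1 \<le> (LINT u|lborel. gs u * E (p * u - z))"
proof -
  have "(LINT u|lborel. gs u * E (p * u - z)) = - (LINT u|lborel. gs u * E (p * u - (- z)))"
    using tilted_integral_odd[of p z] by simp
  then show ?thesis using tilted_integral_neg[of p "- z"] assms by simp
qed

lemma tilted_slope:
  assumes "\<bar>p\<bar> \<le> 1" "\<bar>z\<bar> \<le> 1"
  shows "c_tilt \<le> (LINT u|lborel. gs u * gs (p * u - z))"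
proof -
  have "c_tilt = (LINT u|lborel. gs 2 * (gs u * indicator {-1..1} u))" by (simp add: c_tilt_def)
  also have "\<dots> \<le> (LINT u|lborel. gs u * gs (p * u - z))"
  proof (rule integral_mono)
    fix u :: real
    show "gs 2 * (gs u * indicator {-1..1} u) \<le> gs u * gs (p * u - z)"
    proof (cases "u \<in> {-1..1}")
      case True
      then have "\<bar>p\<bar> * \<bar>u\<bar> \<le> 1 * 1" using assms by (intro mult_mono) auto
      then have "\<bar>p * u - z\<bar> \<le> 2" using assms abs_triangle_ineq4[of "p * u" z] by (simp add: abs_mult)
      then show ?thesis using True gs_ge_2 gs_pos[of u] by (simp add: mult.commute)
    next
      case False
      then show ?thesis using gs_pos[of u] gs_pos[of "p * u - z"] by simp
    qed
    have "\<bar>gs (p * u - z)\<bar> \<le> 1" for u using gs_pos[of "p * u - z"] gs_le[of "p * u - z"] gs_0_less_1 by simp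
    then show "integrable lborel (\<lambda>u. gs u * gs (p * u - z))"
      by (intro integrable_gs_bounded[where B = 1]) auto
  qed (intro integrable_mult_right integrable_gs_indicator, simp)
  finally show ?thesis .
qed

text \<open>One thresholding step in blown-up variables, with f the initial graph before the
  blow-up. An earlier set is a subgraph only inside a box of unscaled half-width r, and its boundary
  \<open>k i \<sigma>\<close> is known to lie within O(\<sigma>) of the blown-up initial graph, with
  no information on its derivatives. The weights enter through their sum 1 and, in error terms,
  through \<open>wabs\<close>.\<close>

locale stage_data =
  fixes I :: "nat set" and w :: "nat \<Rightarrow> real" and A :: "nat \<Rightarrow> real \<Rightarrow> (real \<times> real) set"
    and k :: "nat \<Rightarrow> real \<Rightarrow> real \<Rightarrow> real" and f f' :: "real \<Rightarrow> real" and r C \<sigma>0 :: real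
  assumes finI: "finite I" and sumw: "sum w I = 1"
    and r: "0 < r" "r \<le> 1" and s0: "0 < \<sigma>0" "\<sigma>0 \<le> 1" and C: "C \<ge> 0"
    and meas: "\<And>i \<sigma>. i \<in> I \<Longrightarrow> 0 < \<sigma> \<Longrightarrow> A i \<sigma> \<in> sets borel"
    and box: "\<And>i \<sigma> x y. i \<in> I \<Longrightarrow> 0 < \<sigma> \<Longrightarrow> \<sigma> < \<sigma>0 \<Longrightarrow> \<sigma> * \<bar>x\<bar> < r \<Longrightarrow> \<sigma> * \<bar>y\<bar> < r \<Longrightarrow>
        (x, y) \<in> A i \<sigma> \<longleftrightarrow> y \<le> k i \<sigma> x"
    and near: "\<And>i \<sigma> x. i \<in> I \<Longrightarrow> 0 < \<sigma> \<Longrightarrow> \<sigma> < \<sigma>0 \<Longrightarrow> \<sigma> * \<bar>x\<bar> < r \<Longrightarrow>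
        \<bar>k i \<sigma> x - f (\<sigma> * x) / \<sigma>\<bar> \<le> C * \<sigma>"
    and f_taylor: "\<And>x z. \<bar>x\<bar> < r \<Longrightarrow> \<bar>z\<bar> < r \<Longrightarrow> \<bar>f x - f z - f' z * (x - z)\<bar> \<le> C * (x - z)\<^sup>2"
    and f_0: "f 0 = 0"
    and f'_half: "\<And>z. \<bar>z\<bar> < r \<Longrightarrow> \<bar>f' z\<bar> \<le> 1 / 2"
    and f'_le: "\<And>z. \<bar>z\<bar> < r \<Longrightarrow> \<bar>f' z\<bar> \<le> C * \<bar>z\<bar>"
    and f_half: "\<And>z. \<bar>z\<bar> < r \<Longrightarrow> \<bar>f z\<bar> \<le> \<bar>z\<bar> / 2"
begin

definition \<phi> :: "real \<Rightarrow> real \<times> real \<Rightarrow> real" where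
  "\<phi> \<sigma> q = (\<Sum>i\<in>I. w i * indicator (A i \<sigma>) q)"

abbreviation wabs :: real where "wabs \<equiv> \<Sum>i\<in>I. \<bar>w i\<bar>"

lemma phi_measurable: "0 < \<sigma> \<Longrightarrow> \<phi> \<sigma> \<in> borel_measurable borel"
  unfolding \<phi>_def[abs_def] using meas by (intro borel_measurable_sum borel_measurable_times borel_measurable_indicator) auto

lemma phi_bound: "\<bar>\<phi> \<sigma> q\<bar> \<le> wabs"
  unfolding \<phi>_def by (rule order_trans[OF sum_abs]) (auto intro!: sum_mono simp: indicator_def)

lemma indicator_measurable: "i \<in> I \<Longrightarrow> 0 < \<sigma> \<Longrightarrow> (indicator (A i \<sigma>) :: real \<times> real \<Rightarrow> real) \<in> borel_measurable borel"
  using meas by (intro borel_measurable_indicator) auto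

lemma integrable_gd_W:
  assumes "i \<in> I" "0 < \<sigma>"
  shows "integrable lborel (\<lambda>u. gd j (- u) * W l (indicator (A i \<sigma>)) (x + u) y)"
proof -
  have [measurable]: "(\<lambda>s. W l (indicator (A i \<sigma>)) s y) \<in> borel_measurable borel"
    by (intro borel_measurable_W indicator_measurable assms)
  have "integrable lborel (\<lambda>s. gd j (0 - s) * W l (indicator (A i \<sigma>)) (x + s) y)"
    by (rule integrable_gd_shift_bounded[where B = "1 * gd_norm l"])
       (measurable, rule W_bound[OF indicator_measurable[OF assms]], simp add: indicator_def)
  then show ?thesis by simp
qed

lemma V_phi:
  assumes "0 < \<sigma>"
  shows "V j l (\<phi> \<sigma>) x y = (\<Sum>i\<in>I. w i * (LINT u|lborel. gd j (- u) * W l (indicator (A i \<sigma>)) (x + u) y))"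
proof -
  have "V j l (\<phi> \<sigma>) x y = (LINT u|lborel. gd j (- u) * (\<Sum>i\<in>I. w i * W l (indicator (A i \<sigma>)) (x + u) y))"
    unfolding V_eq_shift \<phi>_def[abs_def]
    by (subst W_sum[where B = 1]) (use indicator_measurable assms in \<open>auto simp: indicator_def[abs_def]\<close>)
  also have "\<dots> = (LINT u|lborel. (\<Sum>i\<in>I. w i * (gd j (- u) * W l (indicator (A i \<sigma>)) (x + u) y)))"
    by (simp add: sum_distrib_left mult.left_commute)
  also have "\<dots> = (\<Sum>i\<in>I. LINT u|lborel. w i * (gd j (- u) * W l (indicator (A i \<sigma>)) (x + u) y))"
    by (intro Bochner_Integration.integral_sum integrable_mult_right integrable_gd_W assms)
  finally show ?thesis by simp
qed

lemma W_tail: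
  assumes "i \<in> I" "0 < \<sigma>" "\<sigma> < \<sigma>0" "\<sigma> * \<bar>s\<bar> < r" "\<sigma> * \<bar>y\<bar> < r / 2"
  shows "\<bar>W l (indicator (A i \<sigma>)) s y - hl l (k i \<sigma> s - y)\<bar>
     \<le> (2 * \<sigma> / r) ^ n * (LINT t|lborel. (1 + \<bar>t\<bar>) ^ n * \<bar>gd l t\<bar>)"
  unfolding half_line_shift[symmetric]
  by (rule W_half_line_error) (use assms meas r box in auto)

text \<open>The section over x + u is replaced by the half line below the tangent of the blown-up
  initial graph at x. For l = 0, 1 the function \<open>hl l\<close> is bounded and 1-Lipschitz,
  which covers the value and the y-slope of the convolution.\<close>

lemma W_leading:
  assumes "l \<le> 1"
  obtains K where "K \<ge> 0"
    "\<And>i \<sigma> x y u. i \<in> I \<Longrightarrow> 0 < \<sigma> \<Longrightarrow> \<sigma> < \<sigma>0 \<Longrightarrow> \<sigma> * \<bar>x\<bar> < r / 2 \<Longrightarrow> \<sigma> * \<bar>y\<bar> < r / 2 \<Longrightarrow>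
      \<bar>W l (indicator (A i \<sigma>)) (x + u) y - hl l (f' (\<sigma> * x) * u - (y - f (\<sigma> * x) / \<sigma>))\<bar> \<le> K * \<sigma> * (1 + \<bar>u\<bar>) ^ 2"
proof -
  define M where "M = (LINT t|lborel. (1 + \<bar>t\<bar>) ^ 1 * \<bar>gd l t\<bar>)"
  have M: "M \<ge> 0" unfolding M_def by (intro Bochner_Integration.integral_nonneg) auto
  \<comment> \<open>In order: the far-field tail of the vertical integral; the distance of
    \<open>k i\<close> from the graph plus the Taylor remainder of f; and, when x + u leaves the
    box, the trivial bound multiplied by (2/r) \<sigma> |u|, which is then at least 1.\<close>
  define K where "K = 2 * M / r + 2 * C + (gd_norm l + 2) * 2 / r"
  have K0: "2 * M / r \<ge> 0" "(gd_norm l + 2) * 2 / r \<ge> 0" using M r gd_norm_nonneg[of l] by auto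
  show ?thesis
  proof (rule that[of K])
    show "K \<ge> 0" using K0 C by (simp add: K_def)
    fix i \<sigma> x y u assume H: "i \<in> I" "0 < \<sigma>" "\<sigma> < \<sigma>0" "\<sigma> * \<bar>x\<bar> < r / 2" "\<sigma> * \<bar>y\<bar> < r / 2"
    let ?D = "W l (indicator (A i \<sigma>)) (x + u) y" and ?a = "f' (\<sigma> * x) * u - (y - f (\<sigma> * x) / \<sigma>)"
    have u1: "1 \<le> (1 + \<bar>u\<bar>) ^ 2" "\<bar>u\<bar> \<le> (1 + \<bar>u\<bar>) ^ 2" "u\<^sup>2 \<le> (1 + \<bar>u\<bar>) ^ 2"
      by (auto simp: power2_eq_square algebra_simps)
    have p0: "0 \<le> C * \<sigma>" "0 \<le> (2 * M / r) * \<sigma>" "0 \<le> ((gd_norm l + 2) * 2 / r) * \<sigma>"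
      by (intro mult_nonneg_nonneg K0 C less_imp_le[OF H(2)])+
    show "\<bar>?D - hl l ?a\<bar> \<le> K * \<sigma> * (1 + \<bar>u\<bar>) ^ 2"
    proof (cases "\<sigma> * \<bar>x + u\<bar> < r")
      case True
      have sx: "\<bar>\<sigma> * x\<bar> < r" "\<bar>\<sigma> * (x + u)\<bar> < r" using H True r by (auto simp: abs_mult)
      have "\<bar>f (\<sigma> * (x + u)) - f (\<sigma> * x) - f' (\<sigma> * x) * (\<sigma> * (x + u) - \<sigma> * x)\<bar> \<le> C * (\<sigma> * (x + u) - \<sigma> * x)\<^sup>2"
        using f_taylor[OF sx(2) sx(1)] .
      then have "\<bar>f (\<sigma> * (x + u)) - f (\<sigma> * x) - \<sigma> * (f' (\<sigma> * x) * u)\<bar> \<le> \<sigma> * (C * \<sigma> * u\<^sup>2)"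
        by (simp add: algebra_simps power2_eq_square)
      moreover have "f (\<sigma> * (x + u)) - f (\<sigma> * x) - \<sigma> * (f' (\<sigma> * x) * u)
          = \<sigma> * (f (\<sigma> * (x + u)) / \<sigma> - f (\<sigma> * x) / \<sigma> - f' (\<sigma> * x) * u)"
        using H by (simp add: field_simps)
      ultimately have "\<bar>f (\<sigma> * (x + u)) / \<sigma> - f (\<sigma> * x) / \<sigma> - f' (\<sigma> * x) * u\<bar> \<le> C * \<sigma> * u\<^sup>2"
        using H(2) by (simp add: abs_mult)
      moreover have "\<bar>k i \<sigma> (x + u) - f (\<sigma> * (x + u)) / \<sigma>\<bar> \<le> C * \<sigma>" by (rule near[OF H(1-3) True])
      ultimately have "\<bar>(k i \<sigma> (x + u) - y) - ?a\<bar> \<le> C * \<sigma> + C * \<sigma> * u\<^sup>2" by linarith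
      then have "\<bar>hl l (k i \<sigma> (x + u) - y) - hl l ?a\<bar> \<le> C * \<sigma> + C * \<sigma> * u\<^sup>2"
        using hl_lipschitz[OF assms, of "k i \<sigma> (x + u) - y" ?a] by linarith
      moreover have "\<bar>?D - hl l (k i \<sigma> (x + u) - y)\<bar> \<le> (2 * \<sigma> / r) ^ 1 * M"
        unfolding M_def by (rule W_tail) (use H True in auto)
      moreover have "C * \<sigma> * 1 \<le> C * \<sigma> * (1 + \<bar>u\<bar>) ^ 2" "C * \<sigma> * u\<^sup>2 \<le> C * \<sigma> * (1 + \<bar>u\<bar>) ^ 2"
        "(2 * M / r) * \<sigma> * 1 \<le> (2 * M / r) * \<sigma> * (1 + \<bar>u\<bar>) ^ 2" "0 \<le> ((gd_norm l + 2) * 2 / r) * \<sigma> * (1 + \<bar>u\<bar>) ^ 2"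
        by (rule mult_left_mono[OF u1(1) p0(1)] mult_left_mono[OF u1(3) p0(1)] mult_left_mono[OF u1(1) p0(2)]
            mult_nonneg_nonneg[OF p0(3) zero_le_power2])+
      moreover have "(2 * \<sigma> / r) ^ 1 * M = (2 * M / r) * \<sigma> * 1" by simp
      ultimately show ?thesis unfolding K_def distrib_right by linarith
    next
      case False
      have "\<bar>?D\<bar> \<le> 1 * gd_norm l"
        by (rule W_bound[OF indicator_measurable[OF H(1,2)]]) (simp add: indicator_def)
      then have b: "\<bar>?D - hl l ?a\<bar> \<le> gd_norm l + 2" using hl_bounded[OF assms, of ?a] by linarith
      have "\<sigma> * \<bar>x + u\<bar> \<le> \<sigma> * \<bar>x\<bar> + \<sigma> * \<bar>u\<bar>" using H(2) by (simp add: distrib_left[symmetric])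
      then have "r / 2 \<le> \<sigma> * \<bar>u\<bar>" using False H by linarith
      also have "\<dots> \<le> \<sigma> * (1 + \<bar>u\<bar>) ^ 2" using u1 H by (intro mult_left_mono) auto
      finally have "1 \<le> 2 / r * (\<sigma> * (1 + \<bar>u\<bar>) ^ 2)" using r by (simp add: field_simps)
      then have "(gd_norm l + 2) * 1 \<le> (gd_norm l + 2) * (2 / r * (\<sigma> * (1 + \<bar>u\<bar>) ^ 2))"
        using gd_norm_nonneg[of l] by (intro mult_left_mono) auto
      moreover have "0 \<le> (2 * M / r) * \<sigma> * (1 + \<bar>u\<bar>) ^ 2" "0 \<le> 2 * C * \<sigma> * (1 + \<bar>u\<bar>) ^ 2"
        using mult_nonneg_nonneg[OF p0(2) zero_le_power2[of "1 + \<bar>u\<bar>"]] mult_nonneg_nonneg[OF p0(1) zero_le_power2[of "1 + \<bar>u\<bar>"]]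
        by linarith+
      moreover have "(gd_norm l + 2) * (2 / r * (\<sigma> * (1 + \<bar>u\<bar>) ^ 2)) = (gd_norm l + 2) * 2 / r * \<sigma> * (1 + \<bar>u\<bar>) ^ 2" by simp
      ultimately show ?thesis using b unfolding K_def distrib_right by linarith
    qed
  qed
qed

text \<open>The leading term is the same for every i, so of the weights only their sum 1 remains in
  it; the errors add up with the absolute weights.\<close>

lemma V_leading:
  assumes "l \<le> 1"
  obtains K where "K \<ge> 0"
    "\<And>\<sigma> x y. 0 < \<sigma> \<Longrightarrow> \<sigma> < \<sigma>0 \<Longrightarrow> \<sigma> * \<bar>x\<bar> < r / 2 \<Longrightarrow> \<sigma> * \<bar>y\<bar> < r / 2 \<Longrightarrow>
      \<bar>V 0 l (\<phi> \<sigma>) x y - (LINT u|lborel. gs u * hl l (f' (\<sigma> * x) * u - (y - f (\<sigma> * x) / \<sigma>)))\<bar> \<le> K * \<sigma>"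
proof -
  obtain K where K: "K \<ge> 0"
    "\<And>i \<sigma> x y u. i \<in> I \<Longrightarrow> 0 < \<sigma> \<Longrightarrow> \<sigma> < \<sigma>0 \<Longrightarrow> \<sigma> * \<bar>x\<bar> < r / 2 \<Longrightarrow> \<sigma> * \<bar>y\<bar> < r / 2 \<Longrightarrow>
      \<bar>W l (indicator (A i \<sigma>)) (x + u) y - hl l (f' (\<sigma> * x) * u - (y - f (\<sigma> * x) / \<sigma>))\<bar> \<le> K * \<sigma> * (1 + \<bar>u\<bar>) ^ 2"
    using W_leading[OF assms] by blast
  define N where "N = (LINT u|lborel. (1 + \<bar>u\<bar>) ^ 2 * \<bar>gd 0 u\<bar>)"
  have N: "N \<ge> 0" unfolding N_def by (intro Bochner_Integration.integral_nonneg) auto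
  show ?thesis
  proof (rule that[of "wabs * (K * N)"])
    show "0 \<le> wabs * (K * N)" using K(1) N by (intro mult_nonneg_nonneg sum_nonneg) auto
    fix \<sigma> x y :: real assume H: "0 < \<sigma>" "\<sigma> < \<sigma>0" "\<sigma> * \<bar>x\<bar> < r / 2" "\<sigma> * \<bar>y\<bar> < r / 2"
    let ?h = "\<lambda>u. hl l (f' (\<sigma> * x) * u - (y - f (\<sigma> * x) / \<sigma>))"
    have ih: "integrable lborel (\<lambda>u. gs u * ?h u)"
      by (rule integrable_gs_bounded[where B = 2])
         (rule measurable_compose[OF _ borel_measurable_hl[OF assms]], simp, rule hl_bounded[OF assms])
    have 1: "\<bar>(LINT u|lborel. gd 0 (- u) * W l (indicator (A i \<sigma>)) (x + u) y) - (LINT u|lborel. gs u * ?h u)\<bar> \<le> K * \<sigma> * N"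
      if "i \<in> I" for i
    proof -
      have "\<bar>LINT u|lborel. gd 0 (- u) * W l (indicator (A i \<sigma>)) (x + u) y - gs u * ?h u\<bar>
          \<le> (LINT u|lborel. K * \<sigma> * ((1 + \<bar>u\<bar>) ^ 2 * \<bar>gd 0 u\<bar>))"
      proof (rule integral_abs_le_of_abs_le)
        fix u :: real
        have "\<bar>W l (indicator (A i \<sigma>)) (x + u) y - ?h u\<bar> * \<bar>gd 0 u\<bar> \<le> K * \<sigma> * (1 + \<bar>u\<bar>) ^ 2 * \<bar>gd 0 u\<bar>"
          by (intro mult_right_mono K that H) auto
        moreover have "gd 0 (- u) * W l (indicator (A i \<sigma>)) (x + u) y - gs u * ?h u
            = (W l (indicator (A i \<sigma>)) (x + u) y - ?h u) * gd 0 u"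
          unfolding gd_0 gs_even left_diff_distrib by (simp only: mult.commute[of "gs u"])
        ultimately show "\<bar>gd 0 (- u) * W l (indicator (A i \<sigma>)) (x + u) y - gs u * ?h u\<bar> \<le> K * \<sigma> * ((1 + \<bar>u\<bar>) ^ 2 * \<bar>gd 0 u\<bar>)"
          by (simp only: abs_mult mult.assoc)
      qed (intro integrable_mult_right integrable_power_gd)
      moreover have "(LINT u|lborel. gd 0 (- u) * W l (indicator (A i \<sigma>)) (x + u) y - gs u * ?h u)
          = (LINT u|lborel. gd 0 (- u) * W l (indicator (A i \<sigma>)) (x + u) y) - (LINT u|lborel. gs u * ?h u)"
        by (rule Bochner_Integration.integral_diff[OF integrable_gd_W[OF that H(1)] ih])
      ultimately show ?thesis unfolding N_def integral_mult_right_zero by simp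
    qed
    have "V 0 l (\<phi> \<sigma>) x y - (LINT u|lborel. gs u * ?h u)
       = (\<Sum>i\<in>I. w i * ((LINT u|lborel. gd 0 (- u) * W l (indicator (A i \<sigma>)) (x + u) y) - (LINT u|lborel. gs u * ?h u)))"
      unfolding V_phi[OF H(1)] right_diff_distrib sum_subtractf sum_distrib_right[symmetric] sumw by simp
    moreover have "\<bar>\<dots>\<bar> \<le> (\<Sum>i\<in>I. \<bar>w i\<bar> * (K * \<sigma> * N))"
      by (rule order_trans[OF sum_abs]) (unfold abs_mult, intro sum_mono mult_left_mono 1, auto)
    ultimately show "\<bar>V 0 l (\<phi> \<sigma>) x y - (LINT u|lborel. gs u * ?h u)\<bar> \<le> wabs * (K * N) * \<sigma>"
      unfolding sum_distrib_right[symmetric] by (simp add: mult_ac)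
  qed
qed

text \<open>Besides solving the threshold equation, y stays close to the blown-up initial graph, has
  a slope bounded away from 0 (for implicit differentiation), and separates its column: in the half
  box the new set is exactly what lies below y.\<close>

definition good_root :: "real \<Rightarrow> real \<Rightarrow> real \<Rightarrow> real \<Rightarrow> bool" where
  "good_root K \<sigma> x y \<longleftrightarrow> \<bar>y - f (\<sigma> * x) / \<sigma>\<bar> \<le> K * \<sigma> \<and> \<sigma> * \<bar>y\<bar> < r / 2 \<and> V 0 0 (\<phi> \<sigma>) x y = 1 / 2 \<and>
     V 0 1 (\<phi> \<sigma>) x y \<le> - c_tilt / 2 \<and>
     (\<forall>z. \<sigma> * \<bar>z\<bar> < r / 2 \<longrightarrow> (V 0 0 (\<phi> \<sigma>) x z \<ge> 1 / 2 \<longleftrightarrow> z \<le> y))"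

lemma root_exists:
  obtains K \<sigma>1 where "K \<ge> 0" "0 < \<sigma>1" "\<sigma>1 \<le> \<sigma>0"
    "\<And>\<sigma> x. 0 < \<sigma> \<Longrightarrow> \<sigma> < \<sigma>1 \<Longrightarrow> \<sigma> * \<bar>x\<bar> < r / 2 \<Longrightarrow> \<exists>y. good_root K \<sigma> x y"
proof -
  obtain L0 where L0: "L0 \<ge> 0" "\<And>\<sigma> x y. 0 < \<sigma> \<Longrightarrow> \<sigma> < \<sigma>0 \<Longrightarrow> \<sigma> * \<bar>x\<bar> < r / 2 \<Longrightarrow> \<sigma> * \<bar>y\<bar> < r / 2 \<Longrightarrow>
      \<bar>V 0 0 (\<phi> \<sigma>) x y - (LINT u|lborel. gs u * hl 0 (f' (\<sigma> * x) * u - (y - f (\<sigma> * x) / \<sigma>)))\<bar> \<le> L0 * \<sigma>"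
    using V_leading[of 0, OF zero_le] by blast
  obtain L1 where L1: "L1 \<ge> 0" "\<And>\<sigma> x y. 0 < \<sigma> \<Longrightarrow> \<sigma> < \<sigma>0 \<Longrightarrow> \<sigma> * \<bar>x\<bar> < r / 2 \<Longrightarrow> \<sigma> * \<bar>y\<bar> < r / 2 \<Longrightarrow>
      \<bar>V 0 1 (\<phi> \<sigma>) x y - (LINT u|lborel. gs u * hl 1 (f' (\<sigma> * x) * u - (y - f (\<sigma> * x) / \<sigma>)))\<bar> \<le> L1 * \<sigma>"
    using V_leading[of 1, OF order_refl] by blast
  \<comment> \<open>At distance K \<sigma> from the graph the leading term is at least (L0 + 1)
    \<sigma> in absolute value and beats the error L0 \<sigma>. So the sign of V - 1/2 is known
    outside a strip of half-width K \<sigma>.\<close>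
  define K where "K = (L0 + 1) / c_tilt"
  have K: "K > 0" "c_tilt * K = L0 + 1" using c_tilt_pos L0(1) by (auto simp: K_def)
  \<comment> \<open>The entry 1 / K keeps the strip below the cap 1 of the tilted estimates, the one
    with L1 preserves half of the slope \<open>c_tilt\<close>, and r / (4 K) keeps the strip inside
    the half box.\<close>
  define \<sigma>1 where "\<sigma>1 = min \<sigma>0 (min (1 / K) (min (c_tilt / (2 * (L1 + 1))) (r / (4 * K))))"
  have s1: "0 < \<sigma>1" "\<sigma>1 \<le> \<sigma>0" "\<sigma>1 \<le> 1 / K" "\<sigma>1 \<le> c_tilt / (2 * (L1 + 1))" "\<sigma>1 \<le> r / (4 * K)"
    using s0 K c_tilt_pos L1(1) r by (auto simp: \<sigma>1_def)
  show ?thesis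
  proof (rule that[of K \<sigma>1])
    show "K \<ge> 0" using K by simp
    show "0 < \<sigma>1" "\<sigma>1 \<le> \<sigma>0" by fact+
    fix \<sigma> x :: real assume H: "0 < \<sigma>" "\<sigma> < \<sigma>1" "\<sigma> * \<bar>x\<bar> < r / 2"
    define p where "p = f' (\<sigma> * x)"
    define a where "a = f (\<sigma> * x) / \<sigma>"
    have sx: "\<bar>\<sigma> * x\<bar> < r" using H r by (simp add: abs_mult)
    have p: "\<bar>p\<bar> \<le> 1" using f'_half[OF sx] by (simp add: p_def)
    have a: "\<sigma> * \<bar>a\<bar> < r / 4" using f_half[OF sx] H by (simp add: a_def abs_mult)
    have "\<sigma> < 1 / K" "\<sigma> < c_tilt / (2 * (L1 + 1))" "\<sigma> < r / (4 * K)" "\<sigma> < 1" "\<sigma> < \<sigma>0" using H s1 s0 by linarith+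
    then have s: "K * \<sigma> < 1" "(L1 + 1) * \<sigma> < c_tilt / 2" "K * \<sigma> < r / 4" "\<sigma> < 1" "\<sigma> < \<sigma>0"
      using K L1(1) by (auto simp: field_simps)
    have v0: "\<bar>V 0 0 (\<phi> \<sigma>) x y - 1 / 2 - (LINT u|lborel. gs u * E (p * u - (y - a)))\<bar> \<le> L0 * \<sigma>" if "\<sigma> * \<bar>y\<bar> < r / 2" for y
    proof -
      have "(LINT u|lborel. gs u * hl 0 (p * u - (y - a))) = (LINT u|lborel. 1 / 2 * gs u + gs u * E (p * u - (y - a)))"
        by (simp add: hl_0 distrib_left mult.commute)
      also have "\<dots> = 1 / 2 * (LINT u|lborel. gs u) + (LINT u|lborel. gs u * E (p * u - (y - a)))"
        using gs_integral_1 integrable_gs_E[of p "y - a"] by (simp add: has_bochner_integral_iff)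
      also have "(LINT u|lborel. gs u) = 1" using gs_integral_1 by (simp add: has_bochner_integral_iff)
      finally show ?thesis using L0(2)[OF H(1) s(5) H(3) that] unfolding p_def a_def by linarith
    qed
    have Ks: "K * \<sigma> > 0" using K H by simp
    have neg: "V 0 0 (\<phi> \<sigma>) x y < 1 / 2" if "\<sigma> * \<bar>y\<bar> < r / 2" "a + K * \<sigma> \<le> y" for y
    proof -
      have "K * \<sigma> \<le> min (y - a) 1" using that(2) s(1) by simp
      have "0 \<le> y - a" using that(2) Ks by linarith
      have "c_tilt * (K * \<sigma>) \<le> c_tilt * min (y - a) 1" using \<open>K * \<sigma> \<le> _\<close> c_tilt_pos by (intro mult_left_mono) auto
      moreover have "c_tilt * (K * \<sigma>) = (L0 + 1) * \<sigma>" using K(2) by (simp add: mult.assoc[symmetric])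
      ultimately have "(LINT u|lborel. gs u * E (p * u - (y - a))) \<le> - ((L0 + 1) * \<sigma>)"
        using tilted_integral_neg[OF p \<open>0 \<le> y - a\<close>] by linarith
      then show ?thesis using v0[OF that(1)] H(1) by (simp add: algebra_simps)
    qed
    have pos: "V 0 0 (\<phi> \<sigma>) x y > 1 / 2" if "\<sigma> * \<bar>y\<bar> < r / 2" "y \<le> a - K * \<sigma>" for y
    proof -
      have "K * \<sigma> \<le> min (- (y - a)) 1" using that(2) s(1) by simp
      have "y - a \<le> 0" using that(2) Ks by linarith
      have "c_tilt * (K * \<sigma>) \<le> c_tilt * min (- (y - a)) 1" using \<open>K * \<sigma> \<le> _\<close> c_tilt_pos by (intro mult_left_mono) auto
      moreover have "c_tilt * (K * \<sigma>) = (L0 + 1) * \<sigma>" using K(2) by (simp add: mult.assoc[symmetric])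
      ultimately have "(LINT u|lborel. gs u * E (p * u - (y - a))) \<ge> (L0 + 1) * \<sigma>"
        using tilted_integral_pos[OF p \<open>y - a \<le> 0\<close>] by linarith
      then show ?thesis using v0[OF that(1)] H(1) by (simp add: algebra_simps)
    qed
    have slope: "V 0 1 (\<phi> \<sigma>) x y \<le> - c_tilt / 2" if "\<sigma> * \<bar>y\<bar> < r / 2" "\<bar>y - a\<bar> \<le> K * \<sigma>" for y
    proof -
      have "c_tilt \<le> (LINT u|lborel. gs u * gs (p * u - (y - a)))" by (rule tilted_slope[OF p]) (use that s in linarith)
      moreover have "(LINT u|lborel. gs u * hl 1 (p * u - (y - a))) = - (LINT u|lborel. gs u * gs (p * u - (y - a)))"
        unfolding hl_1 by simp
      ultimately show ?thesis using L1(2)[OF H(1) s(5) H(3) that(1)] s(2) H(1) unfolding p_def a_def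
        by (simp add: algebra_simps)
    qed
    have inbox: "\<sigma> * \<bar>y\<bar> < r / 2" if "\<bar>y - a\<bar> \<le> K * \<sigma>" for y
    proof -
      have "\<bar>y\<bar> \<le> \<bar>a\<bar> + r / 4" using that s(3) by linarith
      from mult_left_mono[OF this less_imp_le[OF H(1)]]
      have "\<sigma> * \<bar>y\<bar> \<le> \<sigma> * \<bar>a\<bar> + \<sigma> * (r / 4)" by (simp only: distrib_left)
      moreover have "\<sigma> * (r / 4) \<le> 1 * (r / 4)" using s(4) r by (intro mult_right_mono) auto
      ultimately show ?thesis using a by linarith
    qed
    note dV = V_deriv_y[OF phi_measurable[OF H(1)] phi_bound, of 0 0 x, simplified One_nat_def[symmetric]]
    \<comment> \<open>The signs at the two ends of the strip give a root; strict decrease inside the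
      strip and strict signs outside make it the only one in the half box.\<close>
    have "\<exists>y\<ge>a - K * \<sigma>. y \<le> a + K * \<sigma> \<and> V 0 0 (\<phi> \<sigma>) x y = 1 / 2"
    proof (rule IVT2')
      show "V 0 0 (\<phi> \<sigma>) x (a + K * \<sigma>) \<le> 1 / 2" using neg[OF inbox[of "a + K * \<sigma>"]] Ks by simp
      show "1 / 2 \<le> V 0 0 (\<phi> \<sigma>) x (a - K * \<sigma>)" using pos[OF inbox[of "a - K * \<sigma>"]] Ks by simp
      show "continuous_on {a - K * \<sigma>..a + K * \<sigma>} (V 0 0 (\<phi> \<sigma>) x)"
        by (rule DERIV_continuous_on[OF has_field_derivative_at_within[OF dV]])
    qed (use Ks in simp)
    then obtain y where "a - K * \<sigma> \<le> y" "y \<le> a + K * \<sigma>" and "V 0 0 (\<phi> \<sigma>) x y = 1 / 2" by blast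
    then have y: "\<bar>y - a\<bar> \<le> K * \<sigma>" "V 0 0 (\<phi> \<sigma>) x y = 1 / 2" by linarith+
    have dec: "V 0 0 (\<phi> \<sigma>) x d < V 0 0 (\<phi> \<sigma>) x b" if "b < d" "\<bar>b - a\<bar> \<le> K * \<sigma>" "\<bar>d - a\<bar> \<le> K * \<sigma>" for b d
    proof (rule DERIV_neg_imp_decreasing[OF that(1)])
      fix z assume "b \<le> z" "z \<le> d"
      then have "\<bar>z - a\<bar> \<le> K * \<sigma>" using that by linarith
      then have "V 0 1 (\<phi> \<sigma>) x z < 0" using slope[OF inbox] c_tilt_pos by fastforce
      then show "\<exists>y. (V 0 0 (\<phi> \<sigma>) x has_real_derivative y) (at z) \<and> y < 0" using dV by blast
    qed
    have "good_root K \<sigma> x y"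
      unfolding good_root_def
    proof (intro conjI allI impI)
      show "\<bar>y - f (\<sigma> * x) / \<sigma>\<bar> \<le> K * \<sigma>" using y by (simp add: a_def)
      show "\<sigma> * \<bar>y\<bar> < r / 2" by (rule inbox[OF y(1)])
      show "V 0 0 (\<phi> \<sigma>) x y = 1 / 2" by fact
      show "V 0 1 (\<phi> \<sigma>) x y \<le> - c_tilt / 2" by (rule slope[OF inbox[OF y(1)] y(1)])
      fix z assume z: "\<sigma> * \<bar>z\<bar> < r / 2"
      show "1 / 2 \<le> V 0 0 (\<phi> \<sigma>) x z \<longleftrightarrow> z \<le> y"
      proof
        assume le: "1 / 2 \<le> V 0 0 (\<phi> \<sigma>) x z"
        show "z \<le> y"
        proof (rule ccontr)
          assume "\<not> z \<le> y"
          moreover from this have "\<bar>z - a\<bar> \<le> K * \<sigma>" using neg[OF z] le y by linarith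
          ultimately show False using dec[of y z] y le by auto
        qed
      next
        assume le: "z \<le> y"
        show "1 / 2 \<le> V 0 0 (\<phi> \<sigma>) x z"
        proof (rule ccontr)
          assume n: "\<not> 1 / 2 \<le> V 0 0 (\<phi> \<sigma>) x z"
          then have "\<bar>z - a\<bar> \<le> K * \<sigma>" using pos[OF z] le y by linarith
          moreover have "z \<noteq> y" using n y by auto
          ultimately show False using dec[of z y] y le n by auto
        qed
      qed
    qed
    then show "\<exists>y. good_root K \<sigma> x y" ..
  qed
qed

end

section \<open>Expansion of the new interface\<close>

lemma bnd_sigma1_mult: "bnd Q a b f \<Longrightarrow> c = Suc a \<Longrightarrow> bnd Q c b (\<lambda>\<sigma> x u. \<sigma> * f \<sigma> x u)"
  using bnd_sigma_mult[of Q a b f c 1] by simp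

text \<open>The coefficient of \<sigma>^n has degree n + 1 in x and the parity of n + 1. The first
  two are multiples of the heat polynomials x^2/2 + b and x^3/6 + b x at heat time b, because the
  nonlinearity of E enters only at \<sigma>^3. In the induction b becomes \<open>beta1\<close>,
  while c and d become \<open>cb\<close> and \<open>db\<close>.\<close>

definition profile :: "real \<Rightarrow> real \<Rightarrow> real \<Rightarrow> real \<Rightarrow> real \<Rightarrow> real \<Rightarrow> real \<Rightarrow> real \<Rightarrow> real \<Rightarrow> real \<Rightarrow> real \<Rightarrow> real" where
  "profile f2 f3 f4 f5 b c d a3 a1 \<sigma> x =
     \<sigma> * (f2 * (x ^ 2 / 2 + b)) + \<sigma> ^ 2 * (f3 * (x ^ 3 / 6 + b * x))
     + \<sigma> ^ 3 * (f4 * x ^ 4 / 24 + c * x ^ 2 / 2 + d) + \<sigma> ^ 4 * (f5 * x ^ 5 / 120 + a3 * x ^ 3 + a1 * x)"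

lemma sum_weights_affine:
  fixes w :: "nat \<Rightarrow> real"
  assumes "sum w I = 1"
  shows "(\<Sum>i\<in>I. w i * (g i + h)) = (\<Sum>i\<in>I. w i * g i) + h"
    "(\<Sum>i\<in>I. w i * (h + g i)) = h + (\<Sum>i\<in>I. w i * g i)"
    "(\<Sum>i\<in>I. w i * (g i - h)) = (\<Sum>i\<in>I. w i * g i) - h"
    "(\<Sum>i\<in>I. w i * (h - g i)) = h - (\<Sum>i\<in>I. w i * g i)"
  by (simp_all add: distrib_left right_diff_distrib sum.distrib sum_subtractf assms flip: sum_distrib_right)

text \<open>For fixed \<sigma> and x the profile is affine in (b, c, d, a3, a1), so averaging with
  total weight 1 averages just these coefficients.\<close>

lemma sum_weights_profile:
  assumes "sum w I = 1"
  shows "(\<Sum>i\<in>I. w i * profile f2 f3 f4 f5 (b i) (c i) (d i) (a3 i) (a1 i) \<sigma> x)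
     = profile f2 f3 f4 f5 (\<Sum>i\<in>I. w i * b i) (\<Sum>i\<in>I. w i * c i) (\<Sum>i\<in>I. w i * d i)
         (\<Sum>i\<in>I. w i * a3 i) (\<Sum>i\<in>I. w i * a1 i) \<sigma> x"
proof -
  let ?S = "\<lambda>g. \<Sum>i\<in>I. w i * g i"
  have "(\<Sum>i\<in>I. w i * profile f2 f3 f4 f5 (b i) (c i) (d i) (a3 i) (a1 i) \<sigma> x)
     = (\<Sum>i\<in>I. (\<sigma> * f2 * x ^ 2 / 2 + \<sigma> ^ 2 * f3 * x ^ 3 / 6 + \<sigma> ^ 3 * f4 * x ^ 4 / 24 + \<sigma> ^ 4 * f5 * x ^ 5 / 120) * w i
         + (\<sigma> * f2 + \<sigma> ^ 2 * f3 * x) * (w i * b i) + (\<sigma> ^ 3 * x ^ 2 / 2) * (w i * c i) + \<sigma> ^ 3 * (w i * d i)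
         + (\<sigma> ^ 4 * x ^ 3) * (w i * a3 i) + (\<sigma> ^ 4 * x) * (w i * a1 i))"
    by (intro sum.cong refl) (simp add: profile_def field_simps)
  also have "\<dots> = (\<sigma> * f2 * x ^ 2 / 2 + \<sigma> ^ 2 * f3 * x ^ 3 / 6 + \<sigma> ^ 3 * f4 * x ^ 4 / 24 + \<sigma> ^ 4 * f5 * x ^ 5 / 120)
         + (\<sigma> * f2 + \<sigma> ^ 2 * f3 * x) * ?S b + (\<sigma> ^ 3 * x ^ 2 / 2) * ?S c + \<sigma> ^ 3 * ?S d
         + (\<sigma> ^ 4 * x ^ 3) * ?S a3 + (\<sigma> ^ 4 * x) * ?S a1"
    by (simp only: sum.distrib sum_distrib_left[symmetric] assms mult_1_right)
  finally show ?thesis by (simp add: profile_def field_simps)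
qed

text \<open>Adds the expansions of the earlier boundaries and a choice \<kappa> of roots. The
  derivatives f2 to f5 belong to the initial graph and are common to all stages; b, c, d, a3, a1
  vary with the stage.\<close>

locale stage_root = stage_data +
  fixes f2 f3 f4 f5 :: real and b c d a3 a1 :: "nat \<Rightarrow> real"
    and K \<sigma>1 :: real and \<kappa> :: "real \<Rightarrow> real \<Rightarrow> real"
  assumes expn: "\<And>i \<sigma> x. i \<in> I \<Longrightarrow> 0 < \<sigma> \<Longrightarrow> \<sigma> < \<sigma>0 \<Longrightarrow> \<sigma> * \<bar>x\<bar> < r \<Longrightarrow>
        \<bar>k i \<sigma> x - profile f2 f3 f4 f5 (b i) (c i) (d i) (a3 i) (a1 i) \<sigma> x\<bar> \<le> C * \<sigma> ^ 5 * (1 + \<bar>x\<bar>) ^ 6"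
    and K: "K \<ge> 0" and s1: "0 < \<sigma>1" "\<sigma>1 \<le> \<sigma>0"
    and root: "\<And>\<sigma> x. 0 < \<sigma> \<Longrightarrow> \<sigma> < \<sigma>1 \<Longrightarrow> \<sigma> * \<bar>x\<bar> < r / 2 \<Longrightarrow> good_root K \<sigma> x (\<kappa> \<sigma> x)"
begin

definition b' where "b' = (\<Sum>i\<in>I. w i * b i) + 1"

definition R :: "real \<Rightarrow> real \<Rightarrow> bool" where "R \<sigma> x \<longleftrightarrow> 0 < \<sigma> \<and> \<sigma> < \<sigma>1 \<and> \<sigma> * \<bar>x\<bar> < r / 2"

abbreviation Q :: "real \<Rightarrow> real \<Rightarrow> real \<Rightarrow> bool" where "Q \<equiv> \<lambda>\<sigma> x u. R \<sigma> x"
abbreviation Qin :: "real \<Rightarrow> real \<Rightarrow> real \<Rightarrow> bool" where "Qin \<equiv> \<lambda>\<sigma> x u. R \<sigma> x \<and> \<sigma> * \<bar>x + u\<bar> < r"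
abbreviation Qout :: "real \<Rightarrow> real \<Rightarrow> real \<Rightarrow> bool" where "Qout \<equiv> \<lambda>\<sigma> x u. R \<sigma> x \<and> \<not> \<sigma> * \<bar>x + u\<bar> < r"

lemma R_D:
  assumes "R \<sigma> x"
  shows "0 < \<sigma>" "\<sigma> < \<sigma>1" "\<sigma> < \<sigma>0" "\<sigma> * \<bar>x\<bar> < r / 2" "\<sigma> * \<bar>x\<bar> < r" "good_root K \<sigma> x (\<kappa> \<sigma> x)" "\<sigma> * \<bar>\<kappa> \<sigma> x\<bar> < r / 2"
proof -
  show "0 < \<sigma>" "\<sigma> < \<sigma>1" "\<sigma> < \<sigma>0" "\<sigma> * \<bar>x\<bar> < r / 2" "\<sigma> * \<bar>x\<bar> < r" using assms s1 r by (auto simp: R_def)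
  show "good_root K \<sigma> x (\<kappa> \<sigma> x)" using assms root by (auto simp: R_def)
  then show "\<sigma> * \<bar>\<kappa> \<sigma> x\<bar> < r / 2" by (simp add: good_root_def)
qed

lemma far: "bnd Qout m l g \<Longrightarrow> m' = m + n \<Longrightarrow> bnd Qout m' l g"
proof (erule bnd_far[where \<rho> = "r / 2"])
  fix \<sigma> x u assume H: "R \<sigma> x \<and> \<not> \<sigma> * \<bar>x + u\<bar> < r" "\<sigma> > 0"
  have "\<bar>x + u\<bar> \<le> \<bar>x\<bar> + \<bar>u\<bar>" by simp
  from mult_left_mono[OF this less_imp_le[OF H(2)]]
  show "r / 2 \<le> \<sigma> * \<bar>u\<bar>" using H R_D(4)[of \<sigma> x] unfolding distrib_left by linarith
qed (use r in auto)

definition p2 where "p2 i x = f2 * (x ^ 2 / 2 + b i)"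
definition p3 where "p3 i x = f3 * (x ^ 3 / 6 + b i * x)"
definition p4 where "p4 i x = f4 * x ^ 4 / 24 + c i * x ^ 2 / 2 + d i"
definition p5 where "p5 i x = f5 * x ^ 5 / 120 + a3 i * x ^ 3 + a1 i * x"

lemma profile_split:
  "profile f2 f3 f4 f5 (b i) (c i) (d i) (a3 i) (a1 i) \<sigma> x = \<sigma> * p2 i x + \<sigma> ^ 2 * p3 i x + \<sigma> ^ 3 * p4 i x + \<sigma> ^ 4 * p5 i x"
  by (simp add: profile_def p2_def p3_def p4_def p5_def)

lemma bnd_p: "bnd P 1 2 (\<lambda>\<sigma> x u. \<sigma> * p2 i (x + u))" "bnd P 2 3 (\<lambda>\<sigma> x u. \<sigma> ^ 2 * p3 i (x + u))"
  "bnd P 3 4 (\<lambda>\<sigma> x u. \<sigma> ^ 3 * p4 i (x + u))" "bnd P 4 5 (\<lambda>\<sigma> x u. \<sigma> ^ 4 * p5 i (x + u))"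
proof -
  have x1: "bnd P 0 n (\<lambda>\<sigma> x u. x + u)" if "n \<ge> 1" for n
    using bnd_xu_power[of 1 n P] that by simp
  have q: "bnd P 0 2 (\<lambda>\<sigma> x u. p2 i (x + u))" "bnd P 0 3 (\<lambda>\<sigma> x u. p3 i (x + u))"
    "bnd P 0 4 (\<lambda>\<sigma> x u. p4 i (x + u))" "bnd P 0 5 (\<lambda>\<sigma> x u. p5 i (x + u))"
    unfolding p2_def p3_def p4_def p5_def
    by (intro bnd_add bnd_cmult bnd_divc bnd_const bnd_xu_power x1; simp)+
  show "bnd P 1 2 (\<lambda>\<sigma> x u. \<sigma> * p2 i (x + u))" "bnd P 2 3 (\<lambda>\<sigma> x u. \<sigma> ^ 2 * p3 i (x + u))"
    "bnd P 3 4 (\<lambda>\<sigma> x u. \<sigma> ^ 3 * p4 i (x + u))" "bnd P 4 5 (\<lambda>\<sigma> x u. \<sigma> ^ 4 * p5 i (x + u))"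
    by (rule bnd_sigma1_mult[OF q(1)] bnd_sigma_mult[OF q(2)] bnd_sigma_mult[OF q(3)] bnd_sigma_mult[OF q(4)]; simp)+
qed

lemma f_square: "\<bar>z\<bar> < r \<Longrightarrow> \<bar>f z\<bar> \<le> C * z\<^sup>2"
  using f_taylor[of z 0] f'_le[of 0] f_0 r by simp

lemma kappa_near: "bnd Q 1 0 (\<lambda>\<sigma> x u. \<kappa> \<sigma> x - f (\<sigma> * x) / \<sigma>)"
  by (rule bndI[of K _ _ _ _ 0]) (use K R_D(6) in \<open>auto simp: good_root_def\<close>)

lemma kappa_bnd: "bnd Q 1 2 (\<lambda>\<sigma> x u. \<kappa> \<sigma> x)"
proof -
  have "bnd Q 1 2 (\<lambda>\<sigma> x u. f (\<sigma> * x) / \<sigma>)"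
  proof (rule bndI[of C _ _ _ _ 0])
    fix \<sigma> x u :: real assume "R \<sigma> x"
    note H = R_D[OF this]
    have "\<bar>f (\<sigma> * x)\<bar> \<le> C * (\<sigma> * x)\<^sup>2" by (rule f_square) (use H in \<open>simp add: abs_mult\<close>)
    then have "\<bar>f (\<sigma> * x) / \<sigma>\<bar> \<le> C * \<sigma> * \<bar>x\<bar> ^ 2"
      using H(1) by (simp add: field_simps power2_eq_square)
    also have "\<dots> \<le> C * \<sigma> * (1 + \<bar>x\<bar>) ^ 2" using C H(1) by (intro mult_left_mono power_mono) auto
    finally show "\<bar>f (\<sigma> * x) / \<sigma>\<bar> \<le> C * \<sigma> ^ 1 * (1 + \<bar>x\<bar>) ^ 2 * (1 + \<bar>u\<bar>) ^ 0" by simp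
  qed (use C in auto)
  from bnd_add[OF this bnd_weaken[OF kappa_near]] show ?thesis by simp
qed

lemma kappa_bnd_out: "bnd Qout 1 2 (\<lambda>\<sigma> x u. \<kappa> \<sigma> x)"
  by (rule bnd_subset[OF kappa_bnd]) auto

definition D where "D i \<sigma> x u = k i \<sigma> (x + u) - \<kappa> \<sigma> x"

text \<open>The two heights are separately of size \<sigma> (1 + |x|)^2, but their difference grows
  with one power only: f (\<sigma> (x + u)) - f (\<sigma> x) is f' (\<sigma> x) \<sigma> u up to
  O(\<sigma>^2 u^2), and |f' z| \<le> C |z|. The powers of D in the expansion of E then stay within
  the weight (1 + |x|)^6.\<close>

lemma D_bnd: assumes "i \<in> I" shows "bnd Qin 1 1 (D i)"
proof -
  have 1: "bnd Qin 1 1 (\<lambda>\<sigma> x u. k i \<sigma> (x + u) - f (\<sigma> * (x + u)) / \<sigma>)"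
  proof (rule bnd_weaken)
    show "bnd Qin 1 0 (\<lambda>\<sigma> x u. k i \<sigma> (x + u) - f (\<sigma> * (x + u)) / \<sigma>)"
      by (rule bndI[of C _ _ _ _ 0]) (use C near[OF assms] R_D in auto)
  qed auto
  have 2: "bnd Qin 1 1 (\<lambda>\<sigma> x u. f (\<sigma> * (x + u)) / \<sigma> - f (\<sigma> * x) / \<sigma>)"
  proof (rule bndI[of "2 * C" _ _ _ _ 2])
    fix \<sigma> x u :: real assume Q: "R \<sigma> x \<and> \<sigma> * \<bar>x + u\<bar> < r"
    note H = R_D[OF conjunct1[OF Q]]
    have s: "\<bar>\<sigma> * x\<bar> < r" "\<bar>\<sigma> * (x + u)\<bar> < r" using H Q by (simp_all add: abs_mult)
    have "\<bar>f (\<sigma> * (x + u)) - f (\<sigma> * x) - f' (\<sigma> * x) * (\<sigma> * (x + u) - \<sigma> * x)\<bar> \<le> C * (\<sigma> * (x + u) - \<sigma> * x)\<^sup>2"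
      by (rule f_taylor[OF s(2,1)])
    then have t: "\<bar>f (\<sigma> * (x + u)) - f (\<sigma> * x) - f' (\<sigma> * x) * (\<sigma> * u)\<bar> \<le> C * (\<sigma> * u)\<^sup>2"
      by (simp add: algebra_simps)
    have "\<bar>f' (\<sigma> * x) * (\<sigma> * u)\<bar> \<le> C * \<bar>\<sigma> * x\<bar> * \<bar>\<sigma> * u\<bar>"
      unfolding abs_mult[of "f' _"] by (intro mult_right_mono f'_le s) auto
    with t have "\<bar>f (\<sigma> * (x + u)) - f (\<sigma> * x)\<bar> \<le> C * \<bar>\<sigma> * x\<bar> * \<bar>\<sigma> * u\<bar> + C * (\<sigma> * u)\<^sup>2" by linarith
    also have "\<dots> = \<sigma> ^ 2 * C * (\<bar>x\<bar> * \<bar>u\<bar> + 1 * u\<^sup>2)" using H(1) by (simp add: abs_mult power2_eq_square algebra_simps)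
    also have "\<dots> \<le> \<sigma> ^ 2 * C * ((1 + \<bar>x\<bar>) * (1 + \<bar>u\<bar>) ^ 2 + (1 + \<bar>x\<bar>) * (1 + \<bar>u\<bar>) ^ 2)"
    proof (intro mult_left_mono add_mono mult_mono)
      have "0 \<le> \<bar>u\<bar> * \<bar>u\<bar>" by simp
      then show "\<bar>u\<bar> \<le> (1 + \<bar>u\<bar>)\<^sup>2" "u\<^sup>2 \<le> (1 + \<bar>u\<bar>)\<^sup>2" by (simp_all add: power2_eq_square algebra_simps)
    qed (use C in auto)
    finally have "\<bar>f (\<sigma> * (x + u)) - f (\<sigma> * x)\<bar> \<le> \<sigma> * (2 * C * \<sigma> * (1 + \<bar>x\<bar>) * (1 + \<bar>u\<bar>) ^ 2)"
      by (simp add: power2_eq_square algebra_simps)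
    then have "\<bar>f (\<sigma> * (x + u)) - f (\<sigma> * x)\<bar> / \<sigma> \<le> 2 * C * \<sigma> * (1 + \<bar>x\<bar>) * (1 + \<bar>u\<bar>) ^ 2"
      using H(1) by (simp add: pos_divide_le_eq mult.commute)
    moreover have "\<bar>f (\<sigma> * (x + u)) / \<sigma> - f (\<sigma> * x) / \<sigma>\<bar> = \<bar>f (\<sigma> * (x + u)) - f (\<sigma> * x)\<bar> / \<sigma>"
      using H(1) unfolding diff_divide_distrib[symmetric] by (simp add: abs_divide)
    ultimately show "\<bar>f (\<sigma> * (x + u)) / \<sigma> - f (\<sigma> * x) / \<sigma>\<bar> \<le> 2 * C * \<sigma> ^ 1 * (1 + \<bar>x\<bar>) ^ 1 * (1 + \<bar>u\<bar>) ^ 2" by simp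
  qed (use C in auto)
  have 3: "bnd Qin 1 1 (\<lambda>\<sigma> x u. \<kappa> \<sigma> x - f (\<sigma> * x) / \<sigma>)"
    by (rule bnd_weaken[OF bnd_subset[OF kappa_near]]) auto
  show ?thesis by (rule bnd_cong[OF bnd_diff[OF bnd_add[OF 1 2] 3]]) (simp add: D_def)
qed

lemma k_expn: assumes "i \<in> I"
  shows "bnd Qin 5 6 (\<lambda>\<sigma> x u. k i \<sigma> (x + u) - profile f2 f3 f4 f5 (b i) (c i) (d i) (a3 i) (a1 i) \<sigma> (x + u))"
proof (rule bndI[of C _ _ _ _ 6])
  fix \<sigma> x u :: real assume Q: "R \<sigma> x \<and> \<sigma> * \<bar>x + u\<bar> < r"
  note H = R_D[OF conjunct1[OF Q]]
  have "(1 + \<bar>x + u\<bar>) ^ 6 \<le> ((1 + \<bar>x\<bar>) * (1 + \<bar>u\<bar>)) ^ 6"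
    by (intro power_mono) (auto simp: algebra_simps intro: order_trans[OF abs_triangle_ineq])
  then have "C * \<sigma> ^ 5 * (1 + \<bar>x + u\<bar>) ^ 6 \<le> C * \<sigma> ^ 5 * ((1 + \<bar>x\<bar>) * (1 + \<bar>u\<bar>)) ^ 6"
    using C H(1) by (intro mult_left_mono) auto
  then show "\<bar>k i \<sigma> (x + u) - profile f2 f3 f4 f5 (b i) (c i) (d i) (a3 i) (a1 i) \<sigma> (x + u)\<bar>
      \<le> C * \<sigma> ^ 5 * (1 + \<bar>x\<bar>) ^ 6 * (1 + \<bar>u\<bar>) ^ 6"
    using expn[OF assms H(1) H(3), of "x + u"] Q by (simp add: power_mult_distrib mult_ac)
qed (use C in auto)

definition Wi where "Wi l i \<sigma> x u = W l (indicator (A i \<sigma>)) (x + u) (\<kappa> \<sigma> x)"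

text \<open>The far-field estimate is used with n = 5 to match the error of the full
  expansion.\<close>

lemma Wi_hl: assumes "i \<in> I" shows "bnd Qin 5 0 (\<lambda>\<sigma> x u. Wi l i \<sigma> x u - hl l (D i \<sigma> x u))"
proof -
  define M where "M = (LINT t|lborel. (1 + \<bar>t\<bar>) ^ 5 * \<bar>gd l t\<bar>)"
  have M: "M \<ge> 0" unfolding M_def by (intro Bochner_Integration.integral_nonneg) auto
  show ?thesis
  proof (rule bndI[of "(2 / r) ^ 5 * M" _ _ _ _ 0])
    show "0 \<le> (2 / r) ^ 5 * M" using M r by auto
    fix \<sigma> x u :: real assume Q: "R \<sigma> x \<and> \<sigma> * \<bar>x + u\<bar> < r"
    note H = R_D[OF conjunct1[OF Q]]
    have "\<bar>Wi l i \<sigma> x u - hl l (D i \<sigma> x u)\<bar> \<le> (2 * \<sigma> / r) ^ 5 * M"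
      unfolding Wi_def D_def M_def by (rule W_tail) (use assms H Q in auto)
    also have "\<dots> = (2 / r) ^ 5 * M * \<sigma> ^ 5" by (simp add: power_mult_distrib power_divide)
    finally show "\<bar>Wi l i \<sigma> x u - hl l (D i \<sigma> x u)\<bar> \<le> (2 / r) ^ 5 * M * \<sigma> ^ 5 * (1 + \<bar>x\<bar>) ^ 0 * (1 + \<bar>u\<bar>) ^ 0" by simp
  qed
qed

lemma Wi_bnd: assumes "i \<in> I" shows "bnd Q 0 0 (Wi l i)"
proof (rule bndI[of "gd_norm l" _ _ _ _ 0])
  fix \<sigma> x u :: real assume "R \<sigma> x"
  have "\<bar>Wi l i \<sigma> x u\<bar> \<le> 1 * gd_norm l"
    unfolding Wi_def by (rule W_bound[OF indicator_measurable[OF assms R_D(1)[OF \<open>R \<sigma> x\<close>]]]) (simp add: indicator_def)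
  then show "\<bar>Wi l i \<sigma> x u\<bar> \<le> gd_norm l * \<sigma> ^ 0 * (1 + \<bar>x\<bar>) ^ 0 * (1 + \<bar>u\<bar>) ^ 0" by simp
qed (rule gd_norm_nonneg)

text \<open>Up to the far field this is E at D, divided by \<open>gs 0\<close>, that is D - D^3/12 +
  O(D^5); the division normalises the linear coefficient to 1.\<close>

abbreviation e0 where "e0 i \<sigma> x u \<equiv> (Wi 0 i \<sigma> x u - 1 / 2) / gs 0"

lemma e0_out: "i \<in> I \<Longrightarrow> bnd Qout m l (e0 i)"
  by (rule bnd_weaken[OF far[OF bnd_divc[OF bnd_diff[OF bnd_subset[OF Wi_bnd] bnd_const]]]]) auto

lemma e0_in: assumes "i \<in> I" shows "bnd Qin 5 0 (\<lambda>\<sigma> x u. e0 i \<sigma> x u - E (D i \<sigma> x u) / gs 0)"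
  by (rule bnd_cong[OF bnd_divc[OF Wi_hl[OF assms, of 0], where c = "gs 0"]]) (simp add: hl_0 diff_divide_distrib add_divide_distrib)

lemma gs0: "gs 0 \<noteq> 0" using gs_pos[of 0] by simp

text \<open>First pass: the cubic term of E involves \<kappa> through D, so E is replaced by its
  linear part to determine \<kappa> up to order \<sigma>^3. Only then can D^3 be expanded.\<close>

lemma e0_expansion_weak: assumes "i \<in> I"
  shows "bnd Q 3 4 (\<lambda>\<sigma> x u. e0 i \<sigma> x u - (\<sigma> * p2 i (x + u) + \<sigma> ^ 2 * p3 i (x + u) - \<kappa> \<sigma> x))"
proof (rule bnd_union[where P = "\<lambda>\<sigma> x u. \<sigma> * \<bar>x + u\<bar> < r"])
  have 1: "bnd Qin 3 4 (\<lambda>\<sigma> x u. e0 i \<sigma> x u - E (D i \<sigma> x u) / gs 0)"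
    by (rule bnd_weaken[OF e0_in[OF assms]]) auto
  have "bnd Qin 3 3 (\<lambda>\<sigma> x u. E (D i \<sigma> x u) - gs 0 * D i \<sigma> x u)"
  proof (rule bnd_le)
    show "bnd Qin 3 3 (\<lambda>\<sigma> x u. D i \<sigma> x u ^ 3)" by (rule bnd_powerI[OF D_bnd[OF assms]]) auto
  qed (use E_taylor3 in \<open>simp add: power_abs\<close>)
  from bnd_divc[OF bnd_weaken[OF this], of 3 4 "gs 0"]
  have 2: "bnd Qin 3 4 (\<lambda>\<sigma> x u. E (D i \<sigma> x u) / gs 0 - D i \<sigma> x u)"
    by (simp add: diff_divide_distrib gs0)
  have 3: "bnd Qin 3 4 (\<lambda>\<sigma> x u. k i \<sigma> (x + u) - profile f2 f3 f4 f5 (b i) (c i) (d i) (a3 i) (a1 i) \<sigma> (x + u))"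
    by (rule bnd_weaken[OF k_expn[OF assms]]) auto
  have 4: "bnd Qin 3 4 (\<lambda>\<sigma> x u. \<sigma> ^ 3 * p4 i (x + u) + \<sigma> ^ 4 * p5 i (x + u))"
    by (intro bnd_add bnd_p bnd_weaken[OF bnd_p(4)]) auto
  show "bnd Qin 3 4 (\<lambda>\<sigma> x u. e0 i \<sigma> x u - (\<sigma> * p2 i (x + u) + \<sigma> ^ 2 * p3 i (x + u) - \<kappa> \<sigma> x))"
    by (rule bnd_cong[OF bnd_add[OF bnd_add[OF 1 2] bnd_add[OF 3 4]]]) (simp add: profile_split D_def)
  show "bnd Qout 3 4 (\<lambda>\<sigma> x u. e0 i \<sigma> x u - (\<sigma> * p2 i (x + u) + \<sigma> ^ 2 * p3 i (x + u) - \<kappa> \<sigma> x))"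
    by (intro bnd_diff bnd_add e0_out[OF assms] bnd_weaken[OF far[OF bnd_p(1) refl, where n = 2]]
        bnd_weaken[OF far[OF bnd_p(2) refl, where n = 1]] bnd_weaken[OF far[OF kappa_bnd_out refl, where n = 2]]) auto
qed

lemma integrable_gd_e0: assumes "i \<in> I" "R \<sigma> x" shows "integrable lborel (\<lambda>u. gd j (- u) * e0 i \<sigma> x u)"
proof -
  have "integrable lborel (\<lambda>u. gd j (- u))"
    using lborel_integrable_real_affine[OF integrable_gd[of j], of "-1" 0] by simp
  then have "integrable lborel (\<lambda>u. (1 / gs 0) * (gd j (- u) * W 0 (indicator (A i \<sigma>)) (x + u) (\<kappa> \<sigma> x)) - (1 / (2 * gs 0)) * gd j (- u))"
    by (intro Bochner_Integration.integrable_diff integrable_mult_right integrable_gd_W assms R_D(1)[OF assms(2)])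
  then show ?thesis by (simp add: Wi_def diff_divide_distrib right_diff_distrib mult_ac)
qed

lemma sum_integral_Wi:
  assumes "R \<sigma> x"
  shows "(\<Sum>i\<in>I. w i * (LINT u|lborel. gd j (- u) * Wi l i \<sigma> x u)) = V j l (\<phi> \<sigma>) x (\<kappa> \<sigma> x)"
  unfolding Wi_def using V_phi[OF R_D(1)[OF assms]] by simp

lemma integral_gd_const: "(LINT u|lborel. gd 0 (- u)) = 1" "(LINT u|lborel. gd 1 (- u)) = 0" "(LINT u|lborel. gd 2 (- u)) = 0"
  using gs_moments_poly[of "\<lambda>u. 1" 1 0 0 0 0 0 0 0 0] by (simp_all add: has_bochner_integral_iff)

text \<open>As the weights sum to 1, the 1/2 in \<open>e0\<close> removes half the total integral of
  the kernel. For j = 0 this cancels against V = 1/2 at the root, and for j = 1, 2 the kernel has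
  integral 0.\<close>

lemma sum_integral_e0:
  assumes "R \<sigma> x" "j \<in> {0, 1, 2}"
  shows "(\<Sum>i\<in>I. w i * (LINT u|lborel. gd j (- u) * e0 i \<sigma> x u)) = (if j = 0 then 0 else V j 0 (\<phi> \<sigma>) x (\<kappa> \<sigma> x) / gs 0)"
proof -
  have ig: "integrable lborel (\<lambda>u. gd j (- u))"
    using lborel_integrable_real_affine[OF integrable_gd[of j], of "-1" 0] by simp
  define J where "J = (LINT u|lborel. gd j (- u))"
  have "(LINT u|lborel. gd j (- u) * e0 i \<sigma> x u) = ((LINT u|lborel. gd j (- u) * Wi 0 i \<sigma> x u) - J / 2) / gs 0" if "i \<in> I" for i
  proof -
    have "(\<lambda>u. gd j (- u) * e0 i \<sigma> x u) = (\<lambda>u. (gd j (- u) * Wi 0 i \<sigma> x u - gd j (- u) / 2) / gs 0)"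
      by (simp add: fun_eq_iff right_diff_distrib)
    then show ?thesis
      using integrable_gd_W[OF that R_D(1)[OF assms(1)], of j 0 x "\<kappa> \<sigma> x"] ig by (simp add: Wi_def J_def)
  qed
  then have "(\<Sum>i\<in>I. w i * (LINT u|lborel. gd j (- u) * e0 i \<sigma> x u))
      = (\<Sum>i\<in>I. w i * ((LINT u|lborel. gd j (- u) * Wi 0 i \<sigma> x u) - J / 2)) / gs 0"
    by (simp only: sum_divide_distrib times_divide_eq_right cong: sum.cong)
  also have "\<dots> = (V j 0 (\<phi> \<sigma>) x (\<kappa> \<sigma> x) - J / 2) / gs 0"
    unfolding sum_weights_affine[OF sumw] sum_integral_Wi[OF assms(1)] ..
  finally show ?thesis using assms(2) integral_gd_const R_D(6)[OF assms(1)]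
    by (auto simp: J_def good_root_def simp del: One_nat_def)
qed

lemma kappa_expansion_weak: "bnd Q 3 4 (\<lambda>\<sigma> x u. \<kappa> \<sigma> x - (\<sigma> * (f2 * (x ^ 2 / 2 + b')) + \<sigma> ^ 2 * (f3 * (x ^ 3 / 6 + b' * x))))"
proof -
  \<comment> \<open>The Gaussian means of (x + u)^2/2 and (x + u)^3/6 are x^2/2 + 1 and x^3/6 + x,
    so one step raises the heat time \<open>b i\<close> by 1. The weighted sum of the integrals
    being 0, the weighted sum of T gives \<kappa>.\<close>
  define T where "T i \<sigma> x = \<sigma> * (f2 * (x ^ 2 / 2 + (b i + 1))) + \<sigma> ^ 2 * (f3 * (x ^ 3 / 6 + (b i + 1) * x)) - \<kappa> \<sigma> x" for i \<sigma> x
  have 1: "bnd Q 3 4 (\<lambda>\<sigma> x u. (LINT u|lborel. gd 0 (- u) * e0 i \<sigma> x u) - T i \<sigma> x)" if "i \<in> I" for i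
  proof (rule integral_gd_of_bnd[OF e0_expansion_weak[OF that]])
    fix \<sigma> x :: real assume "R \<sigma> x"
    show "integrable lborel (\<lambda>u. gd 0 (- u) * e0 i \<sigma> x u)" by (rule integrable_gd_e0[OF that \<open>R \<sigma> x\<close>])
    have T: "T i \<sigma> x = (\<sigma> * (f2 * (x ^ 2 / 2 + b i)) + \<sigma> ^ 2 * (f3 * (x ^ 3 / 6 + b i * x)) - \<kappa> \<sigma> x)
      + 2 * (\<sigma> * f2 / 2 + \<sigma> ^ 2 * f3 * x / 2) + 12 * 0 + 120 * 0 + 1680 * 0"
      by (simp add: T_def field_simps)
    show "has_bochner_integral lborel (\<lambda>u. gd 0 (- u) * (\<sigma> * p2 i (x + u) + \<sigma> ^ 2 * p3 i (x + u) - \<kappa> \<sigma> x)) (T i \<sigma> x)"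
      unfolding T
      by (rule gs_moments_poly(1)[where ?q1.0 = "\<sigma> * f2 * x + \<sigma> ^ 2 * f3 * (x ^ 2 / 2 + b i)" and ?q3.0 = "\<sigma> ^ 2 * f3 / 6" and ?q5.0 = 0 and ?q7.0 = 0])
         (simp add: p2_def p3_def power2_eq_square power3_eq_cube field_simps)
  qed
  have "bnd Q 3 4 (\<lambda>\<sigma> x u. \<Sum>i\<in>I. w i * ((LINT u|lborel. gd 0 (- u) * e0 i \<sigma> x u) - T i \<sigma> x))"
    by (intro bnd_sum bnd_cmult 1)
  then show ?thesis
  proof (rule bnd_cong)
    fix \<sigma> x u :: real assume "R \<sigma> x"
    have "(\<Sum>i\<in>I. w i * T i \<sigma> x) = (\<Sum>i\<in>I. w i * (profile f2 f3 0 0 (b i + 1) 0 0 0 0 \<sigma> x - \<kappa> \<sigma> x))"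
      by (simp add: T_def profile_def)
    also have "\<dots> = profile f2 f3 0 0 b' 0 0 0 0 \<sigma> x - \<kappa> \<sigma> x"
      unfolding sum_weights_affine[OF sumw] sum_weights_profile[OF sumw] b'_def by simp
    finally have "(\<Sum>i\<in>I. w i * T i \<sigma> x) = profile f2 f3 0 0 b' 0 0 0 0 \<sigma> x - \<kappa> \<sigma> x" .
    moreover have "(\<Sum>i\<in>I. w i * ((LINT u|lborel. gd 0 (- u) * e0 i \<sigma> x u) - T i \<sigma> x)) = 0 - (\<Sum>i\<in>I. w i * T i \<sigma> x)"
      using sum_integral_e0[OF \<open>R \<sigma> x\<close>, of 0] by (simp add: right_diff_distrib sum_subtractf)
    ultimately show "\<kappa> \<sigma> x - (\<sigma> * (f2 * (x ^ 2 / 2 + b')) + \<sigma> ^ 2 * (f3 * (x ^ 3 / 6 + b' * x)))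
        = (\<Sum>i\<in>I. w i * ((LINT u|lborel. gd 0 (- u) * e0 i \<sigma> x u) - T i \<sigma> x))"
      by (simp add: profile_def)
  qed
qed

text \<open>The first-order lead of stage i over the new interface. With it, \<open>d2\<close> and
  \<open>d3\<close> are the coefficients of \<sigma> and \<sigma>^2 in D; the terms x^2/2 and x^3/6
  of the common initial graph have cancelled.\<close>

definition dl where "dl i = b i - b'"
definition d2 where "d2 i x u = f2 * (dl i + x * u + u ^ 2 / 2)"
definition d3 where "d3 i x u = f3 * (dl i * x + (x ^ 2 / 2 + b i) * u + x / 2 * u ^ 2 + u ^ 3 / 6)"

lemma bnd_d: "bnd P 1 1 (\<lambda>\<sigma> x u. \<sigma> * d2 i x u)" "bnd P 2 2 (\<lambda>\<sigma> x u. \<sigma> ^ 2 * d3 i x u)"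
proof -
  have x1: "bnd P 0 n (\<lambda>\<sigma> x u. x)" if "n \<ge> 1" for n using bnd_x_power[of 1 n P] that by simp
  have u1: "bnd P 0 n (\<lambda>\<sigma> x u. u)" for n using bnd_u_power[of P n 1] by simp
  have "bnd P 0 1 (\<lambda>\<sigma> x u. x * u)"
    by (rule bnd_mult[OF bnd_x bnd_u]) auto
  moreover have "bnd P 0 2 (\<lambda>\<sigma> x u. (x ^ 2 / 2 + b i) * u)"
    by (rule bnd_mult[OF bnd_add[OF bnd_divc[OF bnd_x_power[of 2 2]] bnd_const] bnd_u]) auto
  moreover have "bnd P 0 2 (\<lambda>\<sigma> x u. x / 2 * u ^ 2)"
    by (rule bnd_weaken[OF bnd_mult[OF bnd_divc[OF bnd_x] bnd_u_power[of _ 0] refl refl]]) auto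
  ultimately have xu: "bnd P 0 1 (\<lambda>\<sigma> x u. x * u)" "bnd P 0 2 (\<lambda>\<sigma> x u. (x ^ 2 / 2 + b i) * u)"
    "bnd P 0 2 (\<lambda>\<sigma> x u. x / 2 * u ^ 2)" .
  have q: "bnd P 0 1 (\<lambda>\<sigma> x u. d2 i x u)" "bnd P 0 2 (\<lambda>\<sigma> x u. d3 i x u)"
    unfolding d2_def d3_def by (intro bnd_add bnd_cmult bnd_divc bnd_const bnd_u_power x1 xu; simp)+
  show "bnd P 1 1 (\<lambda>\<sigma> x u. \<sigma> * d2 i x u)" "bnd P 2 2 (\<lambda>\<sigma> x u. \<sigma> ^ 2 * d3 i x u)"
    by (rule bnd_sigma1_mult[OF q(1)] bnd_sigma_mult[OF q(2)]; simp)+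
qed

lemma D_remainder: assumes "i \<in> I"
  shows "bnd Qin 3 4 (\<lambda>\<sigma> x u. D i \<sigma> x u - (\<sigma> * d2 i x u + \<sigma> ^ 2 * d3 i x u))"
proof -
  have 3: "bnd Qin 3 4 (\<lambda>\<sigma> x u. k i \<sigma> (x + u) - profile f2 f3 f4 f5 (b i) (c i) (d i) (a3 i) (a1 i) \<sigma> (x + u))"
    by (rule bnd_weaken[OF k_expn[OF assms]]) auto
  have 4: "bnd Qin 3 4 (\<lambda>\<sigma> x u. \<sigma> ^ 3 * p4 i (x + u) + \<sigma> ^ 4 * p5 i (x + u))"
    by (intro bnd_add bnd_p bnd_weaken[OF bnd_p(4)]) auto
  have 5: "bnd Qin 3 4 (\<lambda>\<sigma> x u. \<kappa> \<sigma> x - (\<sigma> * (f2 * (x ^ 2 / 2 + b')) + \<sigma> ^ 2 * (f3 * (x ^ 3 / 6 + b' * x))))"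
    by (rule bnd_subset[OF kappa_expansion_weak]) auto
  show ?thesis
  proof (rule bnd_cong[OF bnd_diff[OF bnd_add[OF 3 4] 5]])
    fix \<sigma> x u :: real
    have "p2 i (x + u) = f2 * (x ^ 2 / 2 + b') + d2 i x u" "p3 i (x + u) = f3 * (x ^ 3 / 6 + b' * x) + d3 i x u"
      by (simp_all add: p2_def p3_def d2_def d3_def dl_def power2_eq_square power3_eq_cube field_simps)
    then show "D i \<sigma> x u - (\<sigma> * d2 i x u + \<sigma> ^ 2 * d3 i x u) =
       k i \<sigma> (x + u) - profile f2 f3 f4 f5 (b i) (c i) (d i) (a3 i) (a1 i) \<sigma> (x + u)
         + (\<sigma> ^ 3 * p4 i (x + u) + \<sigma> ^ 4 * p5 i (x + u))
         - (\<kappa> \<sigma> x - (\<sigma> * (f2 * (x ^ 2 / 2 + b')) + \<sigma> ^ 2 * (f3 * (x ^ 3 / 6 + b' * x))))"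
      unfolding profile_split D_def by (simp add: algebra_simps)
  qed
qed

text \<open>With a + b the two-term approximation of D, the difference D^3 - (a + b)^3 has the
  remainder of D, of order \<sigma>^3, as a factor and a second factor of order \<sigma>^2; what is
  left, 3 a b^2 + b^3, is of order \<sigma>^5 or smaller.\<close>

lemma D_cube: assumes "i \<in> I"
  shows "bnd Qin 5 6 (\<lambda>\<sigma> x u. D i \<sigma> x u ^ 3 - (\<sigma> ^ 3 * d2 i x u ^ 3 + 3 * \<sigma> ^ 4 * (d2 i x u ^ 2 * d3 i x u)))"
proof -
  let ?a = "\<lambda>\<sigma> x u. \<sigma> * d2 i x u" and ?b = "\<lambda>\<sigma> x u. \<sigma> ^ 2 * d3 i x u"
  let ?R = "\<lambda>\<sigma> x u. D i \<sigma> x u - (?a \<sigma> x u + ?b \<sigma> x u)"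
  have ab: "bnd Qin 1 1 (\<lambda>\<sigma> x u. ?a \<sigma> x u + ?b \<sigma> x u)"
    by (intro bnd_add bnd_d bnd_weaken[OF bnd_d(2)]) auto
  have 1: "bnd Qin 2 2 (\<lambda>\<sigma> x u. D i \<sigma> x u ^ 2 + D i \<sigma> x u * (?a \<sigma> x u + ?b \<sigma> x u) + (?a \<sigma> x u + ?b \<sigma> x u) ^ 2)"
    by (intro bnd_add bnd_powerI[OF D_bnd[OF assms]] bnd_mult[OF D_bnd[OF assms] ab] bnd_powerI[OF ab]) auto
  have 2: "bnd Qin 5 6 (\<lambda>\<sigma> x u. ?R \<sigma> x u * (D i \<sigma> x u ^ 2 + D i \<sigma> x u * (?a \<sigma> x u + ?b \<sigma> x u) + (?a \<sigma> x u + ?b \<sigma> x u) ^ 2))"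
    by (rule bnd_mult[OF D_remainder[OF assms] 1]) auto
  have 3: "bnd Qin 5 6 (\<lambda>\<sigma> x u. 3 * (?a \<sigma> x u * ?b \<sigma> x u ^ 2))"
    by (rule bnd_weaken[OF bnd_cmult[OF bnd_mult[OF bnd_d(1) bnd_powerI[OF bnd_d(2), where n = 2] refl refl]]]) auto
  have 4: "bnd Qin 5 6 (\<lambda>\<sigma> x u. ?b \<sigma> x u ^ 3)"
    by (rule bnd_weaken[OF bnd_powerI[OF bnd_d(2), where n = 3]]) auto
  show ?thesis
    by (rule bnd_cong[OF bnd_add[OF 2 bnd_add[OF 3 4]]]) (simp add: eval_nat_numeral algebra_simps)
qed

lemma D_square: assumes "i \<in> I"
  shows "bnd Qin 4 5 (\<lambda>\<sigma> x u. D i \<sigma> x u ^ 2 - (\<sigma> ^ 2 * d2 i x u ^ 2 + 2 * \<sigma> ^ 3 * (d2 i x u * d3 i x u)))"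
proof -
  let ?a = "\<lambda>\<sigma> x u. \<sigma> * d2 i x u" and ?b = "\<lambda>\<sigma> x u. \<sigma> ^ 2 * d3 i x u"
  let ?R = "\<lambda>\<sigma> x u. D i \<sigma> x u - (?a \<sigma> x u + ?b \<sigma> x u)"
  have ab: "bnd Qin 1 1 (\<lambda>\<sigma> x u. ?a \<sigma> x u + ?b \<sigma> x u)"
    by (intro bnd_add bnd_d bnd_weaken[OF bnd_d(2)]) auto
  have 2: "bnd Qin 4 5 (\<lambda>\<sigma> x u. ?R \<sigma> x u * (D i \<sigma> x u + (?a \<sigma> x u + ?b \<sigma> x u)))"
    by (rule bnd_mult[OF D_remainder[OF assms] bnd_add[OF D_bnd[OF assms] ab]]) auto
  have 4: "bnd Qin 4 5 (\<lambda>\<sigma> x u. ?b \<sigma> x u ^ 2)"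
    by (rule bnd_weaken[OF bnd_powerI[OF bnd_d(2), where n = 2]]) auto
  show ?thesis
    by (rule bnd_cong[OF bnd_add[OF 2 4]]) (simp add: eval_nat_numeral algebra_simps)
qed

abbreviation prof where "prof i \<sigma> x \<equiv> profile f2 f3 f4 f5 (b i) (c i) (d i) (a3 i) (a1 i) \<sigma> x"

abbreviation cubic where "cubic i \<sigma> x u \<equiv> \<sigma> ^ 3 * d2 i x u ^ 3 + 3 * \<sigma> ^ 4 * (d2 i x u ^ 2 * d3 i x u)"

text \<open>Second pass: E is expanded with error O(D^5), and D^3 is replaced by its two leading
  terms, which no longer contain \<kappa>.\<close>

lemma e0_expansion: assumes "i \<in> I"
  shows "bnd Q 5 6 (\<lambda>\<sigma> x u. e0 i \<sigma> x u - (prof i \<sigma> (x + u) - \<kappa> \<sigma> x - cubic i \<sigma> x u / 12))"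
proof (rule bnd_union[where P = "\<lambda>\<sigma> x u. \<sigma> * \<bar>x + u\<bar> < r"])
  have 1: "bnd Qin 5 6 (\<lambda>\<sigma> x u. e0 i \<sigma> x u - E (D i \<sigma> x u) / gs 0)"
    by (rule bnd_weaken[OF e0_in[OF assms]]) auto
  have "bnd Qin 5 5 (\<lambda>\<sigma> x u. E (D i \<sigma> x u) - gs 0 * (D i \<sigma> x u - D i \<sigma> x u ^ 3 / 12))"
  proof (rule bnd_le)
    show "bnd Qin 5 5 (\<lambda>\<sigma> x u. D i \<sigma> x u ^ 5)" by (rule bnd_powerI[OF D_bnd[OF assms]]) auto
  qed (use E_taylor5 in \<open>simp add: power_abs\<close>)
  from bnd_divc[OF bnd_weaken[OF this], of 5 6 "gs 0"]
  have 2: "bnd Qin 5 6 (\<lambda>\<sigma> x u. E (D i \<sigma> x u) / gs 0 - (D i \<sigma> x u - D i \<sigma> x u ^ 3 / 12))"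
    by (simp add: diff_divide_distrib gs0)
  have 3: "bnd Qin 5 6 (\<lambda>\<sigma> x u. k i \<sigma> (x + u) - prof i \<sigma> (x + u))" by (rule k_expn[OF assms])
  have 4: "bnd Qin 5 6 (\<lambda>\<sigma> x u. (D i \<sigma> x u ^ 3 - cubic i \<sigma> x u) / 12)"
    by (intro bnd_divc D_cube assms)
  show "bnd Qin 5 6 (\<lambda>\<sigma> x u. e0 i \<sigma> x u - (prof i \<sigma> (x + u) - \<kappa> \<sigma> x - cubic i \<sigma> x u / 12))"
    by (rule bnd_cong[OF bnd_add[OF bnd_add[OF 1 2] bnd_diff[OF 3 4]]]) (simp add: D_def diff_divide_distrib)
  have 5: "bnd Qout 5 6 (\<lambda>\<sigma> x u. cubic i \<sigma> x u / 12)"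
  proof -
    have "bnd Qout 3 3 (\<lambda>\<sigma> x u. (\<sigma> * d2 i x u) ^ 3)" by (rule bnd_powerI[OF bnd_d(1)]) auto
    moreover have "bnd Qout 4 4 (\<lambda>\<sigma> x u. (\<sigma> * d2 i x u) ^ 2 * (\<sigma> ^ 2 * d3 i x u))"
      by (rule bnd_mult[OF bnd_powerI[OF bnd_d(1)] bnd_d(2)]) auto
    ultimately have "bnd Qout 5 6 (\<lambda>\<sigma> x u. (\<sigma> * d2 i x u) ^ 3 / 12 + 3 * ((\<sigma> * d2 i x u) ^ 2 * (\<sigma> ^ 2 * d3 i x u)) / 12)"
      by (intro bnd_add bnd_divc bnd_cmult; elim bnd_weaken[OF far[where m' = 5]]) auto
    then show ?thesis by (rule bnd_cong) (simp add: eval_nat_numeral algebra_simps)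
  qed
  have 6: "bnd Qout 5 6 (\<lambda>\<sigma> x u. prof i \<sigma> (x + u))"
    unfolding profile_split
    by (intro bnd_add bnd_weaken[OF far[OF bnd_p(1) refl, where n = 4]] bnd_weaken[OF far[OF bnd_p(2) refl, where n = 3]]
        bnd_weaken[OF far[OF bnd_p(3) refl, where n = 2]] bnd_weaken[OF far[OF bnd_p(4) refl, where n = 1]]) auto
  show "bnd Qout 5 6 (\<lambda>\<sigma> x u. e0 i \<sigma> x u - (prof i \<sigma> (x + u) - \<kappa> \<sigma> x - cubic i \<sigma> x u / 12))"
    by (intro bnd_diff 5 6 e0_out[OF assms] bnd_weaken[OF far[OF kappa_bnd_out refl, where n = 4]]) auto
qed

text \<open>Sorted by powers of \<open>u\<close>, the form in which the Gaussian moments apply.\<close>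

lemma e0_poly:
  "prof i \<sigma> (x + u) - y - cubic i \<sigma> x u / 12 =
     (prof i \<sigma> x - y - \<sigma> ^ 3 * f2 ^ 3 / 12 * dl i ^ 3 - \<sigma> ^ 4 * f2 ^ 2 * f3 / 4 * (dl i ^ 3 * x))
   + (\<sigma> * f2 * x + \<sigma> ^ 2 * f3 * (x ^ 2 / 2 + b i) + \<sigma> ^ 3 * (f4 * x ^ 3 / 6 + c i * x)
       + \<sigma> ^ 4 * (f5 * x ^ 4 / 24 + 3 * a3 i * x ^ 2 + a1 i)
       - \<sigma> ^ 3 * f2 ^ 3 / 12 * (3 * dl i ^ 2 * x) - \<sigma> ^ 4 * f2 ^ 2 * f3 / 4 * (dl i ^ 2 * (x ^ 2 / 2 + b i) + 2 * dl i ^ 2 * x ^ 2)) * u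
   + (\<sigma> * f2 / 2 + \<sigma> ^ 2 * f3 * x / 2 + \<sigma> ^ 3 * (f4 * x ^ 2 / 4 + c i / 2) + \<sigma> ^ 4 * (f5 * x ^ 3 / 12 + 3 * a3 i * x)
       - \<sigma> ^ 3 * f2 ^ 3 / 12 * (3 * dl i * x ^ 2 + 3 * dl i ^ 2 / 2)
       - \<sigma> ^ 4 * f2 ^ 2 * f3 / 4 * (dl i ^ 2 * (x / 2) + 2 * dl i * x * (x ^ 2 / 2 + b i) + (x ^ 2 + dl i) * (dl i * x))) * u ^ 2
   + (\<sigma> ^ 2 * f3 / 6 + \<sigma> ^ 3 * f4 * x / 6 + \<sigma> ^ 4 * (f5 * x ^ 2 / 12 + a3 i)
       - \<sigma> ^ 3 * f2 ^ 3 / 12 * (x ^ 3 + 3 * dl i * x)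
       - \<sigma> ^ 4 * f2 ^ 2 * f3 / 4 * (dl i ^ 2 / 6 + dl i * x ^ 2 + (x ^ 2 + dl i) * (x ^ 2 / 2 + b i) + dl i * x ^ 2)) * u ^ 3
   + (\<sigma> ^ 3 * f4 / 24 + \<sigma> ^ 4 * f5 * x / 24 - \<sigma> ^ 3 * f2 ^ 3 / 12 * (3 * x ^ 2 / 2 + 3 * dl i / 4)
       - \<sigma> ^ 4 * f2 ^ 2 * f3 / 4 * (dl i * x / 3 + (x ^ 2 + dl i) * (x / 2) + x * (x ^ 2 / 2 + b i) + dl i * x / 4)) * u ^ 4
   + (\<sigma> ^ 4 * f5 / 120 - \<sigma> ^ 3 * f2 ^ 3 / 12 * (3 * x / 4)
       - \<sigma> ^ 4 * f2 ^ 2 * f3 / 4 * ((x ^ 2 + dl i) / 6 + x ^ 2 / 2 + (x ^ 2 / 2 + b i) / 4)) * u ^ 5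
   + (- (\<sigma> ^ 3) * f2 ^ 3 / 96 - \<sigma> ^ 4 * f2 ^ 2 * f3 / 4 * (x / 6 + x / 8)) * u ^ 6
   + (- (\<sigma> ^ 4) * f2 ^ 2 * f3 / 96) * u ^ 7 + 0 * u ^ 8"
proof -
  have p: "prof i \<sigma> (x + u) = prof i \<sigma> x
     + (\<sigma> * f2 * x + \<sigma> ^ 2 * f3 * (x ^ 2 / 2 + b i) + \<sigma> ^ 3 * (f4 * x ^ 3 / 6 + c i * x)
       + \<sigma> ^ 4 * (f5 * x ^ 4 / 24 + 3 * a3 i * x ^ 2 + a1 i)) * u
     + (\<sigma> * f2 / 2 + \<sigma> ^ 2 * f3 * x / 2 + \<sigma> ^ 3 * (f4 * x ^ 2 / 4 + c i / 2) + \<sigma> ^ 4 * (f5 * x ^ 3 / 12 + 3 * a3 i * x)) * u ^ 2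
     + (\<sigma> ^ 2 * f3 / 6 + \<sigma> ^ 3 * f4 * x / 6 + \<sigma> ^ 4 * (f5 * x ^ 2 / 12 + a3 i)) * u ^ 3
     + (\<sigma> ^ 3 * f4 / 24 + \<sigma> ^ 4 * f5 * x / 24) * u ^ 4 + \<sigma> ^ 4 * f5 / 120 * u ^ 5"
    unfolding profile_def by (simp add: eval_nat_numeral field_simps)
  have q: "d2 i x u ^ 3 = f2 ^ 3 * (dl i ^ 3 + 3 * dl i ^ 2 * x * u + (3 * dl i * x ^ 2 + 3 * dl i ^ 2 / 2) * u ^ 2
      + (x ^ 3 + 3 * dl i * x) * u ^ 3 + (3 * x ^ 2 / 2 + 3 * dl i / 4) * u ^ 4 + 3 * x / 4 * u ^ 5 + u ^ 6 / 8)"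
    unfolding d2_def by (simp add: eval_nat_numeral field_simps)
  have s: "d2 i x u ^ 2 * d3 i x u = f2 ^ 2 * f3 * (dl i ^ 3 * x
      + (dl i ^ 2 * (x ^ 2 / 2 + b i) + 2 * dl i ^ 2 * x ^ 2) * u
      + (dl i ^ 2 * (x / 2) + 2 * dl i * x * (x ^ 2 / 2 + b i) + (x ^ 2 + dl i) * (dl i * x)) * u ^ 2
      + (dl i ^ 2 / 6 + dl i * x ^ 2 + (x ^ 2 + dl i) * (x ^ 2 / 2 + b i) + dl i * x ^ 2) * u ^ 3
      + (dl i * x / 3 + (x ^ 2 + dl i) * (x / 2) + x * (x ^ 2 / 2 + b i) + dl i * x / 4) * u ^ 4
      + ((x ^ 2 + dl i) / 6 + x ^ 2 / 2 + (x ^ 2 / 2 + b i) / 4) * u ^ 5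
      + (x / 6 + x / 8) * u ^ 6 + u ^ 7 / 24)"
    unfolding d2_def d3_def by (simp add: eval_nat_numeral field_simps)
  show ?thesis unfolding p q s by (simp add: field_simps)
qed

end

lemma has_bochner_integral_cong_value: "has_bochner_integral M g a \<Longrightarrow> a = b \<Longrightarrow> has_bochner_integral M g b"
  by simp

context stage_root
begin

text \<open>Gaussian means of the expanded integrand, sorted by powers of x. The linear part is heat
  flow: (x + u)^4/24 averages to x^4/24 + x^2/2 + 1/2 and c (x + u)^2/2 to c x^2/2 + c. The
  \<open>f2 ^ 3\<close> terms are -1/12 of the mean of \<open>d2\<close> cubed, whose constant term
  is 15 + 9 dl + 3 dl^2 + dl^3 and whose x^2 coefficient is 18 + 6 dl, both times
  \<open>f2 ^ 3\<close>.\<close>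

definition c' where "c' = (\<Sum>i\<in>I. w i * (f4 + c i - f2 ^ 3 * (3 + dl i)))"
definition d' where "d' = (\<Sum>i\<in>I. w i * (f4 / 2 + c i + d i - f2 ^ 3 * (15 + 9 * dl i + 3 * dl i ^ 2 + dl i ^ 3) / 12))"
definition a3' where "a3' = (\<Sum>i\<in>I. w i * (f5 / 6 + a3 i - f2 ^ 2 * f3 / 4 * (12 + 4 * dl i)))"
definition a1' where "a1' = (\<Sum>i\<in>I. w i * (f5 / 2 + 6 * a3 i + a1 i
    - f2 ^ 2 * f3 / 4 * (35 + 13 * dl i + 12 * b i + 3 * dl i ^ 2 + 4 * dl i * b i + dl i ^ 3)))"

lemma kappa_expansion: "bnd Q 5 6 (\<lambda>\<sigma> x u. \<kappa> \<sigma> x - profile f2 f3 f4 f5 b' c' d' a3' a1' \<sigma> x)"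
proof -
  let ?P = "\<lambda>i. profile f2 f3 f4 f5 (b i + 1) (f4 + c i - f2 ^ 3 * (3 + dl i))
    (f4 / 2 + c i + d i - f2 ^ 3 * (15 + 9 * dl i + 3 * dl i ^ 2 + dl i ^ 3) / 12)
    (f5 / 6 + a3 i - f2 ^ 2 * f3 / 4 * (12 + 4 * dl i))
    (f5 / 2 + 6 * a3 i + a1 i
    - f2 ^ 2 * f3 / 4 * (35 + 13 * dl i + 12 * b i + 3 * dl i ^ 2 + 4 * dl i * b i + dl i ^ 3))"
  define T where "T i \<sigma> x = ?P i \<sigma> x - \<kappa> \<sigma> x" for i \<sigma> x
  have 1: "bnd Q 5 6 (\<lambda>\<sigma> x u. (LINT u|lborel. gd 0 (- u) * e0 i \<sigma> x u) - T i \<sigma> x)" if "i \<in> I" for i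
  proof (rule integral_gd_of_bnd[OF e0_expansion[OF that]])
    fix \<sigma> x :: real assume "R \<sigma> x"
    show "integrable lborel (\<lambda>u. gd 0 (- u) * e0 i \<sigma> x u)" by (rule integrable_gd_e0[OF that \<open>R \<sigma> x\<close>])
    show "has_bochner_integral lborel (\<lambda>u. gd 0 (- u) * (prof i \<sigma> (x + u) - \<kappa> \<sigma> x - cubic i \<sigma> x u / 12)) (T i \<sigma> x)"
      by (rule has_bochner_integral_cong_value[OF gs_moments_poly(1)[OF e0_poly]])
         (simp add: T_def profile_def eval_nat_numeral field_simps)
  qed
  have "bnd Q 5 6 (\<lambda>\<sigma> x u. \<Sum>i\<in>I. w i * ((LINT u|lborel. gd 0 (- u) * e0 i \<sigma> x u) - T i \<sigma> x))"
    by (intro bnd_sum bnd_cmult 1)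
  then show ?thesis
  proof (rule bnd_cong)
    fix \<sigma> x u :: real assume "R \<sigma> x"
    have "(\<Sum>i\<in>I. w i * T i \<sigma> x) = profile f2 f3 f4 f5 b' c' d' a3' a1' \<sigma> x - \<kappa> \<sigma> x"
      unfolding T_def sum_weights_affine[OF sumw] sum_weights_profile[OF sumw] b'_def c'_def d'_def a3'_def a1'_def ..
    moreover have "(\<Sum>i\<in>I. w i * ((LINT u|lborel. gd 0 (- u) * e0 i \<sigma> x u) - T i \<sigma> x)) = 0 - (\<Sum>i\<in>I. w i * T i \<sigma> x)"
      using sum_integral_e0[OF \<open>R \<sigma> x\<close>, of 0] by (simp add: right_diff_distrib sum_subtractf)
    ultimately show "\<kappa> \<sigma> x - profile f2 f3 f4 f5 b' c' d' a3' a1' \<sigma> x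
        = (\<Sum>i\<in>I. w i * ((LINT u|lborel. gd 0 (- u) * e0 i \<sigma> x u) - T i \<sigma> x))"
      by simp
  qed
qed

lemma sum_dl: "(\<Sum>i\<in>I. w i * dl i) = - 1"
  unfolding dl_def sum_weights_affine[OF sumw] by (simp add: b'_def)

text \<open>The mean of \<open>dl\<close> is -1, which turns 3 + \<open>dl i\<close> into 2. This is
  the form that matches the recursions of \<open>beta4\<close> and \<open>beta5\<close>.\<close>

lemma c'_eq: "c' = f4 + (\<Sum>i\<in>I. w i * c i) - 2 * f2 ^ 3"
proof -
  have "c' = (\<Sum>i\<in>I. w i * ((f4 - 3 * f2 ^ 3) + c i) - f2 ^ 3 * (w i * dl i))"
    unfolding c'_def by (intro sum.cong refl) (simp add: algebra_simps)
  also have "\<dots> = (f4 - 3 * f2 ^ 3) + (\<Sum>i\<in>I. w i * c i) - f2 ^ 3 * (- 1)"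
    unfolding sum_subtractf sum_weights_affine[OF sumw] sum_distrib_left[symmetric] sum_dl ..
  finally show ?thesis by simp
qed

text \<open>Put dl i = b i - B - 1 with B the mean of b, and let S2, S3 be the means of its square
  and cube. On averaging, the terms 6 B cancel and 8 + 2 B^3 - 3 B S2 + S3 remains; division by 12
  produces the constants 2/3, 1/6, 1/4 and 1/12 in the recursion of \<open>beta3\<close>.\<close>

lemma d'_eq: "d' = f4 / 2 + (\<Sum>i\<in>I. w i * c i) + (\<Sum>i\<in>I. w i * d i)
   - f2 ^ 3 * (2 / 3 + 1 / 6 * (\<Sum>i\<in>I. w i * b i) ^ 3 - 1 / 4 * (\<Sum>i\<in>I. w i * b i) * (\<Sum>i\<in>I. w i * (b i)\<^sup>2)
        + 1 / 12 * (\<Sum>i\<in>I. w i * b i ^ 3))"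
proof -
  define B where "B = (\<Sum>i\<in>I. w i * b i)"
  have bB: "b' = B + 1" by (simp add: b'_def B_def)
  have p: "15 + 9 * dl i + 3 * dl i ^ 2 + dl i ^ 3
      = (8 - 6 * B - B ^ 3) + ((6 + 3 * B ^ 2) * b i - 3 * B * b i ^ 2 + b i ^ 3)" for i
    unfolding dl_def bB by (simp add: eval_nat_numeral algebra_simps)
  define S2 S3 where "S2 = (\<Sum>i\<in>I. w i * b i ^ 2)" and "S3 = (\<Sum>i\<in>I. w i * b i ^ 3)"
  have X: "(\<Sum>i\<in>I. w i * (15 + 9 * dl i + 3 * dl i ^ 2 + dl i ^ 3))
      = (8 - 6 * B - B ^ 3) + ((6 + 3 * B ^ 2) * B - 3 * B * (\<Sum>i\<in>I. w i * b i ^ 2) + (\<Sum>i\<in>I. w i * b i ^ 3))"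
    unfolding p sum_weights_affine[OF sumw] B_def
    by (simp add: distrib_left right_diff_distrib sum.distrib sum_subtractf sum_distrib_left mult.left_commute[of "w _"])
  have Y: "d' = f4 / 2 + (\<Sum>i\<in>I. w i * c i) + (\<Sum>i\<in>I. w i * d i)
      - f2 ^ 3 / 12 * (\<Sum>i\<in>I. w i * (15 + 9 * dl i + 3 * dl i ^ 2 + dl i ^ 3))"
  proof -
    have "d' = (\<Sum>i\<in>I. w i * (f4 / 2 + c i) + w i * d i - f2 ^ 3 / 12 * (w i * (15 + 9 * dl i + 3 * dl i ^ 2 + dl i ^ 3)))"
      unfolding d'_def by (intro sum.cong refl) (simp add: field_simps)
    then show ?thesis
      unfolding sum_subtractf sum.distrib sum_weights_affine[OF sumw] sum_distrib_left[symmetric] by simp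
  qed
  show ?thesis
    unfolding Y X B_def[symmetric] S2_def[symmetric] S3_def[symmetric] by (simp add: field_simps eval_nat_numeral)
qed

section \<open>The second derivative of the new interface at 0\<close>

abbreviation Q0 :: "real \<Rightarrow> real \<Rightarrow> real \<Rightarrow> bool" where "Q0 \<equiv> \<lambda>\<sigma> x u. R \<sigma> x \<and> x = 0"

lemma bnd_at_0: "bnd Q0 m l g \<Longrightarrow> bnd Q0 m 0 g"
  unfolding bnd_def by force

lemma integrable_gd_Wi: assumes "i \<in> I" "R \<sigma> x" shows "integrable lborel (\<lambda>u. gd j (- u) * (Wi l i \<sigma> x u / gs 0))"
  using integrable_divide[OF integrable_gd_W[OF assms(1) R_D(1)[OF assms(2)], of j l x "\<kappa> \<sigma> x"], of "gs 0"]
  by (simp add: Wi_def)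

lemma sum_integral_Wi_div:
  assumes "R \<sigma> x"
  shows "(\<Sum>i\<in>I. w i * (LINT u|lborel. gd j (- u) * (Wi l i \<sigma> x u / gs 0))) = V j l (\<phi> \<sigma>) x (\<kappa> \<sigma> x) / gs 0"
  unfolding sum_integral_Wi[OF assms, symmetric] sum_divide_distrib by simp

text \<open>Restricts a uniform expansion to x = 0, integrates it against the kernel and averages
  over i. The constant 1/2 inside \<open>e0\<close> is invisible to the kernels j = 1, 2, whose
  integral is 0.\<close>

lemma V_from_e0:
  assumes "\<And>i. i \<in> I \<Longrightarrow> bnd Q m l (\<lambda>\<sigma> x u. e0 i \<sigma> x u - p i \<sigma> x u)" and "j \<in> {1, 2}"
    and "\<And>i \<sigma>. i \<in> I \<Longrightarrow> R \<sigma> 0 \<Longrightarrow> has_bochner_integral lborel (\<lambda>u. gd j (- u) * p i \<sigma> 0 u) (T i \<sigma>)"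
  shows "bnd Q0 m 0 (\<lambda>\<sigma> x u. V j 0 (\<phi> \<sigma>) x (\<kappa> \<sigma> x) / gs 0 - (\<Sum>i\<in>I. w i * T i \<sigma>))"
proof -
  have 1: "bnd Q0 m l (\<lambda>\<sigma> x u. (LINT u|lborel. gd j (- u) * e0 i \<sigma> x u) - T i \<sigma>)" if "i \<in> I" for i
    by (rule integral_gd_of_bnd[OF assms(1)[OF that]]) (use assms(3)[OF that] integrable_gd_e0[OF that] in auto)
  have "bnd Q0 m 0 (\<lambda>\<sigma> x u. \<Sum>i\<in>I. w i * ((LINT u|lborel. gd j (- u) * e0 i \<sigma> x u) - T i \<sigma>))"
    by (rule bnd_at_0[where l = l], rule bnd_sum, rule bnd_cmult, erule 1)
  then show ?thesis
  proof (rule bnd_cong)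
    fix \<sigma> x u :: real assume "R \<sigma> x \<and> x = 0"
    then show "V j 0 (\<phi> \<sigma>) x (\<kappa> \<sigma> x) / gs 0 - (\<Sum>i\<in>I. w i * T i \<sigma>) = (\<Sum>i\<in>I. w i * ((LINT u|lborel. gd j (- u) * e0 i \<sigma> x u) - T i \<sigma>))"
      using sum_integral_e0[of \<sigma> x j] assms(2) by (auto simp: right_diff_distrib sum_subtractf)
  qed
qed

lemma V_from_Wi:
  assumes "\<And>i. i \<in> I \<Longrightarrow> bnd Q m l (\<lambda>\<sigma> x u. Wi n i \<sigma> x u / gs 0 - p i \<sigma> x u)"
    and "\<And>i \<sigma>. i \<in> I \<Longrightarrow> R \<sigma> 0 \<Longrightarrow> has_bochner_integral lborel (\<lambda>u. gd j (- u) * p i \<sigma> 0 u) (T i \<sigma>)"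
  shows "bnd Q0 m 0 (\<lambda>\<sigma> x u. V j n (\<phi> \<sigma>) x (\<kappa> \<sigma> x) / gs 0 - (\<Sum>i\<in>I. w i * T i \<sigma>))"
proof -
  have 1: "bnd Q0 m l (\<lambda>\<sigma> x u. (LINT u|lborel. gd j (- u) * (Wi n i \<sigma> x u / gs 0)) - T i \<sigma>)" if "i \<in> I" for i
    by (rule integral_gd_of_bnd[OF assms(1)[OF that]]) (use assms(2)[OF that] integrable_gd_Wi[OF that] in auto)
  have "bnd Q0 m 0 (\<lambda>\<sigma> x u. \<Sum>i\<in>I. w i * ((LINT u|lborel. gd j (- u) * (Wi n i \<sigma> x u / gs 0)) - T i \<sigma>))"
    by (rule bnd_at_0[where l = l], rule bnd_sum, rule bnd_cmult, erule 1)
  then show ?thesis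
  proof (rule bnd_cong)
    fix \<sigma> x u :: real assume "R \<sigma> x \<and> x = 0"
    then have "R \<sigma> x" by (rule conjunct1)
    show "V j n (\<phi> \<sigma>) x (\<kappa> \<sigma> x) / gs 0 - (\<Sum>i\<in>I. w i * T i \<sigma>) = (\<Sum>i\<in>I. w i * ((LINT u|lborel. gd j (- u) * (Wi n i \<sigma> x u / gs 0)) - T i \<sigma>))"
      by (simp only: right_diff_distrib sum_subtractf sum_integral_Wi_div[OF \<open>R \<sigma> x\<close>])
  qed
qed

text \<open>At x = 0 these are the coefficient of \<sigma>^3 in \<open>V 2 0\<close> and that of
  \<sigma>^2 in \<open>V 0 1\<close>, both divided by \<open>gs 0\<close>; the numbers are Gaussian
  moments of the derivatives of the expanded integrands.\<close>

definition \<alpha>3 where "\<alpha>3 = (\<Sum>i\<in>I. w i * (f4 + c i - f2 ^ 3 / 12 * (45 + 18 * dl i + 3 * dl i ^ 2)))"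
definition \<beta>2 where "\<beta>2 = (\<Sum>i\<in>I. w i * (f2 ^ 2 / 4 * (3 + 2 * dl i + dl i ^ 2)))"

lemma V_20: "bnd Q0 5 0 (\<lambda>\<sigma> x u. V 2 0 (\<phi> \<sigma>) x (\<kappa> \<sigma> x) / gs 0 - (\<sigma> * f2 + \<sigma> ^ 3 * \<alpha>3))"
proof -
  have "bnd Q0 5 0 (\<lambda>\<sigma> x u. V 2 0 (\<phi> \<sigma>) x (\<kappa> \<sigma> x) / gs 0
     - (\<Sum>i\<in>I. w i * (\<sigma> * f2 + \<sigma> ^ 3 * (f4 + c i - f2 ^ 3 / 12 * (45 + 18 * dl i + 3 * dl i ^ 2)))))"
  proof (rule V_from_e0[OF e0_expansion])
    fix i \<sigma>
    show "has_bochner_integral lborel (\<lambda>u. gd 2 (- u) * (prof i \<sigma> (0 + u) - \<kappa> \<sigma> 0 - cubic i \<sigma> 0 u / 12))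
        (\<sigma> * f2 + \<sigma> ^ 3 * (f4 + c i - f2 ^ 3 / 12 * (45 + 18 * dl i + 3 * dl i ^ 2)))"
      by (rule has_bochner_integral_cong_value[OF gs_moments_poly(3)[OF e0_poly]]) (simp add: field_simps)
  qed auto
  then show ?thesis
    by (rule bnd_cong) (simp add: \<alpha>3_def sum_weights_affine[OF sumw] sum_distrib_left mult.left_commute[of "w _"])
qed

text \<open>Parity: at x = 0 the term \<sigma> \<open>p2 i u\<close> - \<kappa> is even in u while
  \<open>gd 1\<close> is odd, so what remains is of order \<sigma>^2.\<close>

lemma V_10: "bnd Q0 2 0 (\<lambda>\<sigma> x u. V 1 0 (\<phi> \<sigma>) x (\<kappa> \<sigma> x) / gs 0)"
proof -
  have "bnd Q0 2 0 (\<lambda>\<sigma> x u. V 1 0 (\<phi> \<sigma>) x (\<kappa> \<sigma> x) / gs 0 - (\<Sum>i\<in>I. w i * 0))"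
  proof (rule V_from_e0[where l = 3])
    fix i assume "i \<in> I"
    have "bnd Q 2 3 (\<lambda>\<sigma> x u. (e0 i \<sigma> x u - (\<sigma> * p2 i (x + u) + \<sigma> ^ 2 * p3 i (x + u) - \<kappa> \<sigma> x)) + \<sigma> ^ 2 * p3 i (x + u))"
      by (intro bnd_add bnd_p bnd_weaken[OF e0_expansion_weak[OF \<open>i \<in> I\<close>]]) auto
    then show "bnd Q 2 3 (\<lambda>\<sigma> x u. e0 i \<sigma> x u - (\<sigma> * p2 i (x + u) - \<kappa> \<sigma> x))" by (rule bnd_cong) simp
    fix \<sigma>
    show "has_bochner_integral lborel (\<lambda>u. gd 1 (- u) * (\<sigma> * p2 i (0 + u) - \<kappa> \<sigma> 0)) 0"
      by (rule has_bochner_integral_cong_value[OF gs_moments_poly(2)[where ?q0.0 = "\<sigma> * f2 * b i - \<kappa> \<sigma> 0" and ?q1.0 = 0 and ?q2.0 = "\<sigma> * f2 / 2"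
            and ?q3.0 = 0 and ?q4.0 = 0 and ?q5.0 = 0 and ?q6.0 = 0 and ?q7.0 = 0 and ?q8.0 = 0]])
         (simp_all add: p2_def field_simps)
  qed auto
  then show ?thesis by simp
qed

text \<open>In the box \<open>Wi 1\<close> is -\<open>gs\<close> at D, and -\<open>gs\<close> at D
  divided by \<open>gs 0\<close> is -1 + D^2/4 + O(D^4); \<open>D_square\<close> then removes
  \<kappa> from D^2.\<close>

lemma W1_expansion: assumes "i \<in> I"
  shows "bnd Q 4 5 (\<lambda>\<sigma> x u. Wi 1 i \<sigma> x u / gs 0 - (- 1 + (\<sigma> ^ 2 * d2 i x u ^ 2 + 2 * \<sigma> ^ 3 * (d2 i x u * d3 i x u)) / 4))"
proof (rule bnd_union[where P = "\<lambda>\<sigma> x u. \<sigma> * \<bar>x + u\<bar> < r"])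
  have 1: "bnd Qin 4 5 (\<lambda>\<sigma> x u. (Wi 1 i \<sigma> x u - hl 1 (D i \<sigma> x u)) / gs 0)"
    by (rule bnd_weaken[OF bnd_divc[OF Wi_hl[OF assms]]]) auto
  have "bnd Qin 4 4 (\<lambda>\<sigma> x u. hl 1 (D i \<sigma> x u) + gs 0 * (1 - D i \<sigma> x u ^ 2 / 4))"
  proof (rule bnd_le)
    show "bnd Qin 4 4 (\<lambda>\<sigma> x u. D i \<sigma> x u ^ 4)" by (rule bnd_powerI[OF D_bnd[OF assms]]) auto
    show "\<bar>hl 1 (D i \<sigma> x u) + gs 0 * (1 - D i \<sigma> x u ^ 2 / 4)\<bar> \<le> \<bar>D i \<sigma> x u ^ 4\<bar>" for \<sigma> x u
      using gs_taylor4[of "D i \<sigma> x u"] unfolding hl_1 by (simp add: abs_minus_commute)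
  qed
  from bnd_divc[OF bnd_weaken[OF this], of 4 5 "gs 0"]
  have 2: "bnd Qin 4 5 (\<lambda>\<sigma> x u. (hl 1 (D i \<sigma> x u) + gs 0 * (1 - D i \<sigma> x u ^ 2 / 4)) / gs 0)" by simp
  have 3: "bnd Qin 4 5 (\<lambda>\<sigma> x u. (D i \<sigma> x u ^ 2 - (\<sigma> ^ 2 * d2 i x u ^ 2 + 2 * \<sigma> ^ 3 * (d2 i x u * d3 i x u))) / 4)"
    by (intro bnd_divc D_square assms)
  show "bnd Qin 4 5 (\<lambda>\<sigma> x u. Wi 1 i \<sigma> x u / gs 0 - (- 1 + (\<sigma> ^ 2 * d2 i x u ^ 2 + 2 * \<sigma> ^ 3 * (d2 i x u * d3 i x u)) / 4))"
  proof (rule bnd_cong[OF bnd_add[OF 1 bnd_add[OF 2 3]]])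
    fix \<sigma> x u
    have "(hl 1 (D i \<sigma> x u) + gs 0 * (1 - D i \<sigma> x u ^ 2 / 4)) / gs 0 = hl 1 (D i \<sigma> x u) / gs 0 + (1 - D i \<sigma> x u ^ 2 / 4)"
      using gs0 by (simp add: add_divide_distrib)
    then show "Wi 1 i \<sigma> x u / gs 0 - (- 1 + (\<sigma> ^ 2 * d2 i x u ^ 2 + 2 * \<sigma> ^ 3 * (d2 i x u * d3 i x u)) / 4) =
       (Wi 1 i \<sigma> x u - hl 1 (D i \<sigma> x u)) / gs 0 + ((hl 1 (D i \<sigma> x u) + gs 0 * (1 - D i \<sigma> x u ^ 2 / 4)) / gs 0
         + (D i \<sigma> x u ^ 2 - (\<sigma> ^ 2 * d2 i x u ^ 2 + 2 * \<sigma> ^ 3 * (d2 i x u * d3 i x u))) / 4)"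
      by (simp only: diff_divide_distrib)
  qed
  have 4: "bnd Qout 4 5 (\<lambda>\<sigma> x u. Wi 1 i \<sigma> x u / gs 0)"
    by (rule bnd_weaken[OF far[OF bnd_divc[OF bnd_subset[OF Wi_bnd[OF assms]]] refl, where n = 4]]) auto
  have 5: "bnd Qout 4 5 (\<lambda>\<sigma> x u. - 1)"
    by (rule bnd_weaken[OF far[OF bnd_const refl, where n = 4]]) auto
  have A: "bnd Qout 2 2 (\<lambda>\<sigma> x u. (\<sigma> * d2 i x u) ^ 2)" by (rule bnd_powerI[OF bnd_d(1)]) auto
  have B: "bnd Qout 3 3 (\<lambda>\<sigma> x u. (\<sigma> * d2 i x u) * (\<sigma> ^ 2 * d3 i x u))"
    by (rule bnd_mult[OF bnd_d(1) bnd_d(2)]) auto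
  have "bnd Qout 4 5 (\<lambda>\<sigma> x u. ((\<sigma> * d2 i x u) ^ 2 + 2 * ((\<sigma> * d2 i x u) * (\<sigma> ^ 2 * d3 i x u))) / 4)"
    by (intro bnd_add bnd_divc bnd_cmult bnd_weaken[OF far[OF A refl, where n = 2]]
        bnd_weaken[OF far[OF B refl, where n = 1]]) auto
  from bnd_diff[OF 4 bnd_add[OF 5 this]]
  show "bnd Qout 4 5 (\<lambda>\<sigma> x u. Wi 1 i \<sigma> x u / gs 0 - (- 1 + (\<sigma> ^ 2 * d2 i x u ^ 2 + 2 * \<sigma> ^ 3 * (d2 i x u * d3 i x u)) / 4))"
    by (rule bnd_cong) (simp add: eval_nat_numeral algebra_simps)
qed

lemma V_01: "bnd Q0 4 0 (\<lambda>\<sigma> x u. V 0 1 (\<phi> \<sigma>) x (\<kappa> \<sigma> x) / gs 0 - (- 1 + \<sigma> ^ 2 * \<beta>2))"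
proof -
  have "bnd Q0 4 0 (\<lambda>\<sigma> x u. V 0 1 (\<phi> \<sigma>) x (\<kappa> \<sigma> x) / gs 0
     - (\<Sum>i\<in>I. w i * (- 1 + \<sigma> ^ 2 * (f2 ^ 2 / 4 * (3 + 2 * dl i + dl i ^ 2)))))"
  proof (rule V_from_Wi[OF W1_expansion])
    fix i \<sigma>
    show "has_bochner_integral lborel (\<lambda>u. gd 0 (- u) * (- 1 + (\<sigma> ^ 2 * d2 i 0 u ^ 2 + 2 * \<sigma> ^ 3 * (d2 i 0 u * d3 i 0 u)) / 4))
        (- 1 + \<sigma> ^ 2 * (f2 ^ 2 / 4 * (3 + 2 * dl i + dl i ^ 2)))"
      by (rule has_bochner_integral_cong_value[OF gs_moments_poly(1)[where ?q0.0 = "- 1 + \<sigma> ^ 2 * f2 ^ 2 * dl i ^ 2 / 4" and ?q1.0 = "\<sigma> ^ 3 * f2 * f3 * dl i * b i / 2"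
            and ?q2.0 = "\<sigma> ^ 2 * f2 ^ 2 * dl i / 4"
            and ?q3.0 = "\<sigma> ^ 3 * f2 * f3 / 2 * (dl i / 6 + b i / 2)" and ?q4.0 = "\<sigma> ^ 2 * f2 ^ 2 / 16" and ?q5.0 = "\<sigma> ^ 3 * f2 * f3 / 24"
            and ?q6.0 = 0 and ?q7.0 = 0 and ?q8.0 = 0]])
         (simp_all add: d2_def d3_def eval_nat_numeral field_simps)
  qed
  then show ?thesis
    by (rule bnd_cong) (simp add: \<beta>2_def sum_weights_affine[OF sumw] sum_distrib_left mult.left_commute[of "w _"])
qed

text \<open>Parity again: \<open>d2 i 0 u\<close> is even in u, so the \<sigma>^2 term integrates to
  0 against \<open>gd 1\<close>, and the product of \<open>d2\<close> and \<open>d3\<close> enters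
  at \<sigma>^3.\<close>

lemma V_11: "bnd Q0 3 0 (\<lambda>\<sigma> x u. V 1 1 (\<phi> \<sigma>) x (\<kappa> \<sigma> x) / gs 0)"
proof -
  have "bnd Q0 3 0 (\<lambda>\<sigma> x u. V 1 1 (\<phi> \<sigma>) x (\<kappa> \<sigma> x) / gs 0 - (\<Sum>i\<in>I. w i * 0))"
  proof (rule V_from_Wi[where l = 4])
    fix i assume "i \<in> I"
    have "bnd Q 3 3 (\<lambda>\<sigma> x u. (\<sigma> * d2 i x u) * (\<sigma> ^ 2 * d3 i x u))"
      by (rule bnd_mult[OF bnd_d(1) bnd_d(2)]) auto
    then have "bnd Q 3 4 (\<lambda>\<sigma> x u. (Wi 1 i \<sigma> x u / gs 0 - (- 1 + (\<sigma> ^ 2 * d2 i x u ^ 2 + 2 * \<sigma> ^ 3 * (d2 i x u * d3 i x u)) / 4))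
        + ((\<sigma> * d2 i x u) * (\<sigma> ^ 2 * d3 i x u)) / 2)"
      by (intro bnd_add bnd_weaken[OF W1_expansion[OF \<open>i \<in> I\<close>]] bnd_divc) (auto elim: bnd_weaken)
    then show "bnd Q 3 4 (\<lambda>\<sigma> x u. Wi 1 i \<sigma> x u / gs 0 - (- 1 + (\<sigma> ^ 2 * d2 i x u ^ 2) / 4))"
      by (rule bnd_cong) (simp add: eval_nat_numeral algebra_simps)
    fix \<sigma>
    show "has_bochner_integral lborel (\<lambda>u. gd 1 (- u) * (- 1 + (\<sigma> ^ 2 * d2 i 0 u ^ 2) / 4)) 0"
      by (rule has_bochner_integral_cong_value[OF gs_moments_poly(2)[where ?q0.0 = "- 1 + \<sigma> ^ 2 * f2 ^ 2 * dl i ^ 2 / 4" and ?q1.0 = 0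
            and ?q2.0 = "\<sigma> ^ 2 * f2 ^ 2 * dl i / 4"
            and ?q3.0 = 0 and ?q4.0 = "\<sigma> ^ 2 * f2 ^ 2 / 16" and ?q5.0 = 0 and ?q6.0 = 0 and ?q7.0 = 0 and ?q8.0 = 0]])
         (simp_all add: d2_def eval_nat_numeral field_simps)
  qed
  then show ?thesis by simp
qed

text \<open>In the box the vertical integral is \<open>gd 1\<close> at D, which is bounded by |D|
  and so of order \<sigma>.\<close>

lemma V_02: "bnd Q0 1 0 (\<lambda>\<sigma> x u. V 0 2 (\<phi> \<sigma>) x (\<kappa> \<sigma> x) / gs 0)"
proof -
  have "bnd Q0 1 0 (\<lambda>\<sigma> x u. V 0 2 (\<phi> \<sigma>) x (\<kappa> \<sigma> x) / gs 0 - (\<Sum>i\<in>I. w i * 0))"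
  proof (rule V_from_Wi[where l = 1 and p = "\<lambda>i \<sigma> x u. 0"])
    fix i assume i: "i \<in> I"
    have "bnd Q 1 1 (Wi 2 i)"
    proof (rule bnd_union[where P = "\<lambda>\<sigma> x u. \<sigma> * \<bar>x + u\<bar> < r"])
      have "bnd Qin 1 1 (\<lambda>\<sigma> x u. hl 2 (D i \<sigma> x u))"
        by (rule bnd_le[OF D_bnd[OF i]]) (simp only: hl_2 gd_1_le)
      from bnd_add[OF bnd_weaken[OF Wi_hl[OF i, of 2], of 1 1] this]
      show "bnd Qin 1 1 (Wi 2 i)" by simp
      show "bnd Qout 1 1 (Wi 2 i)"
        by (rule bnd_weaken[OF far[OF bnd_subset[OF Wi_bnd[OF i]] refl, where n = 1]]) auto
    qed
    then show "bnd Q 1 1 (\<lambda>\<sigma> x u. Wi 2 i \<sigma> x u / gs 0 - 0)" using bnd_divc by simp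
  qed (simp add: has_bochner_integral_zero)
  then show ?thesis by simp
qed

definition \<kappa>1 where "\<kappa>1 \<sigma> x = - V 1 0 (\<phi> \<sigma>) x (\<kappa> \<sigma> x) / V 0 1 (\<phi> \<sigma>) x (\<kappa> \<sigma> x)"

definition \<kappa>2 where "\<kappa>2 \<sigma> x = - (V 2 0 (\<phi> \<sigma>) x (\<kappa> \<sigma> x) + 2 * V 1 1 (\<phi> \<sigma>) x (\<kappa> \<sigma> x) * \<kappa>1 \<sigma> x
    + V 0 2 (\<phi> \<sigma>) x (\<kappa> \<sigma> x) * \<kappa>1 \<sigma> x ^ 2) / V 0 1 (\<phi> \<sigma>) x (\<kappa> \<sigma> x)"

lemma slope_neg: "R \<sigma> x \<Longrightarrow> V 0 1 (\<phi> \<sigma>) x (\<kappa> \<sigma> x) \<le> - c_tilt / 2"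
  using R_D(6) by (simp add: good_root_def)

lemma inverse_slope_bnd: "bnd Q 0 0 (\<lambda>\<sigma> x u. gs 0 / V 0 1 (\<phi> \<sigma>) x (\<kappa> \<sigma> x))"
proof (rule bndI[of "2 * gs 0 / c_tilt" _ _ _ _ 0])
  fix \<sigma> x u :: real assume "R \<sigma> x"
  from slope_neg[OF this] c_tilt_pos have "c_tilt / 2 \<le> \<bar>V 0 1 (\<phi> \<sigma>) x (\<kappa> \<sigma> x)\<bar>" by linarith
  then have "gs 0 / \<bar>V 0 1 (\<phi> \<sigma>) x (\<kappa> \<sigma> x)\<bar> \<le> gs 0 / (c_tilt / 2)"
    using c_tilt_pos gs_pos[of 0] by (intro divide_left_mono mult_pos_pos) auto
  then show "\<bar>gs 0 / V 0 1 (\<phi> \<sigma>) x (\<kappa> \<sigma> x)\<bar> \<le> 2 * gs 0 / c_tilt * \<sigma> ^ 0 * (1 + \<bar>x\<bar>) ^ 0 * (1 + \<bar>u\<bar>) ^ 0"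
    using gs_pos[of 0] by (simp add: abs_divide mult.commute)
qed (use c_tilt_pos gs_pos[of 0] in auto)

text \<open>The \<sigma>^3 balance of \<open>V 2 0\<close> + \<open>V 0 1\<close> (\<sigma> f2 +
  \<sigma>^3 c') = 0. It shows that implicit differentiation returns the second x-derivative of the
  profile at 0, as if the expansion of \<kappa> could be differentiated term by term.\<close>

lemma coefficient_identity: "\<alpha>3 + \<beta>2 * f2 = c'"
proof -
  have "\<alpha>3 + \<beta>2 * f2 = (\<Sum>i\<in>I. w i * (f4 + c i - f2 ^ 3 / 12 * (45 + 18 * dl i + 3 * dl i ^ 2))
       + w i * (f2 ^ 2 / 4 * (3 + 2 * dl i + dl i ^ 2)) * f2)"
    by (simp add: \<alpha>3_def \<beta>2_def sum.distrib sum_distrib_right)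
  also have "\<dots> = (\<Sum>i\<in>I. w i * ((f4 - 3 * f2 ^ 3) + c i) - f2 ^ 3 * (w i * dl i))"
    by (intro sum.cong refl) (simp add: eval_nat_numeral field_simps)
  also have "\<dots> = (f4 - 3 * f2 ^ 3) + (\<Sum>i\<in>I. w i * c i) - f2 ^ 3 * (- 1)"
    unfolding sum_subtractf sum_weights_affine[OF sumw] sum_distrib_left[symmetric] sum_dl ..
  finally show ?thesis by (simp add: c'_eq)
qed

lemma second_derivative_bnd: "bnd Q0 5 0 (\<lambda>\<sigma> x u. \<kappa>2 \<sigma> x - (\<sigma> * f2 + \<sigma> ^ 3 * c'))"
proof -
  let ?s = "\<lambda>\<sigma> x. gs 0 / V 0 1 (\<phi> \<sigma>) x (\<kappa> \<sigma> x)"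
  let ?v = "\<lambda>j l \<sigma> x. V j l (\<phi> \<sigma>) x (\<kappa> \<sigma> x) / gs 0"
  have s: "bnd Q0 0 0 (\<lambda>\<sigma> x u. ?s \<sigma> x)" by (rule bnd_subset[OF inverse_slope_bnd]) auto
  have k1: "bnd Q0 2 0 (\<lambda>\<sigma> x u. \<kappa>1 \<sigma> x)"
    by (rule bnd_cong[OF bnd_minus[OF bnd_mult[OF V_10 s]]]) (use gs0 in \<open>auto simp: \<kappa>1_def\<close>)
  have t: "bnd Q0 1 0 (\<lambda>\<sigma> x u. \<sigma> * f2 + \<sigma> ^ 3 * c')"
  proof (rule bnd_add)
    show "bnd Q0 1 0 (\<lambda>\<sigma> x u. \<sigma> * f2)" by (rule bnd_sigma1_mult[OF bnd_const]) simp
    show "bnd Q0 1 0 (\<lambda>\<sigma> x u. \<sigma> ^ 3 * c')" by (rule bnd_weaken[OF bnd_sigma_mult[OF bnd_const refl]]) auto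
  qed
  have 1: "bnd Q0 5 0 (\<lambda>\<sigma> x u. (?v 0 1 \<sigma> x - (- 1 + \<sigma> ^ 2 * \<beta>2)) * (\<sigma> * f2 + \<sigma> ^ 3 * c'))"
    by (rule bnd_mult[OF V_01 t]) auto
  have 2: "bnd Q0 5 0 (\<lambda>\<sigma> x u. 2 * (?v 1 1 \<sigma> x * \<kappa>1 \<sigma> x))"
    by (intro bnd_cmult bnd_mult[OF V_11 k1]) auto
  have 3: "bnd Q0 5 0 (\<lambda>\<sigma> x u. ?v 0 2 \<sigma> x * \<kappa>1 \<sigma> x ^ 2)"
    by (rule bnd_mult[OF V_02 bnd_powerI[OF k1, where n = 2]]) auto
  have 4: "bnd Q0 5 0 (\<lambda>\<sigma> x u. \<sigma> ^ 5 * (\<beta>2 * c'))"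
    by (intro bnd_sigma_mult[OF bnd_const]) auto
  \<comment> \<open>Up to sign and the factor \<open>gs 0\<close>, the numerator of \<kappa>2 -
    (\<sigma> f2 + \<sigma>^3 c') over \<open>V 0 1\<close>. Every summand has order 5: the
    \<open>V 2 0\<close> remainder directly, 4 + 1 for the slope, 3 + 2 and 1 + 4 for the terms with
    \<kappa>1, and the last term of the product with the slope.\<close>
  let ?N = "\<lambda>\<sigma> x. (?v 2 0 \<sigma> x - (\<sigma> * f2 + \<sigma> ^ 3 * \<alpha>3)) + (?v 0 1 \<sigma> x - (- 1 + \<sigma> ^ 2 * \<beta>2)) * (\<sigma> * f2 + \<sigma> ^ 3 * c')
    + (2 * (?v 1 1 \<sigma> x * \<kappa>1 \<sigma> x) + ?v 0 2 \<sigma> x * \<kappa>1 \<sigma> x ^ 2) + \<sigma> ^ 5 * (\<beta>2 * c')"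
  have N: "bnd Q0 5 0 (\<lambda>\<sigma> x u. ?N \<sigma> x)"
    by (intro bnd_add V_20 1 2 3 4)
  have "bnd Q0 5 0 (\<lambda>\<sigma> x u. - (?s \<sigma> x * ?N \<sigma> x))"
    by (intro bnd_minus bnd_mult[OF s N]) auto
  then show ?thesis
  proof (rule bnd_cong)
    fix \<sigma> x u :: real assume "R \<sigma> x \<and> x = 0"
    then have nz: "V 0 1 (\<phi> \<sigma>) x (\<kappa> \<sigma> x) \<noteq> 0" using slope_neg[of \<sigma> x] c_tilt_pos by auto
    have alg: "(a + v * t) / v = - (- a / v) + t" if "v \<noteq> 0" for a v t :: real
      using that by (simp add: add_divide_distrib)
    have N_eq: "?N \<sigma> x = ?v 2 0 \<sigma> x + 2 * (?v 1 1 \<sigma> x * \<kappa>1 \<sigma> x) + ?v 0 2 \<sigma> x * \<kappa>1 \<sigma> x ^ 2 + ?v 0 1 \<sigma> x * (\<sigma> * f2 + \<sigma> ^ 3 * c')"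
      unfolding coefficient_identity[symmetric] by (simp add: eval_nat_numeral algebra_simps)
    have "gs 0 * ?N \<sigma> x = V 2 0 (\<phi> \<sigma>) x (\<kappa> \<sigma> x) + 2 * V 1 1 (\<phi> \<sigma>) x (\<kappa> \<sigma> x) * \<kappa>1 \<sigma> x + V 0 2 (\<phi> \<sigma>) x (\<kappa> \<sigma> x) * \<kappa>1 \<sigma> x ^ 2
        + V 0 1 (\<phi> \<sigma>) x (\<kappa> \<sigma> x) * (\<sigma> * f2 + \<sigma> ^ 3 * c')"
      unfolding N_eq using gs0 by (simp add: distrib_left)
    then have "?s \<sigma> x * ?N \<sigma> x = (V 2 0 (\<phi> \<sigma>) x (\<kappa> \<sigma> x) + 2 * V 1 1 (\<phi> \<sigma>) x (\<kappa> \<sigma> x) * \<kappa>1 \<sigma> x + V 0 2 (\<phi> \<sigma>) x (\<kappa> \<sigma> x) * \<kappa>1 \<sigma> x ^ 2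
        + V 0 1 (\<phi> \<sigma>) x (\<kappa> \<sigma> x) * (\<sigma> * f2 + \<sigma> ^ 3 * c')) / V 0 1 (\<phi> \<sigma>) x (\<kappa> \<sigma> x)"
      by (simp only: times_divide_eq_left)
    also have "\<dots> = - \<kappa>2 \<sigma> x + (\<sigma> * f2 + \<sigma> ^ 3 * c')"
      unfolding \<kappa>2_def by (rule alg[OF nz])
    finally show "\<kappa>2 \<sigma> x - (\<sigma> * f2 + \<sigma> ^ 3 * c') = - (?s \<sigma> x * ?N \<sigma> x)" by linarith
  qed
qed

lemma kappa_deriv:
  assumes "R \<sigma> x0"
  shows "(\<kappa> \<sigma> has_real_derivative \<kappa>1 \<sigma> x0) (at x0)"
proof -
  note H = R_D[OF assms]
  have m: "\<phi> \<sigma> \<in> borel_measurable borel" by (rule phi_measurable[OF H(1)])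
  \<comment> \<open>The square of this radius about the point of the graph stays in the half box,
    where the root is known to separate each column.\<close>
  define \<delta> where "\<delta> = min (r / 2 - \<sigma> * \<bar>x0\<bar>) (r / 2 - \<sigma> * \<bar>\<kappa> \<sigma> x0\<bar>) / \<sigma>"
  have \<delta>: "\<delta> > 0" using H by (simp add: \<delta>_def)
  have near_x: "R \<sigma> x" if "\<bar>x - x0\<bar> < \<delta>" for x
  proof -
    have "\<sigma> * \<bar>x - x0\<bar> < \<sigma> * \<delta>" using that H(1) by simp
    also have "\<dots> \<le> r / 2 - \<sigma> * \<bar>x0\<bar>" using H(1) by (simp add: \<delta>_def)
    finally have "\<sigma> * (\<bar>x - x0\<bar> + \<bar>x0\<bar>) < r / 2" by (simp add: distrib_left)
    moreover have "\<sigma> * \<bar>x\<bar> \<le> \<sigma> * (\<bar>x - x0\<bar> + \<bar>x0\<bar>)" using H(1) by (intro mult_left_mono) auto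
    ultimately have "\<sigma> * \<bar>x\<bar> < r / 2" by linarith
    then show ?thesis using H by (simp add: R_def)
  qed
  have near_y: "\<sigma> * \<bar>y\<bar> < r / 2" if "\<bar>y - \<kappa> \<sigma> x0\<bar> < \<delta>" for y
  proof -
    have "\<sigma> * \<bar>y - \<kappa> \<sigma> x0\<bar> < \<sigma> * \<delta>" using that H(1) by simp
    also have "\<dots> \<le> r / 2 - \<sigma> * \<bar>\<kappa> \<sigma> x0\<bar>" using H(1) by (simp add: \<delta>_def)
    finally have "\<sigma> * (\<bar>y - \<kappa> \<sigma> x0\<bar> + \<bar>\<kappa> \<sigma> x0\<bar>) < r / 2" by (simp add: distrib_left)
    moreover have "\<sigma> * \<bar>y\<bar> \<le> \<sigma> * (\<bar>y - \<kappa> \<sigma> x0\<bar> + \<bar>\<kappa> \<sigma> x0\<bar>)" using H(1) by (intro mult_left_mono) auto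
    ultimately show ?thesis by linarith
  qed
  show ?thesis unfolding \<kappa>1_def
  proof (rule implicit_function_deriv[where F = "\<lambda>x y. V 0 0 (\<phi> \<sigma>) x y - 1 / 2" and Fx = "V 1 0 (\<phi> \<sigma>)" and Fy = "V 0 1 (\<phi> \<sigma>)" and \<delta> = \<delta>])
    show "((\<lambda>x. V 0 0 (\<phi> \<sigma>) x y - 1 / 2) has_real_derivative V 1 0 (\<phi> \<sigma>) x y) (at x)" for x y
      using DERIV_diff[OF V_deriv_x[OF m phi_bound, of 0 0 y x] DERIV_const[of "1/2"]] by simp
    show "((\<lambda>y. V 0 0 (\<phi> \<sigma>) x y - 1 / 2) has_real_derivative V 0 1 (\<phi> \<sigma>) x y) (at y)" for x y
      using DERIV_diff[OF V_deriv_y[OF m phi_bound, of 0 0 x y] DERIV_const[of "1/2"]] by simp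
    show "V 0 1 (\<phi> \<sigma>) x0 (\<kappa> \<sigma> x0) < 0" using slope_neg[OF assms] c_tilt_pos by linarith
    show "0 \<le> V 0 0 (\<phi> \<sigma>) x y - 1 / 2 \<longleftrightarrow> y \<le> \<kappa> \<sigma> x" if "\<bar>x - x0\<bar> < \<delta>" "\<bar>y - \<kappa> \<sigma> x0\<bar> < \<delta>" for x y
      using R_D(6)[OF near_x[OF that(1)]] near_y[OF that(2)] by (simp add: good_root_def)
    show "V 0 0 (\<phi> \<sigma>) x (\<kappa> \<sigma> x) - 1 / 2 = 0" if "\<bar>x - x0\<bar> < \<delta>" for x
      using R_D(6)[OF near_x[OF that(1)]] by (simp add: good_root_def)
  qed (use continuous_V[OF m phi_bound] \<delta> in auto)
qed

lemma kappa_second_deriv: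
  assumes "R \<sigma> 0"
  shows "(deriv (\<kappa> \<sigma>) has_real_derivative \<kappa>2 \<sigma> 0) (at 0)"
proof -
  note H = R_D[OF assms]
  have m: "\<phi> \<sigma> \<in> borel_measurable borel" by (rule phi_measurable[OF H(1)])
  have nz: "V 0 1 (\<phi> \<sigma>) 0 (\<kappa> \<sigma> 0) \<noteq> 0" using slope_neg[OF assms] c_tilt_pos by auto
  have ch: "((\<lambda>x. V j l (\<phi> \<sigma>) x (\<kappa> \<sigma> x)) has_real_derivative
      V (Suc j) l (\<phi> \<sigma>) 0 (\<kappa> \<sigma> 0) + V j (Suc l) (\<phi> \<sigma>) 0 (\<kappa> \<sigma> 0) * \<kappa>1 \<sigma> 0) (at 0)" for j l
    by (rule partials_chain_deriv[where F = "V j l (\<phi> \<sigma>)" and Fx = "V (Suc j) l (\<phi> \<sigma>)" and Fy = "V j (Suc l) (\<phi> \<sigma>)"])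
       (rule V_deriv_x[OF m phi_bound] V_deriv_y[OF m phi_bound] continuous_V[OF m phi_bound] kappa_deriv[OF assms])+
  have k1: "V 1 0 (\<phi> \<sigma>) 0 (\<kappa> \<sigma> 0) = - \<kappa>1 \<sigma> 0 * V 0 1 (\<phi> \<sigma>) 0 (\<kappa> \<sigma> 0)"
    using nz by (simp add: \<kappa>1_def)
  \<comment> \<open>The quotient rule for -\<open>V 1 0\<close> / \<open>V 0 1\<close> along the
    graph, with \<open>V 1 0\<close> eliminated by the definition of \<kappa>1.\<close>
  have alg: "(- (v20 + v11 * k) * v01 - - v10 * (v11 + v02 * k)) / (v01 * v01) = - (v20 + 2 * v11 * k + v02 * k ^ 2) / v01"
    if "v10 = - k * v01" "v01 \<noteq> 0" for v20 v11 k v01 v10 v02 :: real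
    using that(2) unfolding that(1) by (simp add: divide_simps power2_eq_square) (simp add: algebra_simps)
  have "((\<lambda>x. - V 1 0 (\<phi> \<sigma>) x (\<kappa> \<sigma> x) / V 0 1 (\<phi> \<sigma>) x (\<kappa> \<sigma> x)) has_real_derivative \<kappa>2 \<sigma> 0) (at 0)"
    using DERIV_divide[OF DERIV_minus[OF ch[of 1 0]] ch[of 0 1] nz] alg[OF k1 nz]
    unfolding \<kappa>2_def by (simp add: numeral_2_eq_2)
  then have d: "(\<kappa>1 \<sigma> has_real_derivative \<kappa>2 \<sigma> 0) (at 0)" by (simp add: \<kappa>1_def[abs_def])
  have "r / (2 * \<sigma>) > 0" using H(1) r by simp
  then have "\<forall>\<^sub>F x in nhds 0. \<bar>x\<bar> < r / (2 * \<sigma>)"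
    by (auto simp: eventually_nhds_metric dist_real_def intro!: exI[of _ "r / (2 * \<sigma>)"])
  then have "\<forall>\<^sub>F x in nhds 0. deriv (\<kappa> \<sigma>) x = \<kappa>1 \<sigma> x"
  proof eventually_elim
    case (elim x)
    then have "R \<sigma> x" using H by (simp add: R_def field_simps)
    then show ?case by (intro DERIV_imp_deriv kappa_deriv)
  qed
  then show ?thesis using d DERIV_cong_ev[OF refl _ refl] by blast
qed

end

text \<open>Packages one step for the induction: the new boundary satisfies the same kind of
  estimates in a box of half the size, and b', c', d' are written so as to match the beta
  recursions.\<close>

lemma (in stage_data) stage_step:
  assumes expn: "\<And>i \<sigma> x. i \<in> I \<Longrightarrow> 0 < \<sigma> \<Longrightarrow> \<sigma> < \<sigma>0 \<Longrightarrow> \<sigma> * \<bar>x\<bar> < r \<Longrightarrow>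
        \<bar>k i \<sigma> x - profile f2 f3 f4 f5 (b i) (c i) (d i) (a3 i) (a1 i) \<sigma> x\<bar> \<le> C * \<sigma> ^ 5 * (1 + \<bar>x\<bar>) ^ 6"
  defines "b' \<equiv> (\<Sum>i\<in>I. w i * b i) + 1" and "c' \<equiv> f4 + (\<Sum>i\<in>I. w i * c i) - 2 * f2 ^ 3"
    and "d' \<equiv> f4 / 2 + (\<Sum>i\<in>I. w i * c i) + (\<Sum>i\<in>I. w i * d i)
      - f2 ^ 3 * (2 / 3 + 1 / 6 * (\<Sum>i\<in>I. w i * b i) ^ 3 - 1 / 4 * (\<Sum>i\<in>I. w i * b i) * (\<Sum>i\<in>I. w i * (b i)\<^sup>2)
        + 1 / 12 * (\<Sum>i\<in>I. w i * b i ^ 3))"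
  obtains \<sigma>1 K \<kappa> a3' a1' where "0 < \<sigma>1" "\<sigma>1 \<le> \<sigma>0" "K \<ge> 0"
    "\<And>\<sigma> x y. 0 < \<sigma> \<Longrightarrow> \<sigma> < \<sigma>1 \<Longrightarrow> \<sigma> * \<bar>x\<bar> < r / 2 \<Longrightarrow> \<sigma> * \<bar>y\<bar> < r / 2 \<Longrightarrow>
       conv (gauss 1) (\<phi> \<sigma>) (x, y) \<ge> 1 / 2 \<longleftrightarrow> y \<le> \<kappa> \<sigma> x"
    "\<And>\<sigma> x. 0 < \<sigma> \<Longrightarrow> \<sigma> < \<sigma>1 \<Longrightarrow> \<sigma> * \<bar>x\<bar> < r / 2 \<Longrightarrow> \<bar>\<kappa> \<sigma> x - f (\<sigma> * x) / \<sigma>\<bar> \<le> K * \<sigma>"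
    "\<And>\<sigma> x. 0 < \<sigma> \<Longrightarrow> \<sigma> < \<sigma>1 \<Longrightarrow> \<sigma> * \<bar>x\<bar> < r / 2 \<Longrightarrow>
       \<bar>\<kappa> \<sigma> x - profile f2 f3 f4 f5 b' c' d' a3' a1' \<sigma> x\<bar> \<le> K * \<sigma> ^ 5 * (1 + \<bar>x\<bar>) ^ 6"
    "\<And>\<sigma> x. 0 < \<sigma> \<Longrightarrow> \<sigma> < \<sigma>1 \<Longrightarrow> \<sigma> * \<bar>x\<bar> < r / 2 \<Longrightarrow> \<kappa> \<sigma> differentiable (at x)"
    "\<And>\<sigma>. 0 < \<sigma> \<Longrightarrow> \<sigma> < \<sigma>1 \<Longrightarrow> \<exists>D. (deriv (\<kappa> \<sigma>) has_real_derivative D) (at 0) \<and> \<bar>D - (\<sigma> * f2 + \<sigma> ^ 3 * c')\<bar> \<le> K * \<sigma> ^ 5"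
proof -
  obtain K0 \<sigma>1 where K0: "K0 \<ge> 0" "0 < \<sigma>1" "\<sigma>1 \<le> \<sigma>0"
    "\<And>\<sigma> x. 0 < \<sigma> \<Longrightarrow> \<sigma> < \<sigma>1 \<Longrightarrow> \<sigma> * \<bar>x\<bar> < r / 2 \<Longrightarrow> \<exists>y. good_root K0 \<sigma> x y"
    by (rule root_exists) blast
  \<comment> \<open>Outside the range of \<open>root_exists\<close> the value is arbitrary; all
    assertions stay inside it.\<close>
  define \<kappa> where "\<kappa> \<sigma> x = (SOME y. good_root K0 \<sigma> x y)" for \<sigma> x
  interpret S: stage_root I w A k f f' r C \<sigma>0 f2 f3 f4 f5 b c d a3 a1 K0 \<sigma>1 \<kappa>
    by unfold_locales (use expn K0 someI_ex[OF K0(4)] in \<open>auto simp: \<kappa>_def\<close>)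
  have b': "b' = S.b'" and c': "c' = S.c'" and d': "d' = S.d'"
    by (simp_all add: b'_def c'_def d'_def S.b'_def S.c'_eq S.d'_eq)
  have small: "\<sigma> \<le> 1" "\<sigma> * (1 + \<bar>x\<bar>) \<le> 2" if "S.R \<sigma> x" for \<sigma> x
    using S.R_D[OF that] s0 r by (auto simp: distrib_left)
  obtain K1 n1 where K1: "K1 \<ge> 0" "\<And>\<sigma> x u. S.R \<sigma> x \<Longrightarrow> \<bar>\<kappa> \<sigma> x - profile f2 f3 f4 f5 b' c' d' S.a3' S.a1' \<sigma> x\<bar>
      \<le> K1 * \<sigma> ^ 5 * (1 + \<bar>x\<bar>) ^ 6 * (1 + \<bar>u\<bar>) ^ n1"
    using S.kappa_expansion small S.R_D(1) unfolding bnd_def b' c' d' by blast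
  obtain K2 n2 where K2: "K2 \<ge> 0" "\<And>\<sigma> x u. S.R \<sigma> x \<and> x = 0 \<Longrightarrow> \<bar>S.\<kappa>2 \<sigma> x - (\<sigma> * f2 + \<sigma> ^ 3 * c')\<bar>
      \<le> K2 * \<sigma> ^ 5 * (1 + \<bar>x\<bar>) ^ 0 * (1 + \<bar>u\<bar>) ^ n2"
    using S.second_derivative_bnd small S.R_D(1) unfolding bnd_def c' by blast
  have Rx: "S.R \<sigma> x" if "0 < \<sigma>" "\<sigma> < \<sigma>1" "\<sigma> * \<bar>x\<bar> < r / 2" for \<sigma> x using that by (simp add: S.R_def)
  define K where "K = K0 + K1 + K2"
  have K: "K \<ge> 0" "K0 \<le> K" "K1 \<le> K" "K2 \<le> K" using K0(1) K1(1) K2(1) by (auto simp: K_def)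
  show thesis
  proof (rule that[of \<sigma>1 K \<kappa> S.a3' S.a1'])
    fix \<sigma> x y :: real assume H: "0 < \<sigma>" "\<sigma> < \<sigma>1" "\<sigma> * \<bar>x\<bar> < r / 2" "\<sigma> * \<bar>y\<bar> < r / 2"
    show "1 / 2 \<le> conv (gauss 1) (\<phi> \<sigma>) (x, y) \<longleftrightarrow> y \<le> \<kappa> \<sigma> x"
      using S.R_D(6)[OF Rx[OF H(1-3)]] H(4) unfolding conv_gauss_eq_V[OF phi_measurable[OF H(1)] phi_bound]
      by (simp add: good_root_def)
  next
    fix \<sigma> x :: real assume H: "0 < \<sigma>" "\<sigma> < \<sigma>1" "\<sigma> * \<bar>x\<bar> < r / 2"
    have "K0 * \<sigma> \<le> K * \<sigma>" using K H by (intro mult_right_mono) auto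
    then show "\<bar>\<kappa> \<sigma> x - f (\<sigma> * x) / \<sigma>\<bar> \<le> K * \<sigma>"
      using S.R_D(6)[OF Rx[OF H]] by (simp add: good_root_def)
    have "K1 * (\<sigma> ^ 5 * (1 + \<bar>x\<bar>) ^ 6) \<le> K * (\<sigma> ^ 5 * (1 + \<bar>x\<bar>) ^ 6)" using K H by (intro mult_right_mono) auto
    then show "\<bar>\<kappa> \<sigma> x - profile f2 f3 f4 f5 b' c' d' S.a3' S.a1' \<sigma> x\<bar> \<le> K * \<sigma> ^ 5 * (1 + \<bar>x\<bar>) ^ 6"
      using K1(2)[OF Rx[OF H], of 0] by (simp add: mult.assoc)
    show "\<kappa> \<sigma> differentiable (at x)"
      using S.kappa_deriv[OF Rx[OF H]] real_differentiable_def by blast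
  next
    fix \<sigma> :: real assume H: "0 < \<sigma>" "\<sigma> < \<sigma>1"
    then have R: "S.R \<sigma> 0" using r by (simp add: S.R_def)
    have "K2 * \<sigma> ^ 5 \<le> K * \<sigma> ^ 5" using K H by (intro mult_right_mono) auto
    then have "\<bar>S.\<kappa>2 \<sigma> 0 - (\<sigma> * f2 + \<sigma> ^ 3 * c')\<bar> \<le> K * \<sigma> ^ 5"
      using K2(2)[of \<sigma> 0 0] R by simp
    then show "\<exists>D. (deriv (\<kappa> \<sigma>) has_real_derivative D) (at 0) \<and> \<bar>D - (\<sigma> * f2 + \<sigma> ^ 3 * c')\<bar> \<le> K * \<sigma> ^ 5"
      using S.kappa_second_deriv[OF R] by blast
  qed (use K K0 in auto)
qed

section \<open>Induction over the stages\<close>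

lemma Ck_halfplane_SucE:
  assumes "Ck_halfplane (Suc k) f"
  obtains fx ft where "\<And>x t. t \<ge> 0 \<Longrightarrow> ((\<lambda>\<xi>. f \<xi> t) has_real_derivative fx x t) (at x)"
    "\<And>x t. t \<ge> 0 \<Longrightarrow> ((\<lambda>s. f x s) has_real_derivative ft x t) (at t within {0..})"
    "Ck_halfplane k fx" "Ck_halfplane k ft"
  using assms unfolding Ck_halfplane.simps(2) by blast

text \<open>The x-derivative hidden in the existential is determined by f, so peeling off one level
  of smoothness shifts the iterate of \<open>deriv\<close> by one.\<close>

lemma Ck_halfplane_deriv_x:
  assumes "Ck_halfplane (Suc n) f" "t \<ge> 0"
  shows "((deriv ^^ n) (\<lambda>\<xi>. f \<xi> t) has_real_derivative (deriv ^^ Suc n) (\<lambda>\<xi>. f \<xi> t) x) (at x)"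
  using assms
proof (induction n arbitrary: f x)
  case 0
  obtain fx where fx: "\<And>x. ((\<lambda>\<xi>. f \<xi> t) has_real_derivative fx x t) (at x)"
    using Ck_halfplane_SucE[OF 0(1)] 0(2) by metis
  have "deriv (\<lambda>\<xi>. f \<xi> t) x = fx x t" by (rule DERIV_imp_deriv[OF fx])
  then show ?case using fx[of x] by simp
next
  case (Suc n)
  obtain fx where fx: "\<And>x. ((\<lambda>\<xi>. f \<xi> t) has_real_derivative fx x t) (at x)" "Ck_halfplane (Suc n) fx"
    using Ck_halfplane_SucE[OF Suc.prems(1)] Suc.prems(2) by metis
  have "deriv (\<lambda>\<xi>. f \<xi> t) = (\<lambda>\<xi>. fx \<xi> t)" using fx(1) by (auto intro: DERIV_imp_deriv)
  then have "(deriv ^^ Suc m) (\<lambda>\<xi>. f \<xi> t) = (deriv ^^ m) (\<lambda>\<xi>. fx \<xi> t)" for m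
    by (simp add: funpow_Suc_right del: funpow.simps)
  then show ?case using Suc.IH[OF fx(2) Suc.prems(2)] by simp
qed

text \<open>\<open>D n\<close> is the n-th derivative of the initial graph, which passes
  horizontally through the origin.\<close>

locale smooth_profile =
  fixes D :: "nat \<Rightarrow> real \<Rightarrow> real"
  assumes D: "\<And>n x. (D n has_real_derivative D (Suc n) x) (at x)"
    and D_0: "D 0 0 = 0" "D 1 0 = 0"
begin

lemma D_bounded: obtains B where "B \<ge> 0" "\<And>x. \<bar>x\<bar> \<le> 1 \<Longrightarrow> \<bar>D n x\<bar> \<le> B"
proof -
  have "continuous_on {-1..1} (D n)"
    by (rule DERIV_continuous_on[OF has_field_derivative_at_within[OF D]])
  then have "bounded (D n ` {-1..1})" by (intro compact_imp_bounded compact_continuous_image) auto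
  then obtain B where B: "\<forall>x\<in>{-1..1}. \<bar>D n x\<bar> \<le> B" by (auto simp: bounded_iff)
  then have "B \<ge> 0" by (force intro: order_trans[OF abs_ge_zero])
  then show ?thesis using B that by (auto simp: abs_le_iff)
qed

lemma D_lipschitz:
  assumes "\<And>x. \<bar>x\<bar> \<le> s \<Longrightarrow> \<bar>D (Suc n) x\<bar> \<le> B" "\<bar>x\<bar> \<le> s" "\<bar>z\<bar> \<le> s"
  shows "\<bar>D n x - D n z\<bar> \<le> B * \<bar>x - z\<bar>"
proof -
  have "norm (D n x - D n z) \<le> B * norm (x - z)"
    by (rule field_differentiable_bound[where S = "{-s..s}" and f' = "D (Suc n)"])
       (use assms in \<open>auto intro!: has_field_derivative_at_within[OF D] simp: abs_le_iff\<close>)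
  then show ?thesis by simp
qed

lemma profile_bounds:
  obtains r C where "0 < r" "r \<le> 1" "C \<ge> 0"
    "\<And>x z. \<bar>x\<bar> < r \<Longrightarrow> \<bar>z\<bar> < r \<Longrightarrow> \<bar>D 0 x - D 0 z - D 1 z * (x - z)\<bar> \<le> C * (x - z)\<^sup>2"
    "\<And>z. \<bar>z\<bar> < r \<Longrightarrow> \<bar>D 1 z\<bar> \<le> 1 / 2" "\<And>z. \<bar>z\<bar> < r \<Longrightarrow> \<bar>D 1 z\<bar> \<le> C * \<bar>z\<bar>"
    "\<And>z. \<bar>z\<bar> < r \<Longrightarrow> \<bar>D 0 z\<bar> \<le> \<bar>z\<bar> / 2"
    "\<And>x. \<bar>x\<bar> < r \<Longrightarrow> \<bar>D 0 x - (D 2 0 * x ^ 2 / 2 + D 3 0 * x ^ 3 / 6 + D 4 0 * x ^ 4 / 24 + D 5 0 * x ^ 5 / 120)\<bar> \<le> C * \<bar>x\<bar> ^ 6"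
proof -
  obtain B2 where B2: "B2 \<ge> 0" "\<And>x. \<bar>x\<bar> \<le> 1 \<Longrightarrow> \<bar>D 2 x\<bar> \<le> B2" using D_bounded[of 2] by blast
  obtain B6 where B6: "B6 \<ge> 0" "\<And>x. \<bar>x\<bar> \<le> 1 \<Longrightarrow> \<bar>D 6 x\<bar> \<le> B6" using D_bounded[of 6] by blast
  define C where "C = B2 + B6"
  \<comment> \<open>Since \<open>D 1\<close> vanishes at 0, it is bounded by B2 |z|, and this radius
    makes that at most 1/2.\<close>
  define r where "r = min 1 (1 / (2 * (B2 + 1)))"
  have r: "0 < r" "r \<le> 1" "B2 * r \<le> 1 / 2" using B2(1) by (auto simp: r_def min_def field_simps)
  have C: "C \<ge> 0" "B2 \<le> C" "B6 \<le> C" using B2 B6 by (auto simp: C_def)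
  have D1: "\<bar>D 1 z\<bar> \<le> B2 * \<bar>z\<bar>" if "\<bar>z\<bar> \<le> 1" for z
    using D_lipschitz[of 1 1 B2 z 0] B2(2) that D_0 by (simp add: numeral_2_eq_2)
  have half: "\<bar>D 1 z\<bar> \<le> 1 / 2" if "\<bar>z\<bar> < r" for z
  proof -
    have "\<bar>D 1 z\<bar> \<le> B2 * \<bar>z\<bar>" by (rule D1) (use that r in simp)
    also have "\<dots> \<le> B2 * r" using that B2(1) by (intro mult_left_mono) auto
    finally show ?thesis using r by simp
  qed
  show ?thesis
  proof (rule that[of r C])
    show "0 < r" "r \<le> 1" "C \<ge> 0" by fact+
    fix z :: real assume z: "\<bar>z\<bar> < r"
    show "\<bar>D 1 z\<bar> \<le> 1 / 2" by (rule half[OF z])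
    have "B2 * \<bar>z\<bar> \<le> C * \<bar>z\<bar>" using C by (intro mult_right_mono) auto
    then show "\<bar>D 1 z\<bar> \<le> C * \<bar>z\<bar>" using D1[of z] z r by simp
    show "\<bar>D 0 z\<bar> \<le> \<bar>z\<bar> / 2"
      using D_lipschitz[of "\<bar>z\<bar>" 0 "1 / 2" z 0] half z D_0 by simp
    have "\<exists>t. \<bar>t\<bar> \<le> \<bar>z\<bar> \<and> D 0 z = (\<Sum>m<6. D m 0 / fact m * z ^ m) + D 6 t / fact 6 * z ^ 6"
      by (rule Maclaurin_all_le) (auto intro: D)
    then obtain t where t: "\<bar>t\<bar> \<le> \<bar>z\<bar>" "D 0 z = (\<Sum>m<6. D m 0 / fact m * z ^ m) + D 6 t / fact 6 * z ^ 6" by blast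
    have "\<bar>D 6 t / fact 6 * z ^ 6\<bar> = \<bar>D 6 t\<bar> * \<bar>z\<bar> ^ 6 / fact 6" by (simp add: abs_mult power_abs)
    also have "\<dots> \<le> \<bar>D 6 t\<bar> * \<bar>z\<bar> ^ 6 / 1" by (intro divide_left_mono) (auto simp: fact_ge_1)
    also have "\<dots> \<le> C * \<bar>z\<bar> ^ 6 / 1" using B6(2)[of t] C t z r by (simp add: mult_right_mono)
    finally show "\<bar>D 0 z - (D 2 0 * z ^ 2 / 2 + D 3 0 * z ^ 3 / 6 + D 4 0 * z ^ 4 / 24 + D 5 0 * z ^ 5 / 120)\<bar> \<le> C * \<bar>z\<bar> ^ 6"
      using t(2) D_0 by (simp add: eval_nat_numeral fact_numeral)
  next
    fix x z :: real assume xz: "\<bar>x\<bar> < r" "\<bar>z\<bar> < r"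
    \<comment> \<open>Subtracting the tangent at z leaves a function whose derivative on the segment
      is O(|x - z|); the mean value inequality adds the second factor.\<close>
    have "norm ((D 0 x - D 1 z * x) - (D 0 z - D 1 z * z)) \<le> (C * \<bar>x - z\<bar>) * norm (x - z)"
    proof (rule field_differentiable_bound[where S = "closed_segment z x" and f' = "\<lambda>y. D 1 y - D 1 z"])
      fix y assume y: "y \<in> closed_segment z x"
      then have "\<bar>y\<bar> \<le> max \<bar>x\<bar> \<bar>z\<bar>" "\<bar>y - z\<bar> \<le> \<bar>x - z\<bar>" by (auto simp: closed_segment_eq_real_ivl split: if_splits)
      then have "\<bar>D 1 y - D 1 z\<bar> \<le> B2 * \<bar>y - z\<bar>"
        using D_lipschitz[of 1 1 B2 y z] B2(2) xz r by (simp add: numeral_2_eq_2)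
      also have "\<dots> \<le> C * \<bar>x - z\<bar>" using \<open>\<bar>y - z\<bar> \<le> _\<close> C by (intro mult_mono) auto
      finally show "norm (D 1 y - D 1 z) \<le> C * \<bar>x - z\<bar>" by simp
      show "((\<lambda>x. D 0 x - D 1 z * x) has_real_derivative D 1 y - D 1 z) (at y within closed_segment z x)"
        by (auto intro!: derivative_eq_intros has_field_derivative_at_within[OF D[of 0]])
    qed auto
    then show "\<bar>D 0 x - D 0 z - D 1 z * (x - z)\<bar> \<le> C * (x - z)\<^sup>2"
      by (simp add: power2_eq_square algebra_simps)
  qed
qed

end

locale stages = smooth_profile +
  fixes \<gamma> :: "nat \<Rightarrow> nat \<Rightarrow> real" and M :: nat
  assumes weights: "\<And>m. Suc m \<le> M \<Longrightarrow> (\<Sum>i\<le>m. \<gamma> (Suc m) i) = 1"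
begin

text \<open>\<open>cb\<close> is the \<tau> coefficient of the second derivative in the claim,
  \<open>db\<close> the \<tau>^2 coefficient of the height.\<close>

definition cb where "cb i = beta4 \<gamma> i * D 4 0 - beta5 \<gamma> i * D 2 0 ^ 3"
definition db where "db i = beta2 \<gamma> i * D 4 0 - beta3 \<gamma> i * D 2 0 ^ 3"

definition scaled :: "nat \<Rightarrow> real \<Rightarrow> (real \<times> real) set" where
  "scaled i \<sigma> = {p. \<sigma> *\<^sub>R p \<in> stage \<gamma> (\<sigma>\<^sup>2) (subgraph (D 0)) i}"

text \<open>The induction invariant, with box, constant and range of \<sigma> depending on the
  stage. The induction asserts mere existence of a3 and a1: they belong to the odd \<sigma>^4 term,
  which at 0 affects neither the height nor the second derivative.\<close>

definition good :: "nat \<Rightarrow> real \<Rightarrow> real \<Rightarrow> real \<Rightarrow> (real \<Rightarrow> real \<Rightarrow> real) \<Rightarrow> real \<Rightarrow> real \<Rightarrow> bool" where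
  "good i r C \<sigma>0 \<kappa> a3 a1 \<longleftrightarrow> 0 < r \<and> 0 < \<sigma>0 \<and> C \<ge> 0 \<and>
    (\<forall>\<sigma> x. 0 < \<sigma> \<and> \<sigma> < \<sigma>0 \<and> \<sigma> * \<bar>x\<bar> < r \<longrightarrow>
      (\<forall>y. \<sigma> * \<bar>y\<bar> < r \<longrightarrow> ((x, y) \<in> scaled i \<sigma> \<longleftrightarrow> y \<le> \<kappa> \<sigma> x)) \<and>
      \<bar>\<kappa> \<sigma> x - D 0 (\<sigma> * x) / \<sigma>\<bar> \<le> C * \<sigma> \<and>
      \<bar>\<kappa> \<sigma> x - profile (D 2 0) (D 3 0) (D 4 0) (D 5 0) (beta1 \<gamma> i) (cb i) (db i) a3 a1 \<sigma> x\<bar> \<le> C * \<sigma> ^ 5 * (1 + \<bar>x\<bar>) ^ 6 \<and>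
      \<kappa> \<sigma> differentiable (at x)) \<and>
    (\<forall>\<sigma>. 0 < \<sigma> \<and> \<sigma> < \<sigma>0 \<longrightarrow>
      (\<exists>D2. (deriv (\<kappa> \<sigma>) has_real_derivative D2) (at 0) \<and> \<bar>D2 - (\<sigma> * D 2 0 + \<sigma> ^ 3 * cb i)\<bar> \<le> C * \<sigma> ^ 5))"

lemma goodD:
  assumes "good i r C \<sigma>0 \<kappa> a3 a1" "0 < \<sigma>" "\<sigma> < \<sigma>0" "\<sigma> * \<bar>x\<bar> < r"
  shows "\<sigma> * \<bar>y\<bar> < r \<Longrightarrow> (x, y) \<in> scaled i \<sigma> \<longleftrightarrow> y \<le> \<kappa> \<sigma> x" "\<bar>\<kappa> \<sigma> x - D 0 (\<sigma> * x) / \<sigma>\<bar> \<le> C * \<sigma>"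
    "\<bar>\<kappa> \<sigma> x - profile (D 2 0) (D 3 0) (D 4 0) (D 5 0) (beta1 \<gamma> i) (cb i) (db i) a3 a1 \<sigma> x\<bar> \<le> C * \<sigma> ^ 5 * (1 + \<bar>x\<bar>) ^ 6"
    "\<kappa> \<sigma> differentiable (at x)"
  using assms unfolding good_def by blast+

lemma subgraph_borel: "subgraph (D 0) \<in> sets borel"
proof -
  have "continuous_on UNIV (D 0)" by (rule DERIV_continuous_on[OF has_field_derivative_at_within[OF D]])
  then have "closed {p :: real \<times> real. snd p \<le> D 0 (fst p)}"
    by (intro closed_Collect_le continuous_intros continuous_on_compose2[of UNIV "D 0" _ fst]) auto
  moreover have "subgraph (D 0) = {p. snd p \<le> D 0 (fst p)}" by (auto simp: subgraph_def)
  ultimately show ?thesis by (simp add: borel_closed)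
qed

lemma scaled_borel: "0 < \<sigma> \<Longrightarrow> scaled i \<sigma> \<in> sets borel"
proof -
  have "(\<lambda>p::real\<times>real. \<sigma> *\<^sub>R p) -` stage \<gamma> (\<sigma>\<^sup>2) (subgraph (D 0)) i \<inter> space borel \<in> sets borel"
    by (rule measurable_sets[OF _ sets_stage[OF subgraph_borel]]) simp
  then show ?thesis by (simp add: scaled_def vimage_def)
qed

lemma good_0: "\<exists>r C \<sigma>0 \<kappa> a3 a1. good 0 r C \<sigma>0 \<kappa> a3 a1"
proof -
  obtain r C where b: "0 < r" "r \<le> 1" "C \<ge> 0"
    "\<And>x. \<bar>x\<bar> < r \<Longrightarrow> \<bar>D 0 x - (D 2 0 * x ^ 2 / 2 + D 3 0 * x ^ 3 / 6 + D 4 0 * x ^ 4 / 24 + D 5 0 * x ^ 5 / 120)\<bar> \<le> C * \<bar>x\<bar> ^ 6"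
    by (rule profile_bounds) blast
  define \<kappa> where "\<kappa> \<sigma> x = D 0 (\<sigma> * x) / \<sigma>" for \<sigma> x
  have dk: "(\<kappa> \<sigma> has_real_derivative D 1 (\<sigma> * x)) (at x)" if "\<sigma> > 0" for \<sigma> x
    unfolding \<kappa>_def[abs_def] using that
    by (auto intro!: derivative_eq_intros DERIV_chain2[OF D[of 0]])
  have "good 0 r C 1 \<kappa> 0 0"
    unfolding good_def
  proof (intro conjI allI impI b(1,3))
    fix \<sigma> x y :: real assume H: "0 < \<sigma> \<and> \<sigma> < 1 \<and> \<sigma> * \<bar>x\<bar> < r"
    show "(x, y) \<in> scaled 0 \<sigma> \<longleftrightarrow> y \<le> \<kappa> \<sigma> x"
      using H by (simp add: scaled_def subgraph_def \<kappa>_def pos_le_divide_eq mult.commute)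
    show "\<kappa> \<sigma> differentiable (at x)" using dk[of \<sigma> x] H real_differentiable_def by blast
    show "\<bar>\<kappa> \<sigma> x - D 0 (\<sigma> * x) / \<sigma>\<bar> \<le> C * \<sigma>" using H b by (simp add: \<kappa>_def)
    let ?T = "D 2 0 * (\<sigma> * x) ^ 2 / 2 + D 3 0 * (\<sigma> * x) ^ 3 / 6 + D 4 0 * (\<sigma> * x) ^ 4 / 24 + D 5 0 * (\<sigma> * x) ^ 5 / 120"
    have "\<bar>D 0 (\<sigma> * x) - ?T\<bar> \<le> C * \<bar>\<sigma> * x\<bar> ^ 6" by (rule b(4)) (use H in \<open>simp add: abs_mult\<close>)
    then have "\<bar>D 0 (\<sigma> * x) - ?T\<bar> / \<sigma> \<le> C * \<bar>\<sigma> * x\<bar> ^ 6 / \<sigma>" using H by (intro divide_right_mono) auto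
    moreover have "\<bar>D 0 (\<sigma> * x) - ?T\<bar> / \<sigma> = \<bar>(D 0 (\<sigma> * x) - ?T) / \<sigma>\<bar>" using H by (simp add: abs_divide)
    \<comment> \<open>All betas of stage 0 vanish, so the profile is the blown-up Taylor polynomial
      of degree 5.\<close>
    moreover have "(D 0 (\<sigma> * x) - ?T) / \<sigma> = \<kappa> \<sigma> x - profile (D 2 0) (D 3 0) (D 4 0) (D 5 0) (beta1 \<gamma> 0) (cb 0) (db 0) 0 0 \<sigma> x"
      using H by (simp add: \<kappa>_def profile_def cb_def db_def power_mult_distrib eval_nat_numeral field_simps)
    moreover have "C * \<bar>\<sigma> * x\<bar> ^ 6 / \<sigma> = C * \<sigma> ^ 5 * \<bar>x\<bar> ^ 6"
      using H by (simp add: abs_mult power_mult_distrib eval_nat_numeral field_simps)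
    moreover have "C * \<sigma> ^ 5 * \<bar>x\<bar> ^ 6 \<le> C * \<sigma> ^ 5 * (1 + \<bar>x\<bar>) ^ 6"
      using b H by (intro mult_left_mono power_mono) auto
    ultimately show "\<bar>\<kappa> \<sigma> x - profile (D 2 0) (D 3 0) (D 4 0) (D 5 0) (beta1 \<gamma> 0) (cb 0) (db 0) 0 0 \<sigma> x\<bar> \<le> C * \<sigma> ^ 5 * (1 + \<bar>x\<bar>) ^ 6"
      by linarith
  next
    fix \<sigma> :: real assume H: "0 < \<sigma> \<and> \<sigma> < 1"
    have "deriv (\<kappa> \<sigma>) = (\<lambda>x. D 1 (\<sigma> * x))" using dk H by (auto intro!: DERIV_imp_deriv)
    moreover have "((\<lambda>x. D 1 (\<sigma> * x)) has_real_derivative D (Suc 1) (\<sigma> * 0) * \<sigma>) (at 0)"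
      by (rule DERIV_chain2[OF D]) (auto intro!: derivative_eq_intros)
    ultimately show "\<exists>D2. (deriv (\<kappa> \<sigma>) has_real_derivative D2) (at 0) \<and> \<bar>D2 - (\<sigma> * D 2 0 + \<sigma> ^ 3 * cb 0)\<bar> \<le> C * \<sigma> ^ 5"
      using b H by (intro exI[of _ "D 2 0 * \<sigma>"]) (simp add: cb_def numeral_2_eq_2)
  qed simp
  then show ?thesis by blast
qed

lemma good_Suc:
  assumes "Suc m \<le> M" and IH: "\<And>i. i \<le> m \<Longrightarrow> \<exists>r C \<sigma>0 \<kappa> a3 a1. good i r C \<sigma>0 \<kappa> a3 a1"
  shows "\<exists>r C \<sigma>0 \<kappa> a3 a1. good (Suc m) r C \<sigma>0 \<kappa> a3 a1"
proof -
  have "\<forall>i. \<exists>z. i \<le> m \<longrightarrow> (case z of (r, C, \<sigma>0, \<kappa>, a3, a1) \<Rightarrow> good i r C \<sigma>0 \<kappa> a3 a1)"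
    using IH by fastforce
  from choice[OF this] obtain Z where Z: "\<And>i. i \<le> m \<Longrightarrow> (case Z i of (r, C, \<sigma>0, \<kappa>, a3, a1) \<Rightarrow> good i r C \<sigma>0 \<kappa> a3 a1)"
    by blast
  define rr CC ss kk aa3 aa1 where "rr = (\<lambda>i. fst (Z i))" and "CC = (\<lambda>i. fst (snd (Z i)))"
    and "ss = (\<lambda>i. fst (snd (snd (Z i))))" and "kk = (\<lambda>i. fst (snd (snd (snd (Z i)))))"
    and "aa3 = (\<lambda>i. fst (snd (snd (snd (snd (Z i))))))" and "aa1 = (\<lambda>i. snd (snd (snd (snd (snd (Z i))))))"
  have G: "good i (rr i) (CC i) (ss i) (kk i) (aa3 i) (aa1 i)" if "i \<le> m" for i
    using Z[OF that] by (simp add: rr_def CC_def ss_def kk_def aa3_def aa1_def case_prod_beta')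
  obtain r0 C0 where b: "0 < r0" "r0 \<le> 1" "C0 \<ge> 0"
    "\<And>x z. \<bar>x\<bar> < r0 \<Longrightarrow> \<bar>z\<bar> < r0 \<Longrightarrow> \<bar>D 0 x - D 0 z - D 1 z * (x - z)\<bar> \<le> C0 * (x - z)\<^sup>2"
    "\<And>z. \<bar>z\<bar> < r0 \<Longrightarrow> \<bar>D 1 z\<bar> \<le> 1 / 2" "\<And>z. \<bar>z\<bar> < r0 \<Longrightarrow> \<bar>D 1 z\<bar> \<le> C0 * \<bar>z\<bar>"
    "\<And>z. \<bar>z\<bar> < r0 \<Longrightarrow> \<bar>D 0 z\<bar> \<le> \<bar>z\<bar> / 2"
    by (rule profile_bounds) blast
  \<comment> \<open>Finitely many stages are involved, so the smallest box, the smallest range of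
    \<sigma> and the sum of the constants serve all of them and the initial graph.\<close>
  define r where "r = Min (insert r0 (rr ` {..m}))"
  define \<sigma>0 where "\<sigma>0 = Min (insert 1 (ss ` {..m}))"
  define C where "C = C0 + (\<Sum>i\<le>m. CC i)"
  have pos: "0 < rr i" "0 < ss i" "0 \<le> CC i" if "i \<le> m" for i using G[OF that] by (auto simp: good_def)
  have r: "0 < r" "r \<le> r0" "r \<le> 1" "\<And>i. i \<le> m \<Longrightarrow> r \<le> rr i"
  proof -
    show "0 < r" using b pos by (auto simp: r_def)
    show "r \<le> r0" by (simp add: r_def)
    then show "r \<le> 1" using b by simp
    show "\<And>i. i \<le> m \<Longrightarrow> r \<le> rr i" unfolding r_def by (intro Min_le) auto
  qed
  have s: "0 < \<sigma>0" "\<sigma>0 \<le> 1" "\<And>i. i \<le> m \<Longrightarrow> \<sigma>0 \<le> ss i"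
  proof -
    show "0 < \<sigma>0" using pos by (auto simp: \<sigma>0_def)
    show "\<sigma>0 \<le> 1" by (simp add: \<sigma>0_def)
    show "\<And>i. i \<le> m \<Longrightarrow> \<sigma>0 \<le> ss i" unfolding \<sigma>0_def by (intro Min_le) auto
  qed
  have C: "0 \<le> C" "C0 \<le> C" "\<And>i. i \<le> m \<Longrightarrow> CC i \<le> C"
  proof -
    have n: "0 \<le> (\<Sum>i\<le>m. CC i)" using pos by (intro sum_nonneg) auto
    then show "0 \<le> C" "C0 \<le> C" using b by (auto simp: C_def)
    fix i assume "i \<le> m"
    then have "CC i \<le> (\<Sum>i\<le>m. CC i)" by (intro member_le_sum) (use pos in auto)
    then show "CC i \<le> C" using b by (simp add: C_def)
  qed
  have Gi: "(\<sigma> * \<bar>y\<bar> < r \<longrightarrow> ((x, y) \<in> scaled i \<sigma> \<longleftrightarrow> y \<le> kk i \<sigma> x))" "\<bar>kk i \<sigma> x - D 0 (\<sigma> * x) / \<sigma>\<bar> \<le> C * \<sigma>"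
      "\<bar>kk i \<sigma> x - profile (D 2 0) (D 3 0) (D 4 0) (D 5 0) (beta1 \<gamma> i) (cb i) (db i) (aa3 i) (aa1 i) \<sigma> x\<bar> \<le> C * \<sigma> ^ 5 * (1 + \<bar>x\<bar>) ^ 6"
    if H: "i \<in> {..m}" "0 < \<sigma>" "\<sigma> < \<sigma>0" "\<sigma> * \<bar>x\<bar> < r" for i \<sigma> x y
  proof -
    have i: "i \<le> m" using H by simp
    have H': "\<sigma> < ss i" "\<sigma> * \<bar>x\<bar> < rr i" using H s(3)[OF i] r(4)[OF i] by auto
    note g = goodD[OF G[OF i] H(2) H'(1) H'(2)]
    show "(\<sigma> * \<bar>y\<bar> < r \<longrightarrow> ((x, y) \<in> scaled i \<sigma> \<longleftrightarrow> y \<le> kk i \<sigma> x))"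
      using g(1)[of y] r(4)[OF i] by simp
    have "CC i * \<sigma> \<le> C * \<sigma>" using C(3)[OF i] H by (intro mult_right_mono) auto
    then show "\<bar>kk i \<sigma> x - D 0 (\<sigma> * x) / \<sigma>\<bar> \<le> C * \<sigma>" using g(2) by linarith
    have "CC i * \<sigma> ^ 5 * (1 + \<bar>x\<bar>) ^ 6 \<le> C * \<sigma> ^ 5 * (1 + \<bar>x\<bar>) ^ 6" using C(3)[OF i] H by (intro mult_right_mono) auto
    then show "\<bar>kk i \<sigma> x - profile (D 2 0) (D 3 0) (D 4 0) (D 5 0) (beta1 \<gamma> i) (cb i) (db i) (aa3 i) (aa1 i) \<sigma> x\<bar> \<le> C * \<sigma> ^ 5 * (1 + \<bar>x\<bar>) ^ 6"
      using g(3) by linarith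
  qed
  interpret S: stage_data "{..m}" "\<gamma> (Suc m)" scaled kk "D 0" "D 1" r C \<sigma>0
  proof unfold_locales
    show "scaled i \<sigma> \<in> sets borel" if "0 < \<sigma>" for i \<sigma> by (rule scaled_borel[OF that])
    fix x z :: real assume xz: "\<bar>x\<bar> < r" "\<bar>z\<bar> < r"
    have "C0 * (x - z)\<^sup>2 \<le> C * (x - z)\<^sup>2" using C by (intro mult_right_mono) auto
    then show "\<bar>D 0 x - D 0 z - D 1 z * (x - z)\<bar> \<le> C * (x - z)\<^sup>2" using b(4)[of x z] xz r(2) by simp
  next
    fix z :: real assume z: "\<bar>z\<bar> < r"
    have "C0 * \<bar>z\<bar> \<le> C * \<bar>z\<bar>" using C by (intro mult_right_mono) auto
    then show "\<bar>D 1 z\<bar> \<le> C * \<bar>z\<bar>" "\<bar>D 1 z\<bar> \<le> 1 / 2" "\<bar>D 0 z\<bar> \<le> \<bar>z\<bar> / 2"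
      using b(5,6,7)[of z] z r(2) by simp_all
  qed (use weights[OF assms(1)] r s C Gi(1,2) D_0 in auto)
  define b' where "b' = (\<Sum>i\<le>m. \<gamma> (Suc m) i * beta1 \<gamma> i) + 1"
  define c' where "c' = D 4 0 + (\<Sum>i\<le>m. \<gamma> (Suc m) i * cb i) - 2 * D 2 0 ^ 3"
  define d' where "d' = D 4 0 / 2 + (\<Sum>i\<le>m. \<gamma> (Suc m) i * cb i) + (\<Sum>i\<le>m. \<gamma> (Suc m) i * db i)
      - D 2 0 ^ 3 * (2 / 3 + 1 / 6 * (\<Sum>i\<le>m. \<gamma> (Suc m) i * beta1 \<gamma> i) ^ 3
        - 1 / 4 * (\<Sum>i\<le>m. \<gamma> (Suc m) i * beta1 \<gamma> i) * (\<Sum>i\<le>m. \<gamma> (Suc m) i * (beta1 \<gamma> i)\<^sup>2)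
        + 1 / 12 * (\<Sum>i\<le>m. \<gamma> (Suc m) i * beta1 \<gamma> i ^ 3))"
  \<comment> \<open>\<open>cb\<close> and \<open>db\<close> are linear in the betas. Comparing
    coefficients of \<open>D 4 0\<close> and \<open>D 2 0 ^ 3\<close> turns c' into the recursions
    of \<open>beta4\<close> and \<open>beta5\<close>, and d' into those of \<open>beta2\<close> and
    \<open>beta3\<close>.\<close>
  have split: "(\<Sum>i\<le>m. \<gamma> (Suc m) i * cb i) = (\<Sum>i\<le>m. \<gamma> (Suc m) i * beta4 \<gamma> i) * D 4 0 - (\<Sum>i\<le>m. \<gamma> (Suc m) i * beta5 \<gamma> i) * D 2 0 ^ 3"
    "(\<Sum>i\<le>m. \<gamma> (Suc m) i * db i) = (\<Sum>i\<le>m. \<gamma> (Suc m) i * beta2 \<gamma> i) * D 4 0 - (\<Sum>i\<le>m. \<gamma> (Suc m) i * beta3 \<gamma> i) * D 2 0 ^ 3"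
    by (simp_all add: cb_def db_def right_diff_distrib sum_subtractf sum_distrib_right mult.assoc)
  have b': "b' = beta1 \<gamma> (Suc m)" by (simp add: b'_def)
  have c': "c' = cb (Suc m)" unfolding c'_def split by (simp add: cb_def algebra_simps)
  have d': "d' = db (Suc m)" unfolding d'_def split by (simp add: db_def algebra_simps)
  obtain \<sigma>1 K \<kappa> a3' a1' where S: "0 < \<sigma>1" "\<sigma>1 \<le> \<sigma>0" "K \<ge> 0"
    "\<And>\<sigma> x y. 0 < \<sigma> \<Longrightarrow> \<sigma> < \<sigma>1 \<Longrightarrow> \<sigma> * \<bar>x\<bar> < r / 2 \<Longrightarrow> \<sigma> * \<bar>y\<bar> < r / 2 \<Longrightarrow>
       conv (gauss 1) (S.\<phi> \<sigma>) (x, y) \<ge> 1 / 2 \<longleftrightarrow> y \<le> \<kappa> \<sigma> x"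
    "\<And>\<sigma> x. 0 < \<sigma> \<Longrightarrow> \<sigma> < \<sigma>1 \<Longrightarrow> \<sigma> * \<bar>x\<bar> < r / 2 \<Longrightarrow> \<bar>\<kappa> \<sigma> x - D 0 (\<sigma> * x) / \<sigma>\<bar> \<le> K * \<sigma>"
    "\<And>\<sigma> x. 0 < \<sigma> \<Longrightarrow> \<sigma> < \<sigma>1 \<Longrightarrow> \<sigma> * \<bar>x\<bar> < r / 2 \<Longrightarrow>
       \<bar>\<kappa> \<sigma> x - profile (D 2 0) (D 3 0) (D 4 0) (D 5 0) b' c' d' a3' a1' \<sigma> x\<bar> \<le> K * \<sigma> ^ 5 * (1 + \<bar>x\<bar>) ^ 6"
    "\<And>\<sigma> x. 0 < \<sigma> \<Longrightarrow> \<sigma> < \<sigma>1 \<Longrightarrow> \<sigma> * \<bar>x\<bar> < r / 2 \<Longrightarrow> \<kappa> \<sigma> differentiable (at x)"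
    "\<And>\<sigma>. 0 < \<sigma> \<Longrightarrow> \<sigma> < \<sigma>1 \<Longrightarrow> \<exists>D2. (deriv (\<kappa> \<sigma>) has_real_derivative D2) (at 0) \<and> \<bar>D2 - (\<sigma> * D 2 0 + \<sigma> ^ 3 * c')\<bar> \<le> K * \<sigma> ^ 5"
    using S.stage_step[OF Gi(3)] unfolding b'_def c'_def d'_def by blast
  have mem: "(x, y) \<in> scaled (Suc m) \<sigma> \<longleftrightarrow> conv (gauss 1) (S.\<phi> \<sigma>) (x, y) \<ge> 1 / 2" if "0 < \<sigma>" for x y \<sigma>
  proof -
    have "(\<lambda>q. \<Sum>i\<le>m. \<gamma> (Suc m) i * indicator (stage \<gamma> (\<sigma>\<^sup>2) (subgraph (D 0)) i) (\<sigma> *\<^sub>R q)) = S.\<phi> \<sigma>"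
      by (auto simp: S.\<phi>_def fun_eq_iff scaled_def indicator_def)
    then show ?thesis
      using conv_gauss_rescale[OF that, of "\<lambda>q. \<Sum>i\<le>m. \<gamma> (Suc m) i * indicator (stage \<gamma> (\<sigma>\<^sup>2) (subgraph (D 0)) i) q" "(x, y)"]
      by (simp add: scaled_def)
  qed
  have "good (Suc m) (r / 2) K \<sigma>1 \<kappa> a3' a1'"
    unfolding good_def using r(1) S(1,3)
  proof (intro conjI allI impI)
    fix \<sigma> x y assume "0 < \<sigma> \<and> \<sigma> < \<sigma>1 \<and> \<sigma> * \<bar>x\<bar> < r / 2" "\<sigma> * \<bar>y\<bar> < r / 2"
    then show "(x, y) \<in> scaled (Suc m) \<sigma> \<longleftrightarrow> y \<le> \<kappa> \<sigma> x" using S(4) mem by blast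
  qed (use S(5-8)[unfolded b' c' d'] in auto)
  then show ?thesis by blast
qed

lemma good_all: "i \<le> M \<Longrightarrow> \<exists>r C \<sigma>0 \<kappa> a3 a1. good i r C \<sigma>0 \<kappa> a3 a1"
proof (induction i rule: less_induct)
  case (less i)
  then show ?case by (cases i) (auto intro: good_0 good_Suc)
qed

text \<open>Undoes the blow-up with \<sigma> = sqrt \<tau>. Heights gain a factor \<sigma>, so the
  error \<sigma>^5 becomes \<tau>^3; second derivatives lose one, so \<sigma>^5 becomes
  \<tau>^2.\<close>

lemma good_interface:
  assumes "good i r C \<sigma>0 \<kappa> a3 a1" and f: "\<And>z. \<bar>z\<bar> < s \<Longrightarrow> \<bar>D 0 z\<bar> \<le> \<bar>z\<bar> / 2" and s: "0 < s" "s \<le> r"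
  defines "h \<equiv> \<lambda>\<tau> x. sqrt \<tau> * \<kappa> (sqrt \<tau>) (x / sqrt \<tau>)"
  shows "\<forall>\<^sub>F \<tau> in at_right 0. interface_near s (stage \<gamma> \<tau> (subgraph (D 0)) i) (h \<tau>) \<and>
            (\<forall>x. \<bar>x\<bar> < s \<longrightarrow> h \<tau> differentiable (at x)) \<and> deriv (h \<tau>) differentiable (at 0)" (is ?t1)
    and "(\<lambda>\<tau>. h \<tau> 0 - (\<tau> * beta1 \<gamma> i * D 2 0
              + \<tau>\<^sup>2 * (beta2 \<gamma> i * D 4 0 - beta3 \<gamma> i * D 2 0 ^ 3))) \<in> O[at_right 0](\<lambda>\<tau>. \<tau> ^ 3)" (is ?t2)
    and "(\<lambda>\<tau>. (deriv ^^ 2) (h \<tau>) 0 - (D 2 0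
              + \<tau> * (beta4 \<gamma> i * D 4 0 - beta5 \<gamma> i * D 2 0 ^ 3))) \<in> O[at_right 0](\<lambda>\<tau>. \<tau>\<^sup>2)" (is ?t3)
proof -
  note g = assms(1)[unfolded good_def]
  have g0: "0 < r" "0 < \<sigma>0" "C \<ge> 0" using g by auto
  note g1 = goodD[OF assms(1)]
  \<comment> \<open>The second entry gives C \<tau> < s/2; with |D 0 x| \<le> |x|/2 the graph then
    stays inside the box of half-width s, as \<open>interface_near\<close> demands.\<close>
  define \<tau>0 where "\<tau>0 = min (\<sigma>0\<^sup>2) (s / (2 * (C + 1)))"
  have "\<tau>0 > 0" using g0 s by (simp add: \<tau>0_def)
  then have ev: "\<forall>\<^sub>F \<tau> in at_right 0. 0 < \<tau> \<and> \<tau> < \<tau>0"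
    by (auto simp: eventually_at_right intro!: exI[of _ \<tau>0])
  have T: "0 < sqrt \<tau>" "sqrt \<tau> < \<sigma>0" "C * \<tau> < s / 2" "sqrt \<tau> * sqrt \<tau> = \<tau>" if "0 < \<tau> \<and> \<tau> < \<tau>0" for \<tau>
  proof -
    show "0 < sqrt \<tau>" "sqrt \<tau> * sqrt \<tau> = \<tau>" using that by auto
    have "\<tau> < \<sigma>0\<^sup>2" "\<tau> < s / (2 * (C + 1))" using that by (auto simp: \<tau>0_def)
    then show "sqrt \<tau> < \<sigma>0" using g0 real_sqrt_less_iff[of \<tau> "\<sigma>0\<^sup>2"] by simp
    have "(C + 1) * \<tau> < s / 2" using \<open>\<tau> < s / _\<close> g0(3) by (simp add: field_simps)
    then show "C * \<tau> < s / 2" using that by (simp add: distrib_right)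
  qed
  have dh: "(h \<tau> has_real_derivative deriv (\<kappa> (sqrt \<tau>)) (x / sqrt \<tau>)) (at x)" if \<tau>: "0 < \<tau> \<and> \<tau> < \<tau>0" and x: "\<bar>x\<bar> < s" for \<tau> x
  proof -
    note t = T[OF \<tau>]
    have "\<kappa> (sqrt \<tau>) differentiable (at (x / sqrt \<tau>))" by (rule g1(4)[OF t(1,2)]) (use t x s in \<open>simp add: abs_divide\<close>)
    then have "(\<kappa> (sqrt \<tau>) has_real_derivative deriv (\<kappa> (sqrt \<tau>)) (x / sqrt \<tau>)) (at (x / sqrt \<tau>))"
      using DERIV_deriv_iff_real_differentiable by blast
    from DERIV_cmult[OF DERIV_chain2[OF this DERIV_cdivide[OF DERIV_ident]], of "sqrt \<tau>"]
    show ?thesis unfolding h_def using t(1) by simp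
  qed
  have d2h: "(deriv (h \<tau>) has_real_derivative D2 / sqrt \<tau>) (at 0)"
    if \<tau>: "0 < \<tau> \<and> \<tau> < \<tau>0" and D2: "(deriv (\<kappa> (sqrt \<tau>)) has_real_derivative D2) (at 0)" for \<tau> D2
  proof -
    note t = T[OF \<tau>]
    have "\<forall>\<^sub>F x in nhds 0. \<bar>x\<bar> < s"
      using s by (auto simp: eventually_nhds_metric dist_real_def intro!: exI[of _ s])
    then have "\<forall>\<^sub>F x in nhds 0. deriv (h \<tau>) x = deriv (\<kappa> (sqrt \<tau>)) (x / sqrt \<tau>)"
      by eventually_elim (rule DERIV_imp_deriv[OF dh[OF \<tau>]])
    moreover have "((\<lambda>x. deriv (\<kappa> (sqrt \<tau>)) (x / sqrt \<tau>)) has_real_derivative D2 * (1 / sqrt \<tau>)) (at 0)"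
      by (rule DERIV_chain2[where g = "\<lambda>x. x / sqrt \<tau>", OF _ DERIV_cdivide[OF DERIV_ident]]) (use D2 in simp)
    ultimately show ?thesis using DERIV_cong_ev[OF refl _ refl] by fastforce
  qed
  have ex2: "\<exists>D2. (deriv (\<kappa> (sqrt \<tau>)) has_real_derivative D2) (at 0) \<and>
      \<bar>D2 - (sqrt \<tau> * D 2 0 + sqrt \<tau> ^ 3 * cb i)\<bar> \<le> C * sqrt \<tau> ^ 5" if \<tau>: "0 < \<tau> \<and> \<tau> < \<tau>0" for \<tau>
    using g T[OF \<tau>] by blast
  show ?t1
    using ev
  proof eventually_elim
    case (elim \<tau>)
    note t = T[OF elim]
    have "interface_near s (stage \<gamma> \<tau> (subgraph (D 0)) i) (h \<tau>)"
      unfolding interface_near_def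
    proof (intro allI impI conjI)
      fix x :: real assume x: "\<bar>x\<bar> < s"
      have sx: "sqrt \<tau> * \<bar>x / sqrt \<tau>\<bar> < r" using t x s by (simp add: abs_divide)
      have "\<bar>\<kappa> (sqrt \<tau>) (x / sqrt \<tau>) - D 0 x / sqrt \<tau>\<bar> \<le> C * sqrt \<tau>"
        using g1(2)[OF t(1,2) sx] t(1) by simp
      then have "sqrt \<tau> * \<bar>\<kappa> (sqrt \<tau>) (x / sqrt \<tau>) - D 0 x / sqrt \<tau>\<bar> \<le> sqrt \<tau> * (C * sqrt \<tau>)"
        using t(1) by (intro mult_left_mono) auto
      moreover have "sqrt \<tau> * \<bar>\<kappa> (sqrt \<tau>) (x / sqrt \<tau>) - D 0 x / sqrt \<tau>\<bar> = \<bar>h \<tau> x - D 0 x\<bar>"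
        using t(1) abs_mult[of "sqrt \<tau>" "\<kappa> (sqrt \<tau>) (x / sqrt \<tau>) - D 0 x / sqrt \<tau>"]
        by (simp add: h_def right_diff_distrib)
      moreover have "sqrt \<tau> * (C * sqrt \<tau>) = C * \<tau>" using t(4) by (simp add: mult.left_commute)
      ultimately have "\<bar>h \<tau> x - D 0 x\<bar> \<le> C * \<tau>" by simp
      then show "\<bar>h \<tau> x\<bar> < s" using f[OF x] t(3) x by linarith
      fix y :: real assume y: "\<bar>y\<bar> < s"
      have "(x / sqrt \<tau>, y / sqrt \<tau>) \<in> scaled i (sqrt \<tau>) \<longleftrightarrow> y / sqrt \<tau> \<le> \<kappa> (sqrt \<tau>) (x / sqrt \<tau>)"
        by (rule g1(1)[OF t(1,2) sx]) (use t y s in \<open>simp add: abs_divide\<close>)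
      then show "(x, y) \<in> stage \<gamma> \<tau> (subgraph (D 0)) i \<longleftrightarrow> y \<le> h \<tau> x"
        using t(1) elim by (simp add: scaled_def h_def divide_le_eq mult.commute)
    qed
    moreover have "h \<tau> differentiable (at x)" if "\<bar>x\<bar> < s" for x
      using dh[OF elim that] real_differentiable_def by blast
    moreover have "deriv (h \<tau>) differentiable (at 0)"
      using ex2[OF elim] d2h[OF elim] real_differentiable_def by blast
    ultimately show ?case by blast
  qed
  show ?t2
  proof (rule bigoI[of _ C])
    show "\<forall>\<^sub>F \<tau> in at_right 0. norm (h \<tau> 0 - (\<tau> * beta1 \<gamma> i * D 2 0
              + \<tau>\<^sup>2 * (beta2 \<gamma> i * D 4 0 - beta3 \<gamma> i * D 2 0 ^ 3))) \<le> C * norm (\<tau> ^ 3)"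
      using ev
    proof eventually_elim
      case (elim \<tau>)
      note t = T[OF elim]
      define q where "q = sqrt \<tau>"
      have q: "q > 0" "\<tau> = q ^ 2" using t by (auto simp: q_def power2_eq_square)
      have "\<bar>\<kappa> q 0 - (q * (D 2 0 * beta1 \<gamma> i) + q ^ 3 * db i)\<bar> \<le> C * q ^ 5"
        using g1(3)[of q 0] t g0 by (simp add: q_def profile_def)
      then have "q * \<bar>\<kappa> q 0 - (q * (D 2 0 * beta1 \<gamma> i) + q ^ 3 * db i)\<bar> \<le> q * (C * q ^ 5)"
        using q(1) by (intro mult_left_mono) auto
      moreover have "q * \<bar>\<kappa> q 0 - (q * (D 2 0 * beta1 \<gamma> i) + q ^ 3 * db i)\<bar>
          = \<bar>q * (\<kappa> q 0 - (q * (D 2 0 * beta1 \<gamma> i) + q ^ 3 * db i))\<bar>" using q(1) by (simp add: abs_mult)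
      moreover have "q * (\<kappa> q 0 - (q * (D 2 0 * beta1 \<gamma> i) + q ^ 3 * db i))
          = h \<tau> 0 - (\<tau> * beta1 \<gamma> i * D 2 0 + \<tau>\<^sup>2 * (beta2 \<gamma> i * D 4 0 - beta3 \<gamma> i * D 2 0 ^ 3))"
        unfolding h_def q_def[symmetric] q(2) db_def using q(1) by (simp add: eval_nat_numeral algebra_simps)
      moreover have "q * (C * q ^ 5) = C * \<tau> ^ 3" by (simp add: q(2) eval_nat_numeral)
      ultimately show ?case using elim by (simp add: power_abs)
    qed
  qed
  show ?t3
  proof (rule bigoI[of _ C])
    show "\<forall>\<^sub>F \<tau> in at_right 0. norm ((deriv ^^ 2) (h \<tau>) 0 - (D 2 0
              + \<tau> * (beta4 \<gamma> i * D 4 0 - beta5 \<gamma> i * D 2 0 ^ 3))) \<le> C * norm (\<tau>\<^sup>2)"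
      using ev
    proof eventually_elim
      case (elim \<tau>)
      note t = T[OF elim]
      define q where "q = sqrt \<tau>"
      have q: "q > 0" "\<tau> = q ^ 2" using t by (auto simp: q_def power2_eq_square)
      obtain D2 where D2: "(deriv (\<kappa> q) has_real_derivative D2) (at 0)" "\<bar>D2 - (q * D 2 0 + q ^ 3 * cb i)\<bar> \<le> C * q ^ 5"
        using ex2[OF elim] by (auto simp: q_def)
      have "(deriv ^^ 2) (h \<tau>) 0 = D2 / q"
        using DERIV_imp_deriv[OF d2h[OF elim D2(1)[unfolded q_def]]] by (simp add: numeral_2_eq_2 q_def)
      moreover define N where "N = D2 - (q * D 2 0 + q ^ 3 * cb i)"
      moreover have "\<bar>N\<bar> / q \<le> C * q ^ 5 / q"
        using D2(2) q(1) unfolding N_def by (intro divide_right_mono) auto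
      moreover have "\<bar>N\<bar> / q = \<bar>N / q\<bar>" using q(1) by (simp add: abs_divide)
      moreover have "N / q = D2 / q - (D 2 0 + \<tau> * cb i)"
        using q(1) by (simp add: N_def q(2) field_simps eval_nat_numeral)
      moreover have "C * q ^ 5 / q = C * \<tau>\<^sup>2" using q(1) by (simp add: q(2) eval_nat_numeral)
      ultimately have "\<bar>(deriv ^^ 2) (h \<tau>) 0 - (D 2 0 + \<tau> * cb i)\<bar> \<le> C * \<tau>\<^sup>2" by linarith
      then show ?case by (simp add: cb_def)
    qed
  qed
qed

lemma all_interfaces:
  "\<exists>r>0. \<exists>h :: nat \<Rightarrow> real \<Rightarrow> real \<Rightarrow> real. \<forall>i\<le>M.
     (\<forall>\<^sub>F \<tau> in at_right 0. interface_near r (stage \<gamma> \<tau> (subgraph (D 0)) i) (h i \<tau>) \<and>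
        (\<forall>x. \<bar>x\<bar> < r \<longrightarrow> h i \<tau> differentiable (at x)) \<and> deriv (h i \<tau>) differentiable (at 0)) \<and>
     (\<lambda>\<tau>. h i \<tau> 0 - (\<tau> * beta1 \<gamma> i * D 2 0
         + \<tau>\<^sup>2 * (beta2 \<gamma> i * D 4 0 - beta3 \<gamma> i * D 2 0 ^ 3))) \<in> O[at_right 0](\<lambda>\<tau>. \<tau> ^ 3) \<and>
     (\<lambda>\<tau>. (deriv ^^ 2) (h i \<tau>) 0 - (D 2 0
         + \<tau> * (beta4 \<gamma> i * D 4 0 - beta5 \<gamma> i * D 2 0 ^ 3))) \<in> O[at_right 0](\<lambda>\<tau>. \<tau>\<^sup>2)"
proof -
  have "\<forall>i. \<exists>z. i \<le> M \<longrightarrow> (case z of (r, C, \<sigma>0, \<kappa>, a3, a1) \<Rightarrow> good i r C \<sigma>0 \<kappa> a3 a1)"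
    using good_all by fastforce
  from choice[OF this] obtain Z where Z: "\<And>i. i \<le> M \<Longrightarrow> (case Z i of (r, C, \<sigma>0, \<kappa>, a3, a1) \<Rightarrow> good i r C \<sigma>0 \<kappa> a3 a1)"
    by blast
  define rr where "rr i = fst (Z i)" for i
  define kk where "kk i = fst (snd (snd (snd (Z i))))" for i
  obtain r0 where r0: "0 < r0" "\<And>z. \<bar>z\<bar> < r0 \<Longrightarrow> \<bar>D 0 z\<bar> \<le> \<bar>z\<bar> / 2"
    by (rule profile_bounds) blast
  define r where "r = Min (insert r0 (rr ` {..M}))"
  have pos: "0 < rr i" if "i \<le> M" for i using Z[OF that] by (auto simp: good_def rr_def case_prod_beta')
  have r: "0 < r" "r \<le> r0" "\<And>i. i \<le> M \<Longrightarrow> r \<le> rr i"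
  proof -
    show "0 < r" using r0 pos by (auto simp: r_def)
    show "r \<le> r0" by (simp add: r_def)
    show "\<And>i. i \<le> M \<Longrightarrow> r \<le> rr i" unfolding r_def by (intro Min_le) auto
  qed
  have f: "\<And>z. \<bar>z\<bar> < r \<Longrightarrow> \<bar>D 0 z\<bar> \<le> \<bar>z\<bar> / 2" using r0 r(2) by simp
  show ?thesis
  proof (intro exI[of _ r] conjI r(1) exI[of _ "\<lambda>i \<tau> x. sqrt \<tau> * kk i (sqrt \<tau>) (x / sqrt \<tau>)"] allI impI)
    fix i assume i: "i \<le> M"
    obtain C \<sigma>0 a3 a1 where g: "good i (rr i) C \<sigma>0 (kk i) a3 a1"
      using Z[OF i] by (auto simp: rr_def kk_def case_prod_beta')
    show "\<forall>\<^sub>F \<tau> in at_right 0. interface_near r (stage \<gamma> \<tau> (subgraph (D 0)) i) (\<lambda>x. sqrt \<tau> * kk i (sqrt \<tau>) (x / sqrt \<tau>)) \<and>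
        (\<forall>x. \<bar>x\<bar> < r \<longrightarrow> (\<lambda>x. sqrt \<tau> * kk i (sqrt \<tau>) (x / sqrt \<tau>)) differentiable (at x)) \<and>
        deriv (\<lambda>x. sqrt \<tau> * kk i (sqrt \<tau>) (x / sqrt \<tau>)) differentiable (at 0)"
      by (rule good_interface(1)[OF g f r(1) r(3)[OF i]])
    show "(\<lambda>\<tau>. sqrt \<tau> * kk i (sqrt \<tau>) (0 / sqrt \<tau>) - (\<tau> * beta1 \<gamma> i * D 2 0
         + \<tau>\<^sup>2 * (beta2 \<gamma> i * D 4 0 - beta3 \<gamma> i * D 2 0 ^ 3))) \<in> O[at_right 0](\<lambda>\<tau>. \<tau> ^ 3)"
      by (rule good_interface(2)[OF g f r(1) r(3)[OF i]])
    show "(\<lambda>\<tau>. (deriv ^^ 2) (\<lambda>x. sqrt \<tau> * kk i (sqrt \<tau>) (x / sqrt \<tau>)) 0 - (D 2 0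
         + \<tau> * (beta4 \<gamma> i * D 4 0 - beta5 \<gamma> i * D 2 0 ^ 3))) \<in> O[at_right 0](\<lambda>\<tau>. \<tau>\<^sup>2)"
      by (rule good_interface(3)[OF g f r(1) r(3)[OF i]])
  qed
qed

end

section \<open>Motion by mean curvature\<close>

lemma at_within_halfline_nontrivial:
  assumes "t \<ge> (0::real)"
  shows "at t within {0..} \<noteq> bot"
proof -
  have "at_right t \<le> at t within {0..}" by (rule at_le) (use assms in auto)
  then show ?thesis using trivial_limit_at_right_real[of t] by (auto simp: bot_unique)
qed

lemma DERIV_unique_halfline:
  fixes t :: real
  assumes "(g has_real_derivative a) (at t within {0..})" "(g has_real_derivative b) (at t within {0..})" "t \<ge> 0"
  shows "a = b"
  by (rule has_field_derivative_unique[OF assms(1,2) at_within_halfline_nontrivial[OF assms(3)]])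

lemma Ck_halfplane_continuous: "Ck_halfplane k f \<Longrightarrow> continuous_on (UNIV \<times> {0..}) (\<lambda>(x, t). f x t)"
  by (cases k) auto

lemma continuous_on_section:
  assumes "continuous_on (UNIV \<times> {0..}) (\<lambda>(x, t). f x t)"
  shows "continuous_on {0..b} (f x)"
proof -
  have "continuous_on {0..b} (\<lambda>t. (\<lambda>(x, t). f x t) (x, t))"
    by (rule continuous_on_compose2[OF assms]) (auto intro!: continuous_intros)
  then show ?thesis by simp
qed

text \<open>Equality of mixed partials at the boundary: differentiate
  \<open>f x t = f x 0 + \<integral> {0..t} (ft x)\<close> first in \<open>x\<close> and then in \<open>t\<close>.\<close>

lemma mixed_partials_at_0:
  assumes fx: "\<And>x t. t \<ge> 0 \<Longrightarrow> ((\<lambda>\<xi>. f \<xi> t) has_real_derivative fx x t) (at x)"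
    and ft: "\<And>x t. t \<ge> 0 \<Longrightarrow> ((\<lambda>s. f x s) has_real_derivative ft x t) (at t within {0..})"
    and fxt: "\<And>x t. t \<ge> 0 \<Longrightarrow> ((\<lambda>s. fx x s) has_real_derivative fxt x t) (at t within {0..})"
    and ftx: "\<And>x t. t \<ge> 0 \<Longrightarrow> ((\<lambda>\<xi>. ft \<xi> t) has_real_derivative ftx x t) (at x)"
    and c: "continuous_on (UNIV \<times> {0..}) (\<lambda>(x, t). ft x t)" "continuous_on (UNIV \<times> {0..}) (\<lambda>(x, t). ftx x t)"
  shows "fxt x 0 = ftx x 0"
proof -
  have ftc: "(ft x has_integral f x t - f x 0) {0..t}" if "t \<ge> 0" for x t
    by (rule fundamental_theorem_of_calculus[OF that])
       (auto simp: has_real_derivative_iff_has_vector_derivative[symmetric] intro!: DERIV_subset[OF ft])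
  have eq: "fx x t = fx x 0 + integral {0..t} (ftx x)" if t: "t \<ge> 0" for t
  proof (rule DERIV_unique)
    show "((\<lambda>\<xi>. f \<xi> t) has_real_derivative fx x t) (at x)" by (rule fx[OF t])
    have "((\<lambda>\<xi>. integral (cbox 0 t) (ft \<xi>)) has_field_derivative integral (cbox 0 t) (ftx x)) (at x within UNIV)"
    proof (rule leibniz_rule_field_derivative[where fx = ftx])
      show "continuous_on (UNIV \<times> cbox 0 t) (\<lambda>(x, t). ftx x t)"
        by (rule continuous_on_subset[OF c(2)]) auto
      show "ft \<xi> integrable_on cbox 0 t" for \<xi> using ftc[OF t] by (auto simp: integrable_on_def)
    qed (use ftx in auto)
    from DERIV_add[OF fx[of 0 x] this]
    have "((\<lambda>\<xi>. f \<xi> 0 + integral {0..t} (ft \<xi>)) has_real_derivative fx x 0 + integral {0..t} (ftx x)) (at x)"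
      by simp
    moreover have "integral {0..t} (ft \<xi>) = f \<xi> t - f \<xi> 0" for \<xi> using ftc[OF t] by (rule integral_unique)
    ultimately show "((\<lambda>\<xi>. f \<xi> t) has_real_derivative fx x 0 + integral {0..t} (ftx x)) (at x)"
      by simp
  qed
  have "((\<lambda>t. integral {0..t} (ftx x)) has_real_derivative ftx x 0) (at 0 within {0..1})"
    by (rule integral_has_real_derivative[OF continuous_on_section[OF c(2)]]) auto
  from DERIV_add[OF DERIV_const[of "fx x 0"] this]
  have "((\<lambda>t. fx x 0 + integral {0..t} (ftx x)) has_real_derivative ftx x 0) (at 0 within {0..1})" by simp
  then have "(fx x has_real_derivative ftx x 0) (at 0 within {0..1})"
    by (rule has_field_derivative_transform_within[where d = 1]) (simp_all add: eq[symmetric])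
  moreover have "(fx x has_real_derivative fxt x 0) (at 0 within {0..1})"
    by (rule DERIV_subset[OF fxt]) auto
  moreover have "at (0::real) within {0..1} \<noteq> bot" by (simp add: at_within_Icc_at_right)
  ultimately show ?thesis using has_field_derivative_unique by blast
qed

lemma power_bound_of_deriv_halfline:
  fixes F :: "real \<Rightarrow> real"
  assumes "\<And>t. t \<ge> 0 \<Longrightarrow> (F has_real_derivative F' t) (at t within {0..})" "F 0 = 0"
    and "\<And>t. 0 \<le> t \<Longrightarrow> t \<le> 1 \<Longrightarrow> \<bar>F' t\<bar> \<le> B * t ^ n" and t: "0 \<le> t" "t \<le> 1" and B: "B \<ge> 0"
  shows "\<bar>F t\<bar> \<le> B * t ^ Suc n"
proof -
  have "norm (F t - F 0) \<le> (B * t ^ n) * norm (t - 0)"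
  proof (rule field_differentiable_bound[where S = "{0..t}" and f' = F'])
    fix z assume z: "z \<in> {0..t}"
    show "(F has_real_derivative F' z) (at z within {0..t})" by (rule DERIV_subset[OF assms(1)]) (use z in auto)
    have "\<bar>F' z\<bar> \<le> B * z ^ n" by (rule assms(3)) (use z t in auto)
    also have "\<dots> \<le> B * t ^ n" using z B by (intro mult_left_mono power_mono) auto
    finally show "norm (F' z) \<le> B * t ^ n" by simp
  qed (use t in auto)
  then show ?thesis using assms(2) t by (simp add: mult_ac)
qed

text \<open>The bound on g3 over [0, 1] is integrated three times from 0, with derivatives relative
  to the closed half line throughout.\<close>

lemma taylor_2_halfline:
  fixes g :: "real \<Rightarrow> real"
  assumes g: "\<And>t. t \<ge> 0 \<Longrightarrow> (g has_real_derivative g1 t) (at t within {0..})"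
    "\<And>t. t \<ge> 0 \<Longrightarrow> (g1 has_real_derivative g2 t) (at t within {0..})"
    "\<And>t. t \<ge> 0 \<Longrightarrow> (g2 has_real_derivative g3 t) (at t within {0..})"
    and c: "continuous_on {0..1} g3"
  shows "(\<lambda>t. g t - (g 0 + t * g1 0 + t\<^sup>2 / 2 * g2 0)) \<in> O[at_right 0](\<lambda>t. t ^ 3)"
proof -
  have "bounded (g3 ` {0..1})" by (intro compact_imp_bounded compact_continuous_image c) auto
  then obtain B where B: "\<forall>t\<in>{0..1}. \<bar>g3 t\<bar> \<le> B" by (auto simp: bounded_iff)
  then have B0: "B \<ge> 0" by (force intro: order_trans[OF abs_ge_zero])
  have 1: "\<bar>g2 t - g2 0\<bar> \<le> B * t ^ Suc 0" if "0 \<le> t" "t \<le> 1" for t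
    by (rule power_bound_of_deriv_halfline[where F' = g3])
       (use that B B0 in \<open>auto intro!: derivative_eq_intros g(3)\<close>)
  have 2: "\<bar>g1 t - g1 0 - t * g2 0\<bar> \<le> B * t ^ Suc (Suc 0)" if "0 \<le> t" "t \<le> 1" for t
    by (rule power_bound_of_deriv_halfline[where F' = "\<lambda>t. g2 t - g2 0"])
       (use that 1 B0 in \<open>auto intro!: derivative_eq_intros g(2)\<close>)
  have 3: "\<bar>g t - g 0 - t * g1 0 - t\<^sup>2 / 2 * g2 0\<bar> \<le> B * t ^ Suc (Suc (Suc 0))" if "0 \<le> t" "t \<le> 1" for t
    by (rule power_bound_of_deriv_halfline[where F' = "\<lambda>t. g1 t - g1 0 - t * g2 0"])
       (use that 2 B0 in \<open>auto intro!: derivative_eq_intros g(1)\<close>)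
  show ?thesis
  proof (rule bigoI[of _ B])
    have "\<forall>\<^sub>F t in at_right (0::real). t \<in> {0<..<1}" by (rule eventually_at_right_real) simp
    then show "\<forall>\<^sub>F t in at_right 0. norm (g t - (g 0 + t * g1 0 + t\<^sup>2 / 2 * g2 0)) \<le> B * norm (t ^ 3)"
    proof eventually_elim
      case (elim t)
      then show ?case using 3[of t] by (simp add: numeral_3_eq_3 algebra_simps)
    qed
  qed
qed

lemma smooth_halfplane_D:
  assumes "smooth_halfplane f"
  defines "D \<equiv> \<lambda>n. (deriv ^^ n) (\<lambda>x. f x 0)"
  shows "(D n has_real_derivative D (Suc n) x) (at x)"
proof -
  have "Ck_halfplane (Suc n) f" using assms(1) unfolding smooth_halfplane_def by blast
  from Ck_halfplane_deriv_x[OF this, of 0 x] show ?thesis unfolding D_def by simp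
qed

text \<open>Because f_x = 0 at the origin, differentiating the equation in t gives f_tt = f_xxt
  there. Exchanging partials twice at t = 0 turns f_xxt into the second x-derivative of f_xx / (1 +
  f_x^2), which depends on the initial graph alone.\<close>

lemma mean_curvature_taylor:
  assumes sm: "smooth_halfplane f" and "f 0 0 = 0" and d0: "deriv (\<lambda>x. f x 0) 0 = 0" and mc: "moves_by_mean_curvature f"
  defines "D \<equiv> \<lambda>n. (deriv ^^ n) (\<lambda>x. f x 0)"
  shows "(\<lambda>t. f 0 t - (t * D 2 0 + t\<^sup>2 / 2 * (D 4 0 - 2 * D 2 0 ^ 3))) \<in> O[at_right 0](\<lambda>t. t ^ 3)"
proof -
  have D: "(D n has_real_derivative D (Suc n) x) (at x)" for n x
    unfolding D_def by (rule smooth_halfplane_D[OF sm])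
  have "Ck_halfplane (Suc (Suc (Suc 0))) f" using sm unfolding smooth_halfplane_def by blast
  from Ck_halfplane_SucE[OF this] obtain fx ft where
    f: "\<And>x t. t \<ge> 0 \<Longrightarrow> ((\<lambda>\<xi>. f \<xi> t) has_real_derivative fx x t) (at x)"
    "\<And>x t. t \<ge> 0 \<Longrightarrow> ((\<lambda>s. f x s) has_real_derivative ft x t) (at t within {0..})"
    "Ck_halfplane (Suc (Suc 0)) fx" "Ck_halfplane (Suc (Suc 0)) ft" by blast
  from Ck_halfplane_SucE[OF f(3)] obtain fxx fxt where
    fx: "\<And>x t. t \<ge> 0 \<Longrightarrow> ((\<lambda>\<xi>. fx \<xi> t) has_real_derivative fxx x t) (at x)"
    "\<And>x t. t \<ge> 0 \<Longrightarrow> ((\<lambda>s. fx x s) has_real_derivative fxt x t) (at t within {0..})"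
    "Ck_halfplane (Suc 0) fxx" "Ck_halfplane (Suc 0) fxt" by blast
  from Ck_halfplane_SucE[OF f(4)] obtain ftx ftt where
    ft: "\<And>x t. t \<ge> 0 \<Longrightarrow> ((\<lambda>\<xi>. ft \<xi> t) has_real_derivative ftx x t) (at x)"
    "\<And>x t. t \<ge> 0 \<Longrightarrow> ((\<lambda>s. ft x s) has_real_derivative ftt x t) (at t within {0..})"
    "Ck_halfplane (Suc 0) ftx" "Ck_halfplane (Suc 0) ftt" by blast
  from Ck_halfplane_SucE[OF ft(4)] obtain fttt where
    ftt: "\<And>x t. t \<ge> 0 \<Longrightarrow> ((\<lambda>s. ftt x s) has_real_derivative fttt x t) (at t within {0..})" "Ck_halfplane 0 fttt" by metis
  from Ck_halfplane_SucE[OF fx(3)] obtain fxxt where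
    fxx: "\<And>x t. t \<ge> 0 \<Longrightarrow> ((\<lambda>s. fxx x s) has_real_derivative fxxt x t) (at t within {0..})" by metis
  from Ck_halfplane_SucE[OF fx(4)] obtain fxtx where
    fxt: "\<And>x t. t \<ge> 0 \<Longrightarrow> ((\<lambda>\<xi>. fxt \<xi> t) has_real_derivative fxtx x t) (at x)" "Ck_halfplane 0 fxtx" by metis
  note cont = f(3,4)[THEN Ck_halfplane_continuous] fx(3,4)[THEN Ck_halfplane_continuous]
    ft(3,4)[THEN Ck_halfplane_continuous] ftt(2)[THEN Ck_halfplane_continuous] fxt(2)[THEN Ck_halfplane_continuous]
  have fx_D: "fx x 0 = D 1 x" for x using DERIV_unique[OF f(1)[of 0 x] D[of 0 x, unfolded D_def, simplified]] by (simp add: D_def)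
  have fxx_D: "fxx x 0 = D 2 x" for x
    using DERIV_unique[OF fx(1)[of 0 x, unfolded fx_D] D[of 1 x]] by (simp add: numeral_2_eq_2)
  have dd: "deriv (\<lambda>\<xi>. f \<xi> t) x = fx x t" "(deriv ^^ 2) (\<lambda>\<xi>. f \<xi> t) x = fxx x t" if "t \<ge> 0" for x t
  proof -
    have "deriv (\<lambda>\<xi>. f \<xi> t) = (\<lambda>x. fx x t)" using f(1)[OF that] by (auto intro!: DERIV_imp_deriv)
    moreover have "deriv (\<lambda>x. fx x t) x = fxx x t" by (rule DERIV_imp_deriv[OF fx(1)[OF that]])
    ultimately show "deriv (\<lambda>\<xi>. f \<xi> t) x = fx x t" "(deriv ^^ 2) (\<lambda>\<xi>. f \<xi> t) x = fxx x t"
      by (simp_all add: numeral_2_eq_2)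
  qed
  have ft_eq: "ft x t = fxx x t / (1 + (fx x t)\<^sup>2)" if "t \<ge> 0" for x t
    using mc that unfolding moves_by_mean_curvature_def
    by (intro DERIV_unique_halfline[OF f(2)[OF that] _ that]) (metis dd that)
  have fxt_eq: "fxt x 0 = ftx x 0" for x
    by (rule mixed_partials_at_0[OF f(1,2) fx(2) ft(1) cont(2) cont(5)])
  have fxxt_eq: "fxxt x 0 = fxtx x 0" for x
    by (rule mixed_partials_at_0[OF fx(1,2) fxx fxt(1) cont(4) cont(8)])
  have D1: "D 1 0 = 0" using d0 by (simp add: D_def)
  have pos: "1 + (z::real)\<^sup>2 \<noteq> 0" for z using zero_le_power2[of z] by linarith
  have ftx_eq: "ftx x 0 = D 3 x / (1 + (D 1 x)\<^sup>2) - 2 * D 1 x * (D 2 x)\<^sup>2 / (1 + (D 1 x)\<^sup>2)\<^sup>2" for x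
  proof (rule DERIV_unique)
    show "((\<lambda>\<xi>. ft \<xi> 0) has_real_derivative ftx x 0) (at x)" by (rule ft(1)) simp
    have "((\<lambda>\<xi>. D 2 \<xi> / (1 + (D 1 \<xi>)\<^sup>2)) has_real_derivative
        (D 3 x * (1 + (D 1 x)\<^sup>2) - D 2 x * (2 * D 1 x * D 2 x)) / ((1 + (D 1 x)\<^sup>2) * (1 + (D 1 x)\<^sup>2))) (at x)"
      by (rule DERIV_divide) (use D[of 2 x] D[of 1 x] pos in \<open>auto intro!: derivative_eq_intros simp: eval_nat_numeral\<close>)
    moreover have "(D 3 x * (1 + (D 1 x)\<^sup>2) - D 2 x * (2 * D 1 x * D 2 x)) / ((1 + (D 1 x)\<^sup>2) * (1 + (D 1 x)\<^sup>2))
        = D 3 x / (1 + (D 1 x)\<^sup>2) - 2 * D 1 x * (D 2 x)\<^sup>2 / (1 + (D 1 x)\<^sup>2)\<^sup>2"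
      using pos[of "D 1 x"] by (simp add: diff_divide_distrib power2_eq_square mult_ac)
    ultimately show "((\<lambda>\<xi>. ft \<xi> 0) has_real_derivative D 3 x / (1 + (D 1 x)\<^sup>2) - 2 * D 1 x * (D 2 x)\<^sup>2 / (1 + (D 1 x)\<^sup>2)\<^sup>2) (at x)"
      by (simp add: ft_eq fx_D fxx_D)
  qed
  \<comment> \<open>As \<open>D 1\<close> vanishes at 0, the first quotient contributes
    \<open>D 4 0\<close> and the second -2 \<open>D 2 0 ^ 3\<close>; the Taylor factor 1/2 later
    gives f_xxxx/2 - f_xx^3.\<close>
  have fxtx_0: "fxtx 0 0 = D 4 0 - 2 * D 2 0 ^ 3"
  proof (rule DERIV_unique)
    show "((\<lambda>\<xi>. fxt \<xi> 0) has_real_derivative fxtx 0 0) (at 0)" by (rule fxt(1)) simp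
    have A: "((\<lambda>x. 1 + (D 1 x)\<^sup>2) has_real_derivative 2 * D 1 0 * D 2 0) (at 0)"
      using D[of 1 0] by (auto intro!: derivative_eq_intros simp: numeral_2_eq_2)
    have N: "((\<lambda>x. 2 * D 1 x * (D 2 x)\<^sup>2) has_real_derivative 2 * D 2 0 * (D 2 0)\<^sup>2 + 2 * D 1 0 * (2 * D 2 0 * D 3 0)) (at 0)"
      using D[of 1 0] D[of 2 0] by (auto intro!: derivative_eq_intros simp: eval_nat_numeral)
    have D3: "(D 3 has_real_derivative D 4 0) (at 0)" using D[of 3 0] by (simp add: eval_nat_numeral)
    show "((\<lambda>\<xi>. fxt \<xi> 0) has_real_derivative D 4 0 - 2 * D 2 0 ^ 3) (at 0)"
      unfolding fxt_eq ftx_eq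
      by (rule DERIV_cong[OF DERIV_diff[OF DERIV_divide[OF D3 A pos] DERIV_divide[OF N DERIV_power[OF A, of 2]]]])
         (use D1 pos in \<open>simp_all add: power2_eq_square power3_eq_cube\<close>)
  qed
  have ftt_0: "ftt 0 0 = D 4 0 - 2 * D 2 0 ^ 3"
  proof (rule DERIV_unique_halfline)
    show "(ft 0 has_real_derivative ftt 0 0) (at 0 within {0..})" by (rule ft(2)) simp
    have A: "((\<lambda>t. 1 + (fx 0 t)\<^sup>2) has_real_derivative 2 * fx 0 0 * fxt 0 0) (at 0 within {0..})"
      using fx(2)[of 0 0] by (auto intro!: derivative_eq_intros)
    have "((\<lambda>t. fxx 0 t / (1 + (fx 0 t)\<^sup>2)) has_real_derivative
        (fxxt 0 0 * (1 + (fx 0 0)\<^sup>2) - fxx 0 0 * (2 * fx 0 0 * fxt 0 0)) / ((1 + (fx 0 0)\<^sup>2) * (1 + (fx 0 0)\<^sup>2))) (at 0 within {0..})"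
      by (rule DERIV_divide[OF fxx A pos]) simp
    then have "((\<lambda>t. fxx 0 t / (1 + (fx 0 t)\<^sup>2)) has_real_derivative D 4 0 - 2 * D 2 0 ^ 3) (at 0 within {0..})"
      using D1 by (simp add: fx_D fxxt_eq fxtx_0)
    then show "(ft 0 has_real_derivative D 4 0 - 2 * D 2 0 ^ 3) (at 0 within {0..})"
      by (rule has_field_derivative_transform_within[where d = 1]) (auto simp: ft_eq)
  qed simp
  have ft_0: "ft 0 0 = D 2 0" using D1 by (simp add: ft_eq fx_D fxx_D)
  have "(\<lambda>t. f 0 t - (f 0 0 + t * ft 0 0 + t\<^sup>2 / 2 * ftt 0 0)) \<in> O[at_right 0](\<lambda>t. t ^ 3)"
    by (rule taylor_2_halfline[OF f(2) ft(2) ftt(1) continuous_on_section[OF cont(7)]])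
  then show ?thesis using assms(2) by (simp add: ft_0 ftt_0)
qed

section \<open>The hairclip solution\<close>

lemma Ck_halfplane_SucI_within:
  assumes "\<And>x t. t \<ge> 0 \<Longrightarrow> ((\<lambda>\<xi>. f \<xi> t) has_real_derivative fx x t) (at x)"
    "\<And>x t. t \<ge> 0 \<Longrightarrow> ((\<lambda>s. f x s) has_real_derivative ft x t) (at t within {0..})"
    "continuous_on (UNIV \<times> {0..}) (\<lambda>(x, t). f x t)" "Ck_halfplane k fx" "Ck_halfplane k ft"
  shows "Ck_halfplane (Suc k) f"
  unfolding Ck_halfplane.simps(2) using assms by blast

lemma Ck_halfplane_SucI:
  assumes "\<And>x t. ((\<lambda>\<xi>. f \<xi> t) has_real_derivative fx x t) (at x)"
    "\<And>x t. ((\<lambda>s. f x s) has_real_derivative ft x t) (at t)"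
    "continuous_on UNIV (\<lambda>(x, t). f x t)" "Ck_halfplane k fx" "Ck_halfplane k ft"
  shows "Ck_halfplane (Suc k) f"
  by (rule Ck_halfplane_SucI_within[OF assms(1) has_field_derivative_at_within[OF assms(2)]
        continuous_on_subset[OF assms(3)] assms(4,5)]) simp

lemma Ck_halfplane_const: "Ck_halfplane k (\<lambda>x t. c)"
proof (induction k arbitrary: c)
  case (Suc k)
  show ?case by (rule Ck_halfplane_SucI[where fx = "\<lambda>x t. 0" and ft = "\<lambda>x t. 0"]) (auto intro: Suc simp: case_prod_beta')
qed (auto simp: case_prod_beta')

lemma Ck_halfplane_SucD: "Ck_halfplane (Suc k) f \<Longrightarrow> Ck_halfplane k f"
proof (induction k arbitrary: f)
  case (Suc k)
  from Ck_halfplane_SucE[OF Suc.prems] obtain fx ft where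
    f: "\<And>x t. t \<ge> 0 \<Longrightarrow> ((\<lambda>\<xi>. f \<xi> t) has_real_derivative fx x t) (at x)"
    "\<And>x t. t \<ge> 0 \<Longrightarrow> ((\<lambda>s. f x s) has_real_derivative ft x t) (at t within {0..})"
    "Ck_halfplane (Suc k) fx" "Ck_halfplane (Suc k) ft" by blast
  show ?case
    by (rule Ck_halfplane_SucI_within[OF f(1,2) Ck_halfplane_continuous[OF Suc.prems] Suc.IH[OF f(3)] Suc.IH[OF f(4)]])
qed (simp add: Ck_halfplane_continuous)

lemma Ck_halfplane_add:
  "Ck_halfplane k f \<Longrightarrow> Ck_halfplane k g \<Longrightarrow> Ck_halfplane k (\<lambda>x t. f x t + g x t)"
proof (induction k arbitrary: f g)
  case 0
  then show ?case using continuous_on_add[of "UNIV \<times> {0..}" "\<lambda>(x, t). f x t" "\<lambda>(x, t). g x t"]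
    by (simp add: case_prod_beta')
next
  case (Suc k)
  note c = continuous_on_add[OF Ck_halfplane_continuous[OF Suc.prems(1)] Ck_halfplane_continuous[OF Suc.prems(2)]]
  from Ck_halfplane_SucE[OF Suc.prems(1)] obtain fx ft where
    f: "\<And>x t. t \<ge> 0 \<Longrightarrow> ((\<lambda>\<xi>. f \<xi> t) has_real_derivative fx x t) (at x)"
    "\<And>x t. t \<ge> 0 \<Longrightarrow> ((\<lambda>s. f x s) has_real_derivative ft x t) (at t within {0..})"
    "Ck_halfplane k fx" "Ck_halfplane k ft" by blast
  from Ck_halfplane_SucE[OF Suc.prems(2)] obtain gx gt where
    g: "\<And>x t. t \<ge> 0 \<Longrightarrow> ((\<lambda>\<xi>. g \<xi> t) has_real_derivative gx x t) (at x)"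
    "\<And>x t. t \<ge> 0 \<Longrightarrow> ((\<lambda>s. g x s) has_real_derivative gt x t) (at t within {0..})"
    "Ck_halfplane k gx" "Ck_halfplane k gt" by blast
  show ?case
  proof (rule Ck_halfplane_SucI_within[where fx = "\<lambda>x t. fx x t + gx x t" and ft = "\<lambda>x t. ft x t + gt x t"])
    show "continuous_on (UNIV \<times> {0..}) (\<lambda>(x, t). f x t + g x t)" using c by (simp add: case_prod_beta')
  qed (auto intro: DERIV_add f g Suc.IH)
qed

lemma Ck_halfplane_mult:
  "Ck_halfplane k f \<Longrightarrow> Ck_halfplane k g \<Longrightarrow> Ck_halfplane k (\<lambda>x t. f x t * g x t)"
proof (induction k arbitrary: f g)
  case 0
  then show ?case using continuous_on_mult[of "UNIV \<times> {0..}" "\<lambda>(x, t). f x t" "\<lambda>(x, t). g x t"]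
    by (simp add: case_prod_beta')
next
  case (Suc k)
  note c = continuous_on_mult[OF Ck_halfplane_continuous[OF Suc.prems(1)] Ck_halfplane_continuous[OF Suc.prems(2)]]
  note l = Ck_halfplane_SucD[OF Suc.prems(1)] Ck_halfplane_SucD[OF Suc.prems(2)]
  from Ck_halfplane_SucE[OF Suc.prems(1)] obtain fx ft where
    f: "\<And>x t. t \<ge> 0 \<Longrightarrow> ((\<lambda>\<xi>. f \<xi> t) has_real_derivative fx x t) (at x)"
    "\<And>x t. t \<ge> 0 \<Longrightarrow> ((\<lambda>s. f x s) has_real_derivative ft x t) (at t within {0..})"
    "Ck_halfplane k fx" "Ck_halfplane k ft" by blast
  from Ck_halfplane_SucE[OF Suc.prems(2)] obtain gx gt where
    g: "\<And>x t. t \<ge> 0 \<Longrightarrow> ((\<lambda>\<xi>. g \<xi> t) has_real_derivative gx x t) (at x)"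
    "\<And>x t. t \<ge> 0 \<Longrightarrow> ((\<lambda>s. g x s) has_real_derivative gt x t) (at t within {0..})"
    "Ck_halfplane k gx" "Ck_halfplane k gt" by blast
  show ?case
  proof (rule Ck_halfplane_SucI_within[where fx = "\<lambda>x t. fx x t * g x t + gx x t * f x t" and ft = "\<lambda>x t. ft x t * g x t + gt x t * f x t"])
    show "continuous_on (UNIV \<times> {0..}) (\<lambda>(x, t). f x t * g x t)" using c by (simp add: case_prod_beta')
  qed (auto intro!: DERIV_mult f g Ck_halfplane_add Suc.IH l)
qed

context
  fixes a :: real
begin

text \<open>The polynomials in u, v and w form a ring closed under both partial derivatives, since
  w_x = a^2 u v w^3 and w_t = a^2 u^2 w^3. Smoothness of the solution thus reduces to one
  simultaneous induction.\<close>

definition clip_u :: "real \<Rightarrow> real \<Rightarrow> real" where "clip_u x t = exp (- t) * cos x"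
definition clip_v :: "real \<Rightarrow> real \<Rightarrow> real" where "clip_v x t = exp (- t) * sin x"
definition clip_w :: "real \<Rightarrow> real \<Rightarrow> real" where "clip_w x t = 1 / sqrt ((a * clip_u x t)\<^sup>2 + 1)"

text \<open>Shifted by arsinh a so as to pass through the origin at time 0; the flow is invariant
  under vertical translations.\<close>

definition hairclip :: "real \<Rightarrow> real \<Rightarrow> real" where "hairclip x t = arsinh (a * clip_u x t) - arsinh a"

lemma clip_root_pos: "sqrt ((a * clip_u x t)\<^sup>2 + 1) > 0"
  using zero_le_power2[of "a * clip_u x t"] by (simp add: add_nonneg_pos)

lemma clip_derivs:
  "((\<lambda>x. clip_u x t) has_real_derivative - clip_v x t) (at x)"
  "((\<lambda>t. clip_u x t) has_real_derivative - clip_u x t) (at t)"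
  "((\<lambda>x. clip_v x t) has_real_derivative clip_u x t) (at x)"
  "((\<lambda>t. clip_v x t) has_real_derivative - clip_v x t) (at t)"
  unfolding clip_u_def clip_v_def by (auto intro!: derivative_eq_intros)

lemma inverse_sqrt_deriv:
  assumes "(p has_real_derivative p') (at x)"
  shows "((\<lambda>x. 1 / sqrt ((p x)\<^sup>2 + 1)) has_real_derivative - (p x * p') * (1 / sqrt ((p x)\<^sup>2 + 1)) ^ 3) (at x)"
proof -
  have pos: "(p x)\<^sup>2 + 1 > 0" by (simp add: add_nonneg_pos)
  have "((\<lambda>x. (p x)\<^sup>2 + 1) has_real_derivative 2 * p x * p') (at x)"
    using assms by (auto intro!: derivative_eq_intros)
  from DERIV_chain2[OF DERIV_real_sqrt[OF pos] this]
  have s: "((\<lambda>x. sqrt ((p x)\<^sup>2 + 1)) has_real_derivative inverse (sqrt ((p x)\<^sup>2 + 1)) / 2 * (2 * p x * p')) (at x)" .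
  have "sqrt ((p x)\<^sup>2 + 1) \<noteq> 0" using pos by simp
  from DERIV_inverse'[OF s this] show ?thesis
    by (simp add: inverse_eq_divide power3_eq_cube mult_ac)
qed

lemma clip_w_derivs:
  "((\<lambda>x. clip_w x t) has_real_derivative a\<^sup>2 * (clip_u x t * clip_v x t * clip_w x t ^ 3)) (at x)"
  "((\<lambda>t. clip_w x t) has_real_derivative a\<^sup>2 * (clip_u x t ^ 2 * clip_w x t ^ 3)) (at t)"
proof -
  have "((\<lambda>x. a * clip_u x t) has_real_derivative a * - clip_v x t) (at x)"
    "((\<lambda>t. a * clip_u x t) has_real_derivative a * - clip_u x t) (at t)"
    by (intro DERIV_cmult clip_derivs)+
  from this[THEN inverse_sqrt_deriv]
  show "((\<lambda>x. clip_w x t) has_real_derivative a\<^sup>2 * (clip_u x t * clip_v x t * clip_w x t ^ 3)) (at x)"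
    "((\<lambda>t. clip_w x t) has_real_derivative a\<^sup>2 * (clip_u x t ^ 2 * clip_w x t ^ 3)) (at t)"
    unfolding clip_w_def[symmetric] by (simp_all add: power2_eq_square mult_ac)
qed

lemma hairclip_derivs:
  "((\<lambda>x. hairclip x t) has_real_derivative - a * (clip_v x t * clip_w x t)) (at x)"
  "((\<lambda>t. hairclip x t) has_real_derivative - a * (clip_u x t * clip_w x t)) (at t)"
proof -
  have *: "((\<lambda>x. arsinh (p x) - arsinh a) has_real_derivative 1 / sqrt ((p x)\<^sup>2 + 1) * p') (at x)"
    if "(p has_real_derivative p') (at x)" for p p' x
    using DERIV_diff[OF DERIV_chain2[OF arsinh_real_has_field_derivative that] DERIV_const[of "arsinh a"]] by simp
  show "((\<lambda>x. hairclip x t) has_real_derivative - a * (clip_v x t * clip_w x t)) (at x)"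
    "((\<lambda>t. hairclip x t) has_real_derivative - a * (clip_u x t * clip_w x t)) (at t)"
    using *[OF DERIV_cmult[OF clip_derivs(1), of a]] *[OF DERIV_cmult[OF clip_derivs(2), of a]]
    unfolding hairclip_def clip_w_def by (simp_all add: mult_ac)
qed

lemma continuous_clip:
  "continuous_on UNIV (\<lambda>(x, t). clip_u x t)" "continuous_on UNIV (\<lambda>(x, t). clip_v x t)"
  "continuous_on UNIV (\<lambda>(x, t). clip_w x t)" "continuous_on UNIV (\<lambda>(x, t). hairclip x t)"
proof -
  have u: "continuous_on UNIV (\<lambda>q. clip_u (fst q) (snd q))" and v: "continuous_on UNIV (\<lambda>q. clip_v (fst q) (snd q))"
    unfolding clip_u_def clip_v_def by (intro continuous_intros)+
  have "continuous_on UNIV (\<lambda>q. clip_w (fst q) (snd q))"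
    unfolding clip_w_def by (intro continuous_intros u) (use clip_root_pos in \<open>auto simp: less_imp_neq[symmetric]\<close>)
  moreover have "continuous_on UNIV (\<lambda>q. hairclip (fst q) (snd q))"
    unfolding hairclip_def by (intro continuous_intros continuous_on_compose2[OF continuous_on_arsinh[of UNIV]] u) auto
  ultimately show "continuous_on UNIV (\<lambda>(x, t). clip_u x t)" "continuous_on UNIV (\<lambda>(x, t). clip_v x t)"
    "continuous_on UNIV (\<lambda>(x, t). clip_w x t)" "continuous_on UNIV (\<lambda>(x, t). hairclip x t)"
    using u v by (simp_all add: case_prod_beta')
qed

lemma Ck_clip: "Ck_halfplane k clip_u \<and> Ck_halfplane k clip_v \<and> Ck_halfplane k clip_w"
proof (induction k)
  case 0
  show ?case using continuous_clip by (auto intro: continuous_on_subset)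
next
  case (Suc k)
  then have u: "Ck_halfplane k clip_u" and v: "Ck_halfplane k clip_v" and w: "Ck_halfplane k clip_w" by auto
  have neg: "Ck_halfplane k (\<lambda>x t. - g x t)" if "Ck_halfplane k g" for g
    using Ck_halfplane_mult[OF Ck_halfplane_const[of k "-1"] that] by simp
  note m = Ck_halfplane_mult
  have w3: "Ck_halfplane k (\<lambda>x t. clip_w x t ^ 3)" using m[OF m[OF w w] w] by (simp add: power3_eq_cube)
  have u2: "Ck_halfplane k (\<lambda>x t. clip_u x t ^ 2)" using m[OF u u] by (simp add: power2_eq_square)
  show ?case
    by (intro conjI Ck_halfplane_SucI[OF clip_derivs(1,2)] Ck_halfplane_SucI[OF clip_derivs(3,4)] Ck_halfplane_SucI[OF clip_w_derivs]
        continuous_clip neg u v m[OF Ck_halfplane_const] m[OF m[OF u v] w3] m[OF u2 w3])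
qed

lemma smooth_hairclip: "smooth_halfplane hairclip"
  unfolding smooth_halfplane_def
proof
  fix k
  note m = Ck_halfplane_mult
  have "Ck_halfplane (Suc k) hairclip"
    by (intro Ck_halfplane_SucI[OF hairclip_derivs] continuous_clip m[OF Ck_halfplane_const] m) (use Ck_clip in auto)
  then show "Ck_halfplane k hairclip" by (rule Ck_halfplane_SucD)
qed

text \<open>Differentiating v w gives u w + a^2 u v^2 w^3 = u w (1 + a^2 v^2 w^2). The right-hand
  side is therefore f_t (1 + f_x^2), which is the equation of motion by mean curvature.\<close>

lemma hairclip_xx:
  "((\<lambda>x. - a * (clip_v x t * clip_w x t)) has_real_derivative
      - a * (clip_u x t * clip_w x t) * (1 + (- a * (clip_v x t * clip_w x t))\<^sup>2)) (at x)"
  by (rule DERIV_cong[OF DERIV_cmult[OF DERIV_mult[OF clip_derivs(3) clip_w_derivs(1)]]])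
     (simp add: power2_eq_square power3_eq_cube algebra_simps)

lemma hairclip_deriv: "deriv (\<lambda>\<xi>. hairclip \<xi> t) = (\<lambda>x. - a * (clip_v x t * clip_w x t))"
  by (rule ext, rule DERIV_imp_deriv, rule hairclip_derivs)

lemma hairclip_deriv2: "(deriv ^^ 2) (\<lambda>\<xi>. hairclip \<xi> t) =
    (\<lambda>x. - a * (clip_u x t * clip_w x t) * (1 + (- a * (clip_v x t * clip_w x t))\<^sup>2))"
  unfolding numeral_2_eq_2 funpow.simps o_def id_def hairclip_deriv
  by (rule ext, rule DERIV_imp_deriv, rule hairclip_xx[unfolded numeral_2_eq_2])

lemma hairclip_moves: "moves_by_mean_curvature hairclip"
  unfolding moves_by_mean_curvature_def hairclip_deriv hairclip_deriv2
proof (intro allI impI)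
  fix x t :: real assume "t \<ge> 0"
  have "1 + (- a * (clip_v x t * clip_w x t))\<^sup>2 \<noteq> 0"
    using zero_le_power2[of "- a * (clip_v x t * clip_w x t)"] by linarith
  then show "(hairclip x has_real_derivative - a * (clip_u x t * clip_w x t) * (1 + (- a * (clip_v x t * clip_w x t))\<^sup>2) /
        (1 + (- a * (clip_v x t * clip_w x t))\<^sup>2)) (at t within {0..})"
    using has_field_derivative_at_within[OF hairclip_derivs(2)] by simp
qed

lemma clip_at_0: "clip_u 0 0 = 1" "clip_v 0 0 = 0" "clip_w 0 0 = 1 / sqrt (a\<^sup>2 + 1)"
  by (simp_all add: clip_u_def clip_v_def clip_w_def)

lemma hairclip_0: "hairclip 0 0 = 0" "deriv (\<lambda>\<xi>. hairclip \<xi> 0) 0 = 0"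
  unfolding hairclip_deriv by (simp_all add: hairclip_def clip_at_0)

lemma hairclip_second: "(deriv ^^ 2) (\<lambda>\<xi>. hairclip \<xi> 0) 0 = - a / sqrt (a\<^sup>2 + 1)"
  unfolding hairclip_deriv2 by (simp add: clip_at_0)

lemma hairclip_fourth: "(deriv ^^ 4) (\<lambda>\<xi>. hairclip \<xi> 0) 0 = a / sqrt (a\<^sup>2 + 1) - 3 * (a / sqrt (a\<^sup>2 + 1)) ^ 3"
proof -
  let ?u = "\<lambda>x. clip_u x 0" and ?v = "\<lambda>x. clip_v x 0" and ?w = "\<lambda>x. clip_w x 0"
  note d = clip_derivs(1)[of 0] clip_derivs(3)[of 0] clip_w_derivs(1)[of 0]
  \<comment> \<open>The third derivative as a sum of monomials. Since v = 0 at the origin, only the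
    two monomials linear in v contribute to its derivative there.\<close>
  define T where "T x = a * (?v x * ?w x) - 3 * a ^ 3 * (?u x ^ 2 * ?v x * ?w x ^ 3) + a ^ 3 * (?v x ^ 3 * ?w x ^ 3)
      - 3 * a ^ 5 * (?u x ^ 2 * ?v x ^ 3 * ?w x ^ 5)" for x
  have 3: "((\<lambda>x. - a * (?u x * ?w x) * (1 + (- a * (?v x * ?w x))\<^sup>2)) has_real_derivative T x) (at x)" for x
    by (auto intro!: derivative_eq_intros d simp: T_def eval_nat_numeral algebra_simps)
  have 4: "(T has_real_derivative a * ?w 0 - 3 * a ^ 3 * ?w 0 ^ 3) (at 0)"
    unfolding T_def by (auto intro!: derivative_eq_intros d simp: clip_at_0(1,2))
  have "deriv (\<lambda>x. - a * (?u x * ?w x) * (1 + (- a * (?v x * ?w x))\<^sup>2)) = T"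
    by (rule ext, rule DERIV_imp_deriv, rule 3)
  moreover have "(deriv ^^ 4) (\<lambda>\<xi>. hairclip \<xi> 0) = deriv (deriv ((deriv ^^ 2) (\<lambda>\<xi>. hairclip \<xi> 0)))"
    by (simp add: eval_nat_numeral)
  ultimately have "(deriv ^^ 4) (\<lambda>\<xi>. hairclip \<xi> 0) = deriv T" unfolding hairclip_deriv2 by simp
  then show ?thesis using DERIV_imp_deriv[OF 4] by (simp add: clip_at_0 power_divide)
qed

end

section \<open>From the error of one step to the two conditions\<close>

lemma coefficient_zero_of_bigo:
  fixes A :: real
  assumes "(\<lambda>t. t\<^sup>2 * A) \<in> O[at_right 0](\<lambda>t. t ^ 3)"
  shows "A = 0"
proof -
  obtain c where c: "c > 0" "\<forall>\<^sub>F t in at_right 0. norm (t\<^sup>2 * A) \<le> c * norm (t ^ 3)"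
    using landau_o.bigE[OF assms] by blast
  have "\<forall>\<^sub>F t in at_right (0::real). 0 < t" by (simp add: eventually_at_right_less)
  with c(2) have "\<forall>\<^sub>F t in at_right 0. \<bar>A\<bar> \<le> c * t"
  proof eventually_elim
    case (elim t)
    then have "t\<^sup>2 * \<bar>A\<bar> \<le> t\<^sup>2 * (c * t)" by (simp add: abs_mult power2_eq_square power3_eq_cube mult_ac)
    then show ?case using elim by simp
  qed
  moreover have "((\<lambda>t. c * t) \<longlongrightarrow> c * 0) (at_right 0)" by (intro tendsto_intros)
  ultimately have "\<bar>A\<bar> \<le> c * 0" by (intro tendsto_lowerbound[where F = "at_right (0::real)"]) auto
  then show ?thesis by simp
qed

text \<open>With \<tau> = \<delta> / \<open>beta1 \<gamma> M\<close> the linear terms of the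
  computed and the exact height agree. What remains up to O(\<delta>^3) is \<delta>^2 times a
  combination of f_xxxx and f_xx^3 whose coefficients are the defects of the two conditions.\<close>

lemma one_step_error:
  fixes \<gamma> :: "nat \<Rightarrow> nat \<Rightarrow> real"
  assumes w: "\<And>m. Suc m \<le> M \<Longrightarrow> (\<Sum>i\<le>m. \<gamma> (Suc m) i) = 1" and pos: "beta1 \<gamma> M > 0"
    and f: "smooth_halfplane f" "f 0 0 = 0" "deriv (\<lambda>x. f x 0) 0 = 0" "moves_by_mean_curvature f"
  obtains r h where "r > 0"
    "\<forall>\<^sub>F \<delta> in at_right 0. interface_near r (threshold_step \<gamma> M \<delta> (subgraph (\<lambda>x. f x 0))) (h \<delta>)"
    "(\<lambda>\<delta>. h \<delta> 0 - f 0 \<delta> - \<delta>\<^sup>2 * ((beta2 \<gamma> M / (beta1 \<gamma> M)\<^sup>2 - 1 / 2) * (deriv ^^ 4) (\<lambda>x. f x 0) 0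
       - (beta3 \<gamma> M / (beta1 \<gamma> M)\<^sup>2 - 1) * (deriv ^^ 2) (\<lambda>x. f x 0) 0 ^ 3)) \<in> O[at_right 0](\<lambda>\<delta>. \<delta> ^ 3)"
proof -
  define D where "D n = (deriv ^^ n) (\<lambda>x. f x 0)" for n
  define \<beta> where "\<beta> = beta1 \<gamma> M"
  interpret stages D \<gamma> M
    by unfold_locales (use smooth_halfplane_D[OF f(1)] f w in \<open>auto simp: D_def\<close>)
  have D0: "D 0 = (\<lambda>x. f x 0)" by (simp add: D_def)
  obtain r h where r: "r > 0" and h:
    "\<forall>\<^sub>F \<tau> in at_right 0. interface_near r (stage \<gamma> \<tau> (subgraph (D 0)) M) (h M \<tau>)"
    "(\<lambda>\<tau>. h M \<tau> 0 - (\<tau> * beta1 \<gamma> M * D 2 0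
         + \<tau>\<^sup>2 * (beta2 \<gamma> M * D 4 0 - beta3 \<gamma> M * D 2 0 ^ 3))) \<in> O[at_right 0](\<lambda>\<tau>. \<tau> ^ 3)"
  proof -
    from all_interfaces obtain r h where "r > 0" and "\<forall>i\<le>M.
     (\<forall>\<^sub>F \<tau> in at_right 0. interface_near r (stage \<gamma> \<tau> (subgraph (D 0)) i) (h i \<tau>) \<and>
        (\<forall>x. \<bar>x\<bar> < r \<longrightarrow> h i \<tau> differentiable (at x)) \<and> deriv (h i \<tau>) differentiable (at 0)) \<and>
     (\<lambda>\<tau>. h i \<tau> 0 - (\<tau> * beta1 \<gamma> i * D 2 0
         + \<tau>\<^sup>2 * (beta2 \<gamma> i * D 4 0 - beta3 \<gamma> i * D 2 0 ^ 3))) \<in> O[at_right 0](\<lambda>\<tau>. \<tau> ^ 3) \<and>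
     (\<lambda>\<tau>. (deriv ^^ 2) (h i \<tau>) 0 - (D 2 0
         + \<tau> * (beta4 \<gamma> i * D 4 0 - beta5 \<gamma> i * D 2 0 ^ 3))) \<in> O[at_right 0](\<lambda>\<tau>. \<tau>\<^sup>2)"
      by blast
    note this(1) this(2)[rule_format, OF order_refl]
    then show thesis by (intro that[of r h]) (auto elim: eventually_mono)
  qed
  have lim: "filterlim (\<lambda>\<delta>. \<delta> / \<beta>) (at_right 0) (at_right 0)"
  proof (rule filterlim_at_withinI)
    show "((\<lambda>\<delta>. \<delta> / \<beta>) \<longlongrightarrow> 0) (at_right 0)"
      using tendsto_divide[OF tendsto_ident_at[of 0 "{0<..}"] tendsto_const[of \<beta>]] pos by (simp add: \<beta>_def)
    show "\<forall>\<^sub>F \<delta> in at_right 0. \<delta> / \<beta> \<in> {0<..} - {0}"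
      using eventually_at_right_less[of "0::real"] by eventually_elim (use pos in \<open>simp add: \<beta>_def\<close>)
  qed
  show ?thesis
  proof (rule that[OF r, where h = "\<lambda>\<delta>. h M (\<delta> / \<beta>)"])
    show "\<forall>\<^sub>F \<delta> in at_right 0. interface_near r (threshold_step \<gamma> M \<delta> (subgraph (\<lambda>x. f x 0))) (h M (\<delta> / \<beta>))"
      using eventually_compose_filterlim[OF h(1) lim] by (simp add: threshold_step_def \<beta>_def D0)
    have "(\<lambda>\<delta>. h M (\<delta> / \<beta>) 0 - ((\<delta> / \<beta>) * \<beta> * D 2 0 + (\<delta> / \<beta>)\<^sup>2 * (beta2 \<gamma> M * D 4 0 - beta3 \<gamma> M * D 2 0 ^ 3)))
        \<in> O[at_right 0](\<lambda>\<delta>. (\<delta> / \<beta>) ^ 3)"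
      using landau_o.big.compose[OF h(2) lim] by (simp add: \<beta>_def)
    also have "(\<lambda>\<delta>. (\<delta> / \<beta>) ^ 3) = (\<lambda>\<delta>. (1 / \<beta> ^ 3) * \<delta> ^ 3)" by (simp add: power_divide)
    also have "O[at_right 0](\<lambda>\<delta>. (1 / \<beta> ^ 3) * \<delta> ^ 3) = O[at_right 0](\<lambda>\<delta>. \<delta> ^ 3)"
      by (rule landau_o.big.cmult) (use pos in \<open>simp add: \<beta>_def\<close>)
    finally have A: "(\<lambda>\<delta>. h M (\<delta> / \<beta>) 0 - ((\<delta> / \<beta>) * \<beta> * D 2 0 + (\<delta> / \<beta>)\<^sup>2 * (beta2 \<gamma> M * D 4 0 - beta3 \<gamma> M * D 2 0 ^ 3)))
        \<in> O[at_right 0](\<lambda>\<delta>. \<delta> ^ 3)" .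
    have B: "(\<lambda>t. f 0 t - (t * D 2 0 + t\<^sup>2 / 2 * (D 4 0 - 2 * D 2 0 ^ 3))) \<in> O[at_right 0](\<lambda>t. t ^ 3)"
      using mean_curvature_taylor[OF f] unfolding D_def .
    have eq: "h M (\<delta> / \<beta>) 0 - ((\<delta> / \<beta>) * \<beta> * D 2 0 + (\<delta> / \<beta>)\<^sup>2 * (beta2 \<gamma> M * D 4 0 - beta3 \<gamma> M * D 2 0 ^ 3))
        - (f 0 \<delta> - (\<delta> * D 2 0 + \<delta>\<^sup>2 / 2 * (D 4 0 - 2 * D 2 0 ^ 3)))
        = h M (\<delta> / \<beta>) 0 - f 0 \<delta> - \<delta>\<^sup>2 * ((beta2 \<gamma> M / \<beta>\<^sup>2 - 1 / 2) * D 4 0 - (beta3 \<gamma> M / \<beta>\<^sup>2 - 1) * D 2 0 ^ 3)" for \<delta>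
    proof -
      have "(\<delta> / \<beta>) * \<beta> = \<delta>" using pos by (simp add: \<beta>_def)
      moreover have "(\<delta> / \<beta>)\<^sup>2 * (beta2 \<gamma> M * D 4 0 - beta3 \<gamma> M * D 2 0 ^ 3)
          = \<delta>\<^sup>2 * (beta2 \<gamma> M / \<beta>\<^sup>2 * D 4 0 - beta3 \<gamma> M / \<beta>\<^sup>2 * D 2 0 ^ 3)"
        by (simp add: power_divide diff_divide_distrib right_diff_distrib)
      ultimately show ?thesis by (simp only:) (simp add: algebra_simps)
    qed
    show "(\<lambda>\<delta>. h M (\<delta> / \<beta>) 0 - f 0 \<delta> - \<delta>\<^sup>2 * ((beta2 \<gamma> M / (beta1 \<gamma> M)\<^sup>2 - 1 / 2) * (deriv ^^ 4) (\<lambda>x. f x 0) 0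
       - (beta3 \<gamma> M / (beta1 \<gamma> M)\<^sup>2 - 1) * (deriv ^^ 2) (\<lambda>x. f x 0) 0 ^ 3)) \<in> O[at_right 0](\<lambda>\<delta>. \<delta> ^ 3)"
      using sum_in_bigo(2)[OF A B] unfolding eq by (simp add: D_def \<beta>_def)
  qed
qed

lemma second_order_accurate_iff:
  fixes \<gamma> :: "nat \<Rightarrow> nat \<Rightarrow> real"
  assumes w: "\<And>m. Suc m \<le> M \<Longrightarrow> (\<Sum>i\<le>m. \<gamma> (Suc m) i) = 1" and pos: "beta1 \<gamma> M > 0"
  shows "second_order_accurate \<gamma> M \<longleftrightarrow>
        beta2 \<gamma> M / (beta1 \<gamma> M)\<^sup>2 = 1 / 2 \<and> beta3 \<gamma> M / (beta1 \<gamma> M)\<^sup>2 = 1"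
proof
  assume c: "beta2 \<gamma> M / (beta1 \<gamma> M)\<^sup>2 = 1 / 2 \<and> beta3 \<gamma> M / (beta1 \<gamma> M)\<^sup>2 = 1"
  show "second_order_accurate \<gamma> M"
    unfolding second_order_accurate_def
  proof (intro allI impI)
    fix f assume f: "smooth_halfplane f \<and> f 0 0 = 0 \<and> deriv (\<lambda>x. f x 0) 0 = 0 \<and> moves_by_mean_curvature f"
    obtain r h where rh: "r > 0"
      "\<forall>\<^sub>F \<delta> in at_right 0. interface_near r (threshold_step \<gamma> M \<delta> (subgraph (\<lambda>x. f x 0))) (h \<delta>)"
      "(\<lambda>\<delta>. h \<delta> 0 - f 0 \<delta> - \<delta>\<^sup>2 * ((beta2 \<gamma> M / (beta1 \<gamma> M)\<^sup>2 - 1 / 2) * (deriv ^^ 4) (\<lambda>x. f x 0) 0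
         - (beta3 \<gamma> M / (beta1 \<gamma> M)\<^sup>2 - 1) * (deriv ^^ 2) (\<lambda>x. f x 0) 0 ^ 3)) \<in> O[at_right 0](\<lambda>\<delta>. \<delta> ^ 3)"
      using one_step_error[OF w pos, of f] f by blast
    show "\<exists>r>0. \<exists>h. (\<forall>\<^sub>F \<delta>t in at_right 0. interface_near r (threshold_step \<gamma> M \<delta>t (subgraph (\<lambda>x. f x 0))) (h \<delta>t)) \<and>
           (\<lambda>\<delta>t. h \<delta>t 0 - f 0 \<delta>t) \<in> O[at_right 0](\<lambda>\<delta>t. \<delta>t ^ 3)"
    proof (intro exI[of _ r] exI[of _ h] conjI rh(1,2))
      show "(\<lambda>\<delta>t. h \<delta>t 0 - f 0 \<delta>t) \<in> O[at_right 0](\<lambda>\<delta>t. \<delta>t ^ 3)" using rh(3) c by simp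
    qed
  qed
next
  assume acc: "second_order_accurate \<gamma> M"
  define p q where "p = beta2 \<gamma> M / (beta1 \<gamma> M)\<^sup>2 - 1 / 2" and "q = beta3 \<gamma> M / (beta1 \<gamma> M)\<^sup>2 - 1"
  \<comment> \<open>Second order accuracy on the hairclip with parameter a forces the \<delta>^2
    coefficient of its one-step error to vanish.\<close>
  have eq: "p * (deriv ^^ 4) (\<lambda>x. hairclip a x 0) 0 - q * (deriv ^^ 2) (\<lambda>x. hairclip a x 0) 0 ^ 3 = 0" for a
  proof -
    let ?f = "hairclip a"
    note f = smooth_hairclip[of a] hairclip_0[of a] hairclip_moves[of a]
    obtain r h where rh: "r > 0"
      "\<forall>\<^sub>F \<delta> in at_right 0. interface_near r (threshold_step \<gamma> M \<delta> (subgraph (\<lambda>x. ?f x 0))) (h \<delta>)"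
      "(\<lambda>\<delta>. h \<delta> 0 - ?f 0 \<delta> - \<delta>\<^sup>2 * (p * (deriv ^^ 4) (\<lambda>x. ?f x 0) 0 - q * (deriv ^^ 2) (\<lambda>x. ?f x 0) 0 ^ 3)) \<in> O[at_right 0](\<lambda>\<delta>. \<delta> ^ 3)"
      using one_step_error[OF w pos f] unfolding p_def q_def by blast
    obtain r' h' where rh': "r' > 0"
      "\<forall>\<^sub>F \<delta> in at_right 0. interface_near r' (threshold_step \<gamma> M \<delta> (subgraph (\<lambda>x. ?f x 0))) (h' \<delta>)"
      "(\<lambda>\<delta>. h' \<delta> 0 - ?f 0 \<delta>) \<in> O[at_right 0](\<lambda>\<delta>. \<delta> ^ 3)"
      using acc f unfolding second_order_accurate_def by blast
    \<comment> \<open>Accuracy provides some interface h', the expansion another one, h. They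
      describe the same set near the origin, so they agree at 0.\<close>
    have "\<forall>\<^sub>F \<delta> in at_right 0. h \<delta> 0 = h' \<delta> 0"
      using rh(2) rh'(2) by eventually_elim (use rh(1) rh'(1) in \<open>auto intro: interface_near_unique\<close>)
    then have "(\<lambda>\<delta>. h \<delta> 0 - ?f 0 \<delta>) \<in> O[at_right 0](\<lambda>\<delta>. \<delta> ^ 3)"
      by (intro landau_o.big.in_cong[THEN iffD1, OF _ rh'(3)]) (auto elim: eventually_mono)
    from sum_in_bigo(2)[OF this rh(3)]
    have "(\<lambda>\<delta>. \<delta>\<^sup>2 * (p * (deriv ^^ 4) (\<lambda>x. ?f x 0) 0 - q * (deriv ^^ 2) (\<lambda>x. ?f x 0) 0 ^ 3)) \<in> O[at_right 0](\<lambda>\<delta>. \<delta> ^ 3)"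
      by simp
    then show ?thesis by (rule coefficient_zero_of_bigo)
  qed
  have *: "p * (1 - 3 * s) + q * s = 0" if "s = a\<^sup>2 / (a\<^sup>2 + 1)" "a \<noteq> 0" for a s :: real
  proof -
    define T where "T = a / sqrt (a\<^sup>2 + 1)"
    have "a\<^sup>2 + 1 > 0" by (simp add: add_nonneg_pos)
    then have T: "T\<^sup>2 = s" "T \<noteq> 0" using that by (simp_all add: T_def power_divide)
    have "p * (T - 3 * T ^ 3) - q * (- T) ^ 3 = 0"
      using eq[of a] unfolding hairclip_second hairclip_fourth by (simp add: T_def)
    \<comment> \<open>Dividing by T \<noteq> 0 leaves a linear equation for p and q that depends on
      T^2 alone.\<close>
    then have "T * (p * (1 - 3 * T\<^sup>2) + q * T\<^sup>2) = 0" by (simp add: power2_eq_square power3_eq_cube algebra_simps)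
    then show ?thesis using T by simp
  qed
  \<comment> \<open>The values a = 1 and a = 2 give p = q and 7 p = 4 q.\<close>
  have "p = 0" "q = 0" using *[of "1/2" 1] *[of "4/5" 2] by simp_all
  then show "beta2 \<gamma> M / (beta1 \<gamma> M)\<^sup>2 = 1 / 2 \<and> beta3 \<gamma> M / (beta1 \<gamma> M)\<^sup>2 = 1" by (simp add: p_def q_def)
qed

theorem claim5p1:
  fixes \<gamma> :: "nat \<Rightarrow> nat \<Rightarrow> real" and M :: nat
  assumes "M \<ge> 1"
    and "\<And>m. 1 \<le> m \<Longrightarrow> m \<le> M \<Longrightarrow> (\<Sum>i<m. \<gamma> m i) = 1"
    and "beta1 \<gamma> M > 0"
  shows "(\<forall>f :: real \<Rightarrow> real \<Rightarrow> real.
      smooth_halfplane f \<and> f 0 0 = 0 \<and> deriv (\<lambda>x. f x 0) 0 = 0 \<longrightarrow>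
      (let fxx = (deriv ^^ 2) (\<lambda>x. f x 0) 0; fxxxx = (deriv ^^ 4) (\<lambda>x. f x 0) 0 in
       \<exists>r>0. \<exists>h :: nat \<Rightarrow> real \<Rightarrow> real \<Rightarrow> real. \<forall>i\<le>M.
         (\<forall>\<^sub>F \<tau> in at_right 0.
            interface_near r (stage \<gamma> \<tau> (subgraph (\<lambda>x. f x 0)) i) (h i \<tau>) \<and>
            (\<forall>x. \<bar>x\<bar> < r \<longrightarrow> h i \<tau> differentiable (at x)) \<and>
            deriv (h i \<tau>) differentiable (at 0)) \<and>
         (\<lambda>\<tau>. h i \<tau> 0 - (\<tau> * beta1 \<gamma> i * fxx
              + \<tau>\<^sup>2 * (beta2 \<gamma> i * fxxxx - beta3 \<gamma> i * fxx ^ 3))) \<in> O[at_right 0](\<lambda>\<tau>. \<tau> ^ 3) \<and>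
         (\<lambda>\<tau>. (deriv ^^ 2) (h i \<tau>) 0 - (fxx
              + \<tau> * (beta4 \<gamma> i * fxxxx - beta5 \<gamma> i * fxx ^ 3))) \<in> O[at_right 0](\<lambda>\<tau>. \<tau>\<^sup>2)))
    \<and> (second_order_accurate \<gamma> M \<longleftrightarrow>
        beta2 \<gamma> M / (beta1 \<gamma> M)\<^sup>2 = 1 / 2 \<and> beta3 \<gamma> M / (beta1 \<gamma> M)\<^sup>2 = 1)"
proof -
  \<comment> \<open>Row m summed over i < m in the hypothesis is row \<open>Suc m\<close> summed
    over i \<le> m in the recursions.\<close>
  have w: "(\<Sum>i\<le>m. \<gamma> (Suc m) i) = 1" if "Suc m \<le> M" for m
    using assms(2)[of "Suc m"] that by (simp add: lessThan_Suc_atMost)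
  have "\<exists>r>0. \<exists>h :: nat \<Rightarrow> real \<Rightarrow> real \<Rightarrow> real. \<forall>i\<le>M.
         (\<forall>\<^sub>F \<tau> in at_right 0.
            interface_near r (stage \<gamma> \<tau> (subgraph (\<lambda>x. f x 0)) i) (h i \<tau>) \<and>
            (\<forall>x. \<bar>x\<bar> < r \<longrightarrow> h i \<tau> differentiable (at x)) \<and>
            deriv (h i \<tau>) differentiable (at 0)) \<and>
         (\<lambda>\<tau>. h i \<tau> 0 - (\<tau> * beta1 \<gamma> i * (deriv ^^ 2) (\<lambda>x. f x 0) 0
              + \<tau>\<^sup>2 * (beta2 \<gamma> i * (deriv ^^ 4) (\<lambda>x. f x 0) 0 - beta3 \<gamma> i * (deriv ^^ 2) (\<lambda>x. f x 0) 0 ^ 3))) \<in> O[at_right 0](\<lambda>\<tau>. \<tau> ^ 3) \<and>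
         (\<lambda>\<tau>. (deriv ^^ 2) (h i \<tau>) 0 - ((deriv ^^ 2) (\<lambda>x. f x 0) 0
              + \<tau> * (beta4 \<gamma> i * (deriv ^^ 4) (\<lambda>x. f x 0) 0 - beta5 \<gamma> i * (deriv ^^ 2) (\<lambda>x. f x 0) 0 ^ 3))) \<in> O[at_right 0](\<lambda>\<tau>. \<tau>\<^sup>2)"
    if f: "smooth_halfplane f" "f 0 0 = 0" "deriv (\<lambda>x. f x 0) 0 = 0" for f :: "real \<Rightarrow> real \<Rightarrow> real"
  proof -
    interpret stages "\<lambda>n. (deriv ^^ n) (\<lambda>x. f x 0)" \<gamma> M
      by unfold_locales (use smooth_halfplane_D[OF f(1)] f w in auto)
    show ?thesis using all_interfaces unfolding funpow_0 .
  qed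
  then show ?thesis
    unfolding Let_def using second_order_accurate_iff[OF w assms(3)] by blast
qed

end
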